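(* There is an absolute constant $C>0$ such that the following holds. Let $X=(X_t)_{0\le t\le T}$ be an $\mathbb{R}^d$-valued càdlàg process, let $f\in L^2(\mathbb{R}^d)$ be real-valued, and let $\xi$ be an $\mathbb{R}^d$-valued random variable, independent of $X$, with bounded Lebesgue density $\mu$. For $u,v\in\mathbb{R}^d$ and $0\le t,t'\le T$ let $\varphi(u,t;v,t')=\mathbb{E}[e^{i\langle u,X_t\rangle+i\langle v,X_{t'}\rangle}]$. (i) Suppose that $t'\mapsto\varphi(u,t;v,t')$ is differentiable for all $u,v\in\mathbb{R}^d$, $0<t<t'<T$, and that $(t,t')\mapsto\partial_{t'}\varphi(u,t;v,t')$ belongs to $L^1(\mathbb{T}_{T,n})$ for all $u,v$. Then $$\|\Gamma_T(f(\cdot+\xi))-\widehat\Gamma_{T,n}(f(\cdot+\xi))\|_{L^2(\mathbb{P})}^2\le C\|\mu\|_\infty\int_{\mathbb{R}^d}|\mathcal{F}f(u)|^2\big(w_{T,n}^{(u)}+v_{T,n}^{(u)}\big)\,du,$$ where, with $g(u,t)=2-2\,\mathrm{Re}\,\varphi(u,\lfloor t\rfloor_{\Delta_n};-u,t)$, $$w_{T,n}^{(u)}=\Delta_n\int_{\Delta_n}^T|g(u,t)|\,dt+T\int_0^{\Delta_n}|g(u,t)|\,dt,$$ $$v_{T,n}^{(u)}=\Delta_n\int_{\mathbb{T}_{T,n}}\big|\partial_{t'}\varphi(u,t;-u,t')-\partial_{t'}\varphi(u,\lfloor t\rfloor_{\Delta_n};-u,t')\big|\,d(t,t').$$ (ii)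 If in addition $t\mapsto\partial_{t'}\varphi(u,t;v,t')$ is differentiable for $t<t'$ and $(t,t')\mapsto\partial^2_{tt'}\varphi(u,t;v,t')$ belongs to $L^1(\mathbb{T}_{T,n})$ for all $u,v$, then the upper bound in (i) holds with $v_{T,n}^{(u)}$ replaced by $$\tilde v_{T,n}^{(u)}=\Delta_n^2\int_{\mathbb{T}_{T,n}}\big|\partial^2_{tt'}\varphi(u,t;-u,t')\big|\,d(t,t').$$
   Context: $T>0$, $n\in\mathbb{N}$, $\Delta_n=T/n$, $t_k=k\Delta_n$ for $k=0,\dots,n$, and $\lfloor t\rfloor_{\Delta_n}=\lfloor t/\Delta_n\rfloor\Delta_n$. Occupation time functional and Riemann estimator for a measurable function $h$: $\Gamma_T(h)=\int_0^T h(X_t)\,dt$, $\widehat\Gamma_{T,n}(h)=\Delta_n\sum_{k=1}^n h(X_{t_{k-1}})$; thus $\Gamma_T(f(\cdot+\xi))=\int_0^T f(X_t+\xi)\,dt$ and $\widehat\Gamma_{T,n}(f(\cdot+\xi))=\Delta_n\sum_{k=1}^n f(X_{t_{k-1}}+\xi)$. $\mathbb{T}_{T,n}=\{(t,t')\in[0,T]^2:\ t\ge\Delta_n,\ t'>t+2\Delta_n\}$. The map $(u,t,v,t')\mapsto\varphi(u,t;v,t')$ is assumed jointly measurable. $\mathcal{F}f$ is the Fourier transform, $\mathcal{F}f(u)=\int_{\mathbb{R}^d}f(x)e^{i\langle u,x\rangle}dx$ for $f\in L^1\cap L^2$, extended to $L^2(\mathbb{R}^d)$. *)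

theory Defs
  imports "HOL-Probability.Probability"
begin

definition square_integrable :: "(real^'n \<Rightarrow> 'b::real_normed_vector) \<Rightarrow> bool" where
  "square_integrable h \<longleftrightarrow>
     h \<in> borel_measurable borel \<and> integrable lborel (\<lambda>x. (norm (h x))\<^sup>2)"

definition L2_converges ::
    "(nat \<Rightarrow> real^'n \<Rightarrow> complex) \<Rightarrow> (real^'n \<Rightarrow> complex) \<Rightarrow> bool" where
  "L2_converges hs h \<longleftrightarrow>
     (\<lambda>k. \<integral>\<^sup>+x. ennreal ((cmod (hs k x - h x))\<^sup>2) \<partial>lborel) \<longlonglongrightarrow> 0"

definition fourier_L1 :: "(real^'n \<Rightarrow> complex) \<Rightarrow> real^'n \<Rightarrow> complex" where
  "fourier_L1 h u = (LINT x|lborel. h x * iexp (u \<bullet> x))"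

(* g represents the L2 class of the continuous extension, to all of L2, of the Fourier
   transform on the intersection of L1 and L2. *)
definition is_fourier_L2 :: "(real^'n \<Rightarrow> complex) \<Rightarrow> (real^'n \<Rightarrow> complex) \<Rightarrow> bool" where
  "is_fourier_L2 h g \<longleftrightarrow> square_integrable g \<and>
     (\<exists>hs. (\<forall>k. square_integrable (hs k) \<and> integrable lborel (hs k)) \<and>
           L2_converges hs h \<and> L2_converges (\<lambda>k. fourier_L1 (hs k)) g)"

(* By Plancherel a representative exists for every square integrable h and is unique up to
   null sets.  Only values up to null sets are meaningful, also for h in L1. *)
definition fourier_L2 :: "(real^'n \<Rightarrow> complex) \<Rightarrow> real^'n \<Rightarrow> complex" where
  "fourier_L2 h = (SOME g. is_fourier_L2 h g)"

definition cadlag_on :: "real \<Rightarrow> (real \<Rightarrow> 'a::topological_space) \<Rightarrow> bool" where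
  "cadlag_on T x \<longleftrightarrow>
     (\<forall>t\<in>{0..<T}. (x \<longlongrightarrow> x t) (at_right t)) \<and>
     (\<forall>t\<in>{0<..T}. \<exists>l. (x \<longlongrightarrow> l) (at_left t))"

(* Processes are indexed by all real times, but only times in [0,T] are relevant. *)
definition cadlag_process ::
    "'w measure \<Rightarrow> real \<Rightarrow> (real \<Rightarrow> 'w \<Rightarrow> real^'n) \<Rightarrow> bool" where
  "cadlag_process M T X \<longleftrightarrow>
     (\<forall>t\<in>{0..T}. X t \<in> borel_measurable M) \<and>
     (\<forall>\<omega>\<in>space M. cadlag_on T (\<lambda>t. X t \<omega>))"

(* The library's indep_var needs both variables to have the same range type, so independence
   is stated for the generated sigma-algebras. *)
definition indep_of_process ::
    "'w measure \<Rightarrow> real \<Rightarrow> (real \<Rightarrow> 'w \<Rightarrow> real^'n) \<Rightarrow> ('w \<Rightarrow> real^'n) \<Rightarrow> bool" where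
  "indep_of_process M T X \<xi> \<longleftrightarrow>
     prob_space.indep_set M
       (sets (vimage_algebra (space M) (\<lambda>\<omega>. \<lambda>t\<in>{0..T}. X t \<omega>) (PiM {0..T} (\<lambda>_. borel))))
       (sets (vimage_algebra (space M) \<xi> borel))"

definition mesh :: "real \<Rightarrow> nat \<Rightarrow> real" where
  "mesh T n = T / real n"

definition grid_floor :: "real \<Rightarrow> nat \<Rightarrow> real \<Rightarrow> real" where
  "grid_floor T n t = of_int \<lfloor>t / mesh T n\<rfloor> * mesh T n"

definition occupation_time :: "real \<Rightarrow> (real \<Rightarrow> 'a) \<Rightarrow> ('a \<Rightarrow> real) \<Rightarrow> real" where
  "occupation_time T x h = (LINT t:{0..T}|lborel. h (x t))"

definition riemann_estimator ::
    "real \<Rightarrow> nat \<Rightarrow> (real \<Rightarrow> 'a) \<Rightarrow> ('a \<Rightarrow> real) \<Rightarrow> real" where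
  "riemann_estimator T n x h =
     mesh T n * (\<Sum>k=1..n. h (x (real (k - 1) * mesh T n)))"

definition off_diagonal :: "real \<Rightarrow> nat \<Rightarrow> (real \<times> real) set" where
  "off_diagonal T n =
     {(t, t'). t \<in> {0..T} \<and> t' \<in> {0..T} \<and> t \<ge> mesh T n \<and> t' > t + 2 * mesh T n}"

definition joint_char ::
    "'w measure \<Rightarrow> (real \<Rightarrow> 'w \<Rightarrow> real^'n) \<Rightarrow> real^'n \<Rightarrow> real \<Rightarrow> real^'n \<Rightarrow> real \<Rightarrow> complex" where
  "joint_char M X u t v t' = (LINT \<omega>|M. iexp (u \<bullet> X t \<omega> + v \<bullet> X t' \<omega>))"

definition d2_char ::
    "'w measure \<Rightarrow> (real \<Rightarrow> 'w \<Rightarrow> real^'n) \<Rightarrow> real^'n \<Rightarrow> real \<Rightarrow> real^'n \<Rightarrow> real \<Rightarrow> complex" where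
  "d2_char M X u t v t' = vector_derivative (\<lambda>s. joint_char M X u t v s) (at t')"

definition d12_char ::
    "'w measure \<Rightarrow> (real \<Rightarrow> 'w \<Rightarrow> real^'n) \<Rightarrow> real^'n \<Rightarrow> real \<Rightarrow> real^'n \<Rightarrow> real \<Rightarrow> complex" where
  "d12_char M X u t v t' = vector_derivative (\<lambda>s. d2_char M X u s v t') (at t)"

definition g_err ::
    "'w measure \<Rightarrow> (real \<Rightarrow> 'w \<Rightarrow> real^'n) \<Rightarrow> real \<Rightarrow> nat \<Rightarrow> real^'n \<Rightarrow> real \<Rightarrow> real" where
  "g_err M X T n u t = 2 - 2 * Re (joint_char M X u (grid_floor T n t) (- u) t)"

(* The three terms below take values in [0,\<infinity>]: the hypotheses do not make
   the derivative difference in v_term integrable, and the bounds are understood as trivial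
   when the right-hand side is infinite. *)
definition w_term ::
    "'w measure \<Rightarrow> (real \<Rightarrow> 'w \<Rightarrow> real^'n) \<Rightarrow> real \<Rightarrow> nat \<Rightarrow> real^'n \<Rightarrow> ennreal" where
  "w_term M X T n u =
     ennreal (mesh T n) * (\<integral>\<^sup>+t\<in>{mesh T n..T}. ennreal \<bar>g_err M X T n u t\<bar> \<partial>lborel)
     + ennreal T * (\<integral>\<^sup>+t\<in>{0..mesh T n}. ennreal \<bar>g_err M X T n u t\<bar> \<partial>lborel)"

definition v_term ::
    "'w measure \<Rightarrow> (real \<Rightarrow> 'w \<Rightarrow> real^'n) \<Rightarrow> real \<Rightarrow> nat \<Rightarrow> real^'n \<Rightarrow> ennreal" where
  "v_term M X T n u =
     ennreal (mesh T n) *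
     (\<integral>\<^sup>+p\<in>off_diagonal T n.
        (case p of (t, t') \<Rightarrow>
          ennreal (cmod (d2_char M X u t (- u) t'
                         - d2_char M X u (grid_floor T n t) (- u) t'))) \<partial>lborel)"

definition v_tilde_term ::
    "'w measure \<Rightarrow> (real \<Rightarrow> 'w \<Rightarrow> real^'n) \<Rightarrow> real \<Rightarrow> nat \<Rightarrow> real^'n \<Rightarrow> ennreal" where
  "v_tilde_term M X T n u =
     ennreal ((mesh T n)\<^sup>2) *
     (\<integral>\<^sup>+p\<in>off_diagonal T n.
        (case p of (t, t') \<Rightarrow> ennreal (cmod (d12_char M X u t (- u) t'))) \<partial>lborel)"

(* An existential quantifier inside a theorem with type variables for the dimension and the
   sample space would let the constant depend on these types.  A closed numeral is
   independent of everything; its exact value is of no importance. *)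
definition abs_const :: real where
  "abs_const = 10"

end

theory Submission
  imports Defs
begin

text \<open>
  Write the error of the Riemann estimator, for a fixed path and with the random shift replaced by a
  point z, as a function Err(z).  It is a difference of two averages of translates of f, one along the
  path and one along the path frozen at the grid points.  Averaging translates multiplies the Fourier
  transform by the average of the characters exp(-i u x), so Plancherel turns the integral of
  Err(z)^2 over z into the integral over u of (2 pi)^(-d) |F f(u)|^2 |K(u)|^2, where K(u) is the
  integral over time of the phase increment Z(t) = exp(i u X(t)) - exp(i u X(floor t)), up to
  conjugation (\<open>sampling_error_le_phase_integral\<close>).  Since the shift is independent of the path and has
  a density bounded by the essential supremum of mu, the mean square error is at most that bound
  times the expectation of the integral over all z (\<open>nn_integral_indep_le\<close>).  So everything reduces to
  bounding E |K(u)|^2 for each single frequency u.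

  This second moment is at most the integral over [0,T]^2 of |H(t,t')|, H(t,t') = E Z(t) cnj Z(t').
  By symmetry only t \<open>\<le>\<close> t' matters.  Always |H(t,t')| is at most g(t) + g(t') with g(t) = E |Z(t)|^2,
  which is the function g of the statement.  This is used in the band t' \<open>\<le>\<close> t + 3 Delta and in the strip
  t \<open>\<le>\<close> Delta, and it yields the w-term.  Elsewhere H(t,t') is a second difference of the joint
  characteristic function.  The fundamental theorem of calculus in t' writes it as an integral of
  the increment of the t'-derivative over [floor t', t'], and exchanging the integrals gains the
  factor Delta of the v-term (\<open>nn_integral_kernel_le\<close>, \<open>second_moment_phase_integral_le\<close>).  The band
  has width 3 Delta, not 2 Delta, because every s in [floor t', t'] must satisfy s > t + 2 Delta
  in order to remain in the region over which the v-term is integrated.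
  The second part follows because the v-term is at most the v-tilde-term for every u, by the same
  argument applied to the variable t (\<open>v_term_le_v_tilde_term\<close>).

  The Fourier analysis is developed from Gaussian integrals.  Damping with exp(-s^2 |u|^2 / 2) makes
  all integrals absolutely convergent, and letting s tend to 0 gives the upper half of Plancherel
  for integrable functions and the lower half for continuous functions of bounded support.  Density
  extends the lower half, and completeness of L2 gives the existence of the transform on L2.
\<close>

section \<open>Gaussian integrals in Euclidean space\<close>

lemma integral_lborel_affine:
  fixes F :: "'a::euclidean_space \<Rightarrow> complex" and t :: 'a
  assumes [measurable]: "F \<in> borel_measurable borel" and c: "c \<noteq> 0"
  shows "(LINT y|lborel. F y) = complex_of_real (\<bar>c\<bar> ^ DIM('a)) * (LINT z|lborel. F (t + c *\<^sub>R z))"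
proof -
  have "(LINT y|lborel. F y)
      = (LINT y|density (distr lborel borel (\<lambda>x. t + c *\<^sub>R x)) (\<lambda>_. ennreal (\<bar>c\<bar> ^ DIM('a))). F y)"
    using lborel_affine[OF c, of t] by simp
  also have "\<dots> = (LINT y|distr lborel borel (\<lambda>x. t + c *\<^sub>R x). (\<bar>c\<bar> ^ DIM('a)) *\<^sub>R F y)"
    by (rule integral_density) auto
  also have "\<dots> = (LINT z|lborel. (\<bar>c\<bar> ^ DIM('a)) *\<^sub>R F (t + c *\<^sub>R z))"
    by (rule integral_distr) auto
  finally show ?thesis
    by (simp add: scaleR_conv_of_real)
qed

lemma nn_integral_lborel_affine:
  fixes F :: "'a::euclidean_space \<Rightarrow> ennreal" and t :: 'a
  assumes [measurable]: "F \<in> borel_measurable borel" and c: "\<bar>c\<bar> = 1"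
  shows "(\<integral>\<^sup>+z. F (t + c *\<^sub>R z) \<partial>lborel) = (\<integral>\<^sup>+y. F y \<partial>lborel)"
proof -
  have "c \<noteq> 0" using c by auto
  then have "(\<integral>\<^sup>+y. F y \<partial>lborel)
      = (\<integral>\<^sup>+y. F y \<partial>density (distr lborel borel (\<lambda>x. t + c *\<^sub>R x)) (\<lambda>_. ennreal (\<bar>c\<bar> ^ DIM('a))))"
    using lborel_affine[of c t] by simp
  then show ?thesis
    using c by (simp add: nn_integral_density nn_integral_distr)
qed

text \<open>A reformulation of the characteristic function of the standard normal distribution.\<close>

lemma iexp_gauss_real:
  fixes z :: real
  shows "integrable lborel (\<lambda>u::real. iexp (z * u) * complex_of_real (exp (- u\<^sup>2 / 2)))"
    and "(LINT u|lborel. iexp (z * u) * complex_of_real (exp (- u\<^sup>2 / 2)))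
           = complex_of_real (sqrt (2 * pi) * exp (- z\<^sup>2 / 2))"
proof -
  have "integrable lborel std_normal_density"
    by simp
  then have "integrable lborel (\<lambda>u::real. sqrt (2 * pi) * std_normal_density u)"
    by simp
  then have i: "integrable lborel (\<lambda>u::real. exp (- u\<^sup>2 / 2))"
    unfolding std_normal_density_def by simp
  show "integrable lborel (\<lambda>u::real. iexp (z * u) * complex_of_real (exp (- u\<^sup>2 / 2)))"
    by (rule Bochner_Integration.integrable_bound[OF i]) (auto simp: norm_mult)
  have "complex_of_real (exp (- z\<^sup>2 / 2)) = (LINT u|std_normal_distribution. iexp (z * u))"
    using fun_cong[OF char_std_normal_distribution, of z] by (simp add: char_def)
  also have "\<dots> = (LINT u|lborel. std_normal_density u *\<^sub>R iexp (z * u))"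
    by (rule integral_density) auto
  also have "\<dots> = (LINT u|lborel. complex_of_real (1 / sqrt (2 * pi)) * (iexp (z * u) * complex_of_real (exp (- u\<^sup>2 / 2))))"
    by (rule Bochner_Integration.integral_cong) (auto simp: std_normal_density_def scaleR_conv_of_real mult_ac)
  also have "\<dots> = complex_of_real (1 / sqrt (2 * pi)) * (LINT u|lborel. iexp (z * u) * complex_of_real (exp (- u\<^sup>2 / 2)))"
    by simp
  finally show "(LINT u|lborel. iexp (z * u) * complex_of_real (exp (- u\<^sup>2 / 2)))
           = complex_of_real (sqrt (2 * pi) * exp (- z\<^sup>2 / 2))"
    by (simp add: field_simps)
qed

text \<open>In coordinates the Gaussian and the character both factorise, which reduces the integrals in
  Euclidean space to products of integrals over the line.\<close>

lemma exp_neg_norm_sum_Basis: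
  fixes f :: "'a::euclidean_space \<Rightarrow> real" and z :: 'a
  shows "iexp (z \<bullet> (\<Sum>b\<in>Basis. f b *\<^sub>R b)) * complex_of_real (exp (- (norm (\<Sum>b\<in>Basis. f b *\<^sub>R b :: 'a))\<^sup>2 / 2))
    = (\<Prod>b\<in>Basis. iexp ((z \<bullet> b) * f b) * complex_of_real (exp (- (f b)\<^sup>2 / 2)))"
proof -
  have n: "(norm (\<Sum>b\<in>Basis. f b *\<^sub>R b :: 'a))\<^sup>2 = (\<Sum>b\<in>Basis. (f b)\<^sup>2)"
    unfolding power2_norm_eq_inner
    by (simp add: inner_sum_left inner_sum_right inner_Basis if_distrib power2_eq_square cong: if_cong)
  have i: "z \<bullet> (\<Sum>b\<in>Basis. f b *\<^sub>R b) = (\<Sum>b\<in>Basis. (z \<bullet> b) * f b)"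
    by (simp add: inner_sum_right mult.commute)
  show ?thesis
    unfolding n i exp_of_real[symmetric] exp_add[symmetric] exp_sum[OF finite_Basis, symmetric]
    by (simp add: sum.distrib sum_distrib_left sum_negf sum_divide_distrib sum_subtractf)
qed

lemma
  fixes z :: "'a::euclidean_space"
  shows integrable_gauss: "integrable lborel (\<lambda>u::'a. exp (- (norm u)\<^sup>2 / 2))"
    and fourier_gauss:
      "(LINT u|lborel. iexp (z \<bullet> u) * complex_of_real (exp (- (norm u)\<^sup>2 / 2)))
         = complex_of_real (sqrt (2 * pi) ^ DIM('a) * exp (- (norm z)\<^sup>2 / 2))"
proof -
  interpret product_sigma_finite "\<lambda>_::'a. lborel :: real measure"
    by standard
  let ?S = "\<lambda>f::'a \<Rightarrow> real. \<Sum>b\<in>Basis. f b *\<^sub>R b"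
  let ?P = "\<Pi>\<^sub>M b\<in>(Basis::'a set). (lborel :: real measure)"
  have int: "integrable lborel (\<lambda>u::'a. iexp (w \<bullet> u) * complex_of_real (exp (- (norm u)\<^sup>2 / 2)))" for w
  proof -
    have "integrable ?P (\<lambda>f. \<Prod>b\<in>Basis. iexp ((w \<bullet> b) * f b) * complex_of_real (exp (- (f b)\<^sup>2 / 2)))"
      by (rule product_integrable_prod) (rule finite_Basis iexp_gauss_real(1))+
    then have "integrable ?P (\<lambda>f. iexp (w \<bullet> ?S f) * complex_of_real (exp (- (norm (?S f))\<^sup>2 / 2)))"
      by (simp only: exp_neg_norm_sum_Basis)
    then have "integrable (distr ?P borel ?S) (\<lambda>u. iexp (w \<bullet> u) * complex_of_real (exp (- (norm u)\<^sup>2 / 2)))"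
      by (intro iffD2[OF integrable_distr_eq]) measurable
    then show ?thesis
      by (simp only: lborel_eq[symmetric])
  qed
  from int[of 0] have "integrable lborel (\<lambda>u::'a. complex_of_real (exp (- (norm u)\<^sup>2 / 2)))"
    by simp
  then show "integrable lborel (\<lambda>u::'a. exp (- (norm u)\<^sup>2 / 2))"
    using integrable_Re by fastforce
  have "(LINT u|lborel. iexp (z \<bullet> u) * complex_of_real (exp (- (norm u)\<^sup>2 / 2)))
      = (LINT f|?P. iexp (z \<bullet> ?S f) * complex_of_real (exp (- (norm (?S f))\<^sup>2 / 2)))"
    unfolding lborel_eq[where 'a='a] by (rule integral_distr) measurable
  also have "\<dots> = (LINT f|?P. (\<Prod>b\<in>Basis. iexp ((z \<bullet> b) * f b) * complex_of_real (exp (- (f b)\<^sup>2 / 2))))"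
    by (simp only: exp_neg_norm_sum_Basis)
  also have "\<dots> = (\<Prod>b\<in>Basis. complex_of_real (sqrt (2 * pi) * exp (- (z \<bullet> b)\<^sup>2 / 2)))"
    by (subst product_integral_prod[OF finite_Basis iexp_gauss_real(1)])
       (simp only: iexp_gauss_real(2))
  also have "\<dots> = complex_of_real (sqrt (2 * pi) ^ DIM('a) * exp (- (norm z)\<^sup>2 / 2))"
  proof -
    have "(norm z)\<^sup>2 = (\<Sum>b\<in>Basis. (z \<bullet> b)\<^sup>2)"
      unfolding power2_norm_eq_inner by (subst euclidean_inner) (simp only: power2_eq_square)
    then have "- (norm z)\<^sup>2 / 2 = (\<Sum>b\<in>Basis. - (z \<bullet> b)\<^sup>2 / 2)"
      by (simp only: sum_negf[symmetric] sum_divide_distrib)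
    then show ?thesis
      by (simp only: of_real_prod[symmetric] prod.distrib prod_constant exp_sum[OF finite_Basis])
  qed
  finally show "(LINT u|lborel. iexp (z \<bullet> u) * complex_of_real (exp (- (norm u)\<^sup>2 / 2)))
         = complex_of_real (sqrt (2 * pi) ^ DIM('a) * exp (- (norm z)\<^sup>2 / 2))" .
qed

lemma integral_gauss:
  "(LINT u|lborel. exp (- (norm (u::'a::euclidean_space))\<^sup>2 / 2)) = sqrt (2 * pi) ^ DIM('a)"
proof -
  have "complex_of_real (LINT u|lborel. exp (- (norm (u::'a))\<^sup>2 / 2)) = complex_of_real (sqrt (2 * pi) ^ DIM('a))"
    using fourier_gauss[of "0::'a"] by (simp flip: integral_complex_of_real)
  then show ?thesis
    using of_real_eq_iff by blast
qed

lemma nn_integral_gauss: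
  "(\<integral>\<^sup>+u. ennreal (exp (- (norm (u::'a::euclidean_space))\<^sup>2 / 2)) \<partial>lborel) = ennreal (sqrt (2 * pi) ^ DIM('a))"
  by (subst nn_integral_eq_integral[OF integrable_gauss]) (simp_all only: integral_gauss, simp)

lemma integrable_gauss_scaled:
  assumes s: "s > 0"
  shows "integrable lborel (\<lambda>u::'a::euclidean_space. exp (- (norm (s *\<^sub>R u))\<^sup>2 / 2))"
proof -
  have "integrable (density (distr lborel borel (\<lambda>u::'a. 0 + (1/s) *\<^sub>R u)) (\<lambda>_. ennreal (\<bar>1/s\<bar> ^ DIM('a))))
      (\<lambda>u. exp (- (norm (s *\<^sub>R u))\<^sup>2 / 2))"
    using s integrable_gauss[where 'a='a] by (subst integrable_density) (auto simp: integrable_distr_eq)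
  then show ?thesis
    using s by (subst lborel_affine[of "1/s" 0]) auto
qed

lemma fourier_gauss_scaled:
  fixes z :: "'a::euclidean_space"
  assumes s: "s > 0"
  shows "(LINT u|lborel. iexp (z \<bullet> u) * complex_of_real (exp (- (norm (s *\<^sub>R u))\<^sup>2 / 2)))
         = complex_of_real ((sqrt (2 * pi) / s) ^ DIM('a) * exp (- (norm (z /\<^sub>R s))\<^sup>2 / 2))"
proof -
  have "(LINT u|lborel. iexp (z \<bullet> u) * complex_of_real (exp (- (norm (s *\<^sub>R u))\<^sup>2 / 2)))
     = complex_of_real (\<bar>1/s\<bar> ^ DIM('a)) * (LINT u|lborel. iexp (z \<bullet> (0 + (1/s) *\<^sub>R u)) * complex_of_real (exp (- (norm (s *\<^sub>R (0 + (1/s) *\<^sub>R u)))\<^sup>2 / 2)))"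
    by (rule integral_lborel_affine) (use s in auto)
  also have "\<dots> = complex_of_real (\<bar>1/s\<bar> ^ DIM('a)) * (LINT u|lborel. iexp ((z /\<^sub>R s) \<bullet> u) * complex_of_real (exp (- (norm u)\<^sup>2 / 2)))"
  proof -
    have "z \<bullet> (0 + (1/s) *\<^sub>R u) = (z /\<^sub>R s) \<bullet> u" "s *\<^sub>R (0 + (1/s) *\<^sub>R u) = u" for u
      using s by (auto simp: inverse_eq_divide)
    then show ?thesis by (simp only:)
  qed
  also have "\<dots> = complex_of_real ((sqrt (2 * pi) / s) ^ DIM('a) * exp (- (norm (z /\<^sub>R s))\<^sup>2 / 2))"
    unfolding fourier_gauss of_real_mult[symmetric] using s by (simp add: power_divide)
  finally show ?thesis .
qed

section \<open>The regularised Plancherel identity\<close>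

lemma borel_measurable_cnj [measurable (raw)]:
  assumes [measurable]: "f \<in> borel_measurable M"
  shows "(\<lambda>x. cnj (f x)) \<in> borel_measurable M"
  by (rule borel_measurable_continuous_on[of cnj]) (auto intro: continuous_intros)

lemma iexp_mult_cnj_iexp: "iexp a * cnj (iexp b) = iexp (a - b)"
proof -
  have "cnj (iexp b) = iexp (- b)"
    by (simp add: exp_cnj)
  then show ?thesis
    by (simp add: exp_add[symmetric] right_diff_distrib)
qed

lemma borel_measurable_fourier_L1:
  assumes [measurable]: "h \<in> borel_measurable borel"
  shows "fourier_L1 h \<in> borel_measurable borel"
  unfolding fourier_L1_def by measurable

lemma integrable_mult_iexp:
  assumes "integrable lborel (h :: real^'n \<Rightarrow> complex)"
  shows "integrable lborel (\<lambda>x. h x * iexp (u \<bullet> x))"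
proof -
  have [measurable]: "h \<in> borel_measurable borel"
    using assms by auto
  show ?thesis
    by (rule Bochner_Integration.integrable_bound[OF assms]) (auto simp: norm_mult)
qed

lemma cmod_fourier_L1_le:
  "cmod (fourier_L1 h u) \<le> (LINT x|lborel. cmod (h x))"
  unfolding fourier_L1_def by (rule order_trans[OF integral_norm_bound]) (simp add: norm_mult)

text \<open>Both exchanges of integrals in the regularised Plancherel identity have this shape, where k carries
  the oscillating factors and perhaps a bounded Fourier transform.\<close>

lemma fubini_bounded_kernel:
  fixes a :: "'a::euclidean_space \<Rightarrow> complex" and b :: "'b::euclidean_space \<Rightarrow> complex"
  assumes a: "integrable lborel a" and b: "integrable lborel b"
    and k [measurable]: "(\<lambda>(u, x). k u x) \<in> borel_measurable (lborel \<Otimes>\<^sub>M lborel)"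
    and C: "\<And>u x. cmod (k u x) \<le> C"
  shows "(LINT u|lborel. LINT x|lborel. a u * b x * k u x) = (LINT x|lborel. LINT u|lborel. a u * b x * k u x)"
proof -
  have [measurable]: "a \<in> borel_measurable borel" "b \<in> borel_measurable borel"
    using a b by auto
  have bint: "integrable lborel (\<lambda>x. a u * b x * k u x)" for u
  proof (rule Bochner_Integration.integrable_bound)
    show "integrable lborel (\<lambda>x. cmod (a u) * cmod (b x) * C)"
      using b by (intro integrable_mult_left integrable_mult_right integrable_norm)
    have "cmod (a u * b x * k u x) \<le> cmod (a u) * cmod (b x) * C" for x
      by (auto simp: norm_mult intro!: mult_left_mono C)
    then show "AE x in lborel. norm (a u * b x * k u x) \<le> norm (cmod (a u) * cmod (b x) * C)"
      by (auto intro!: AE_I2 order_trans[OF _ abs_ge_self])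
  qed measurable
  have "integrable (lborel \<Otimes>\<^sub>M lborel) (\<lambda>(u, x). a u * b x * k u x)"
  proof (rule lborel_pair.Fubini_integrable)
    show "integrable lborel (\<lambda>u. LINT x|lborel. norm (case (u, x) of (u, x) \<Rightarrow> a u * b x * k u x))"
    proof (rule Bochner_Integration.integrable_bound)
      show "integrable lborel (\<lambda>u. cmod (a u) * (LINT x|lborel. cmod (b x) * C))"
        using a by (intro integrable_mult_left integrable_norm)
      have "(LINT x|lborel. cmod (a u * b x * k u x)) \<le> (LINT x|lborel. cmod (a u) * (cmod (b x) * C))" for u
        using bint b
        by (intro integral_mono integrable_norm integrable_mult_left integrable_mult_right)
           (auto simp: norm_mult mult.assoc intro!: mult_left_mono C)
      then show "AE u in lborel. norm (LINT x|lborel. norm (case (u, x) of (u, x) \<Rightarrow> a u * b x * k u x))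
          \<le> norm (cmod (a u) * (LINT x|lborel. cmod (b x) * C))"
        by (auto simp: abs_mult intro!: AE_I2 order_trans[OF _ abs_ge_self])
           (use order_trans[OF norm_ge_zero C] in simp)
    qed measurable
  qed (use bint in auto)
  then show ?thesis
    by (rule lborel_pair.Fubini_integral[symmetric])
qed

text \<open>Expanding the square of the Fourier transform gives a triple integral of
  h(x) cnj(h(y)) exp(i u (x - y)) against the Gaussian weight in u.  The weight makes it absolutely
  convergent, so u may be integrated first; this produces a Gaussian in (x - y)/s.  The
  substitution y = x - s z moves s out of the Gaussian and into the argument of h, so that letting
  s tend to 0 is a question about translates of h only.\<close>

lemma regularised_plancherel:
  fixes h :: "real^'n \<Rightarrow> complex"
  assumes h: "integrable lborel h" and s: "s > 0"
  shows "(LINT u|lborel. complex_of_real ((cmod (fourier_L1 h u))\<^sup>2 * exp (- (norm (s *\<^sub>R u))\<^sup>2 / 2)))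
    = complex_of_real (sqrt (2 * pi) ^ CARD('n)) *
      (LINT x|lborel. LINT z|lborel. h x * cnj (h (x - s *\<^sub>R z)) * complex_of_real (exp (- (norm z)\<^sup>2 / 2)))"
proof -
  define \<gamma> :: "real^'n \<Rightarrow> complex" where "\<gamma> u = complex_of_real (exp (- (norm (s *\<^sub>R u))\<^sup>2 / 2))" for u
  have m [measurable]: "h \<in> borel_measurable borel" "\<gamma> \<in> borel_measurable borel"
    using h by (auto simp: \<gamma>_def[abs_def])
  have [measurable]: "fourier_L1 h \<in> borel_measurable borel"
    by (rule borel_measurable_fourier_L1) measurable
  have int\<gamma>: "integrable lborel \<gamma>"
    unfolding \<gamma>_def[abs_def] by (intro integrable_of_real integrable_gauss_scaled s)
  have swap: "iexp (u \<bullet> x) * cnj (iexp (u \<bullet> y)) = iexp ((x - y) \<bullet> u)" for u x y :: "real^'n"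
    unfolding iexp_mult_cnj_iexp inner_diff_right[symmetric] by (simp only: inner_commute)
  have hc: "integrable lborel (\<lambda>y. cnj (h y))"
    using h by simp
  have "(LINT u|lborel. complex_of_real ((cmod (fourier_L1 h u))\<^sup>2 * exp (- (norm (s *\<^sub>R u))\<^sup>2 / 2)))
     = (LINT u|lborel. \<gamma> u * fourier_L1 h u * cnj (fourier_L1 h u))"
    by (rule Bochner_Integration.integral_cong) (auto simp: \<gamma>_def complex_norm_square mult_ac simp del: of_real_power)
  also have "\<dots> = (LINT u|lborel. LINT x|lborel. \<gamma> u * h x * (iexp (u \<bullet> x) * cnj (fourier_L1 h u)))"
  proof (rule Bochner_Integration.integral_cong)
    fix u :: "real^'n"
    have "(LINT x|lborel. (\<gamma> u * cnj (fourier_L1 h u)) * (h x * iexp (u \<bullet> x))) = (\<gamma> u * cnj (fourier_L1 h u)) * fourier_L1 h u"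
      by (subst integral_mult_right_zero) (simp only: fourier_L1_def)
    then show "\<gamma> u * fourier_L1 h u * cnj (fourier_L1 h u) = (LINT x|lborel. \<gamma> u * h x * (iexp (u \<bullet> x) * cnj (fourier_L1 h u)))"
      by (simp only: mult_ac)
  qed simp
  also have "\<dots> = (LINT x|lborel. LINT u|lborel. \<gamma> u * h x * (iexp (u \<bullet> x) * cnj (fourier_L1 h u)))"
    by (rule fubini_bounded_kernel[OF int\<gamma> h, where C="LINT x|lborel. cmod (h x)"])
       (measurable, simp add: norm_mult cmod_fourier_L1_le)
  also have "\<dots> = (LINT x|lborel. h x * (LINT u|lborel. LINT y|lborel. \<gamma> u * cnj (h y) * iexp ((x - y) \<bullet> u)))"
  proof (rule Bochner_Integration.integral_cong)
    fix x :: "real^'n"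
    have "cnj (fourier_L1 h u) = (LINT y|lborel. cnj (h y) * cnj (iexp (u \<bullet> y)))" for u
      by (simp only: fourier_L1_def Bochner_Integration.integral_cnj[symmetric] complex_cnj_mult)
    then have "\<gamma> u * h x * (iexp (u \<bullet> x) * cnj (fourier_L1 h u))
        = h x * (LINT y|lborel. \<gamma> u * iexp (u \<bullet> x) * (cnj (h y) * cnj (iexp (u \<bullet> y))))" for u
      by (subst integral_mult_right_zero) (simp only: mult_ac)
    also have "\<dots> u = h x * (LINT y|lborel. \<gamma> u * cnj (h y) * iexp ((x - y) \<bullet> u))" for u
      by (simp only: swap[symmetric] mult_ac)
    finally show "(LINT u|lborel. \<gamma> u * h x * (iexp (u \<bullet> x) * cnj (fourier_L1 h u)))
       = h x * (LINT u|lborel. LINT y|lborel. \<gamma> u * cnj (h y) * iexp ((x - y) \<bullet> u))"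
      by (simp only: integral_mult_right_zero)
  qed simp
  also have "\<dots> = (LINT x|lborel. h x * (LINT y|lborel. LINT u|lborel. \<gamma> u * cnj (h y) * iexp ((x - y) \<bullet> u)))"
    by (subst fubini_bounded_kernel[OF int\<gamma> hc, where C=1]) auto
  also have "\<dots> = (LINT x|lborel. h x * (LINT y|lborel. cnj (h y) *
      complex_of_real ((sqrt (2 * pi) / s) ^ CARD('n) * exp (- (norm ((x - y) /\<^sub>R s))\<^sup>2 / 2))))"
  proof -
    have "(LINT u|lborel. \<gamma> u * cnj (h y) * iexp ((x - y) \<bullet> u))
       = cnj (h y) * (LINT u|lborel. iexp ((x - y) \<bullet> u) * \<gamma> u)" for x y :: "real^'n"
      by (simp only: integral_mult_right_zero[symmetric] mult_ac)
    then show ?thesis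
      by (simp only: \<gamma>_def fourier_gauss_scaled[OF s]) simp
  qed
  also have "\<dots> = (LINT x|lborel. complex_of_real (sqrt (2 * pi) ^ CARD('n)) *
      (LINT z|lborel. h x * cnj (h (x - s *\<^sub>R z)) * complex_of_real (exp (- (norm z)\<^sup>2 / 2))))"
  proof (rule Bochner_Integration.integral_cong)
    fix x :: "real^'n"
    let ?F = "\<lambda>y. cnj (h y) * complex_of_real ((sqrt (2 * pi) / s) ^ CARD('n) * exp (- (norm ((x - y) /\<^sub>R s))\<^sup>2 / 2))"
    have "(LINT y|lborel. ?F y) = complex_of_real (\<bar>- s\<bar> ^ DIM(real^'n)) * (LINT z|lborel. ?F (x + (- s) *\<^sub>R z))"
      by (rule integral_lborel_affine) (use s in auto)
    also have "\<dots> = (LINT z|lborel. complex_of_real (\<bar>- s\<bar> ^ DIM(real^'n)) * ?F (x + (- s) *\<^sub>R z))"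
      by simp
    also have "\<dots> = (LINT z|lborel. complex_of_real (sqrt (2 * pi) ^ CARD('n)) * (cnj (h (x - s *\<^sub>R z)) * complex_of_real (exp (- (norm z)\<^sup>2 / 2))))"
      using s by (intro Bochner_Integration.integral_cong) (auto simp: power_divide)
    finally show "h x * (LINT y|lborel. ?F y) = complex_of_real (sqrt (2 * pi) ^ CARD('n)) *
      (LINT z|lborel. h x * cnj (h (x - s *\<^sub>R z)) * complex_of_real (exp (- (norm z)\<^sup>2 / 2)))"
      by (simp only: mult.assoc integral_mult_right_zero) (simp only: mult.left_commute)
  qed simp
  finally show ?thesis by simp
qed

definition L2sq :: "('a::euclidean_space \<Rightarrow> complex) \<Rightarrow> ennreal" where
  "L2sq h = (\<integral>\<^sup>+x. ennreal ((cmod (h x))\<^sup>2) \<partial>lborel)"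

lemma ennreal_cmod_lebesgue_integral_le:
  fixes f :: "'a \<Rightarrow> complex"
  shows "ennreal (cmod (LINT x|M. f x)) \<le> (\<integral>\<^sup>+x. ennreal (cmod (f x)) \<partial>M)"
  by (cases "integrable M f") (auto simp: integral_norm_bound_ennreal not_integrable_integral_eq)

text \<open>The left side of the regularised identity as a non-negative integral, the form in which
  monotone limits in s can be taken.\<close>

lemma nn_integral_cmod_fourier_L1_gauss:
  fixes h :: "real^'n \<Rightarrow> complex"
  assumes h: "integrable lborel h" and s: "s > 0"
  shows "(\<integral>\<^sup>+u. ennreal ((cmod (fourier_L1 h u))\<^sup>2 * exp (- (norm (s *\<^sub>R u))\<^sup>2 / 2)) \<partial>lborel)
    = ennreal (cmod (complex_of_real (sqrt (2 * pi) ^ CARD('n)) *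
      (LINT x|lborel. LINT z|lborel. h x * cnj (h (x - s *\<^sub>R z)) * complex_of_real (exp (- (norm z)\<^sup>2 / 2)))))"
    (is "?L = ennreal (cmod ?R)")
proof -
  let ?f = "\<lambda>u. (cmod (fourier_L1 h u))\<^sup>2 * exp (- (norm (s *\<^sub>R u))\<^sup>2 / 2)"
  have [measurable]: "h \<in> borel_measurable borel"
    using h by auto
  have [measurable]: "fourier_L1 h \<in> borel_measurable borel"
    by (rule borel_measurable_fourier_L1) measurable
  have f: "integrable lborel ?f"
  proof (rule Bochner_Integration.integrable_bound)
    show "integrable lborel (\<lambda>u::real^'n. (LINT x|lborel. cmod (h x))\<^sup>2 * exp (- (norm (s *\<^sub>R u))\<^sup>2 / 2))"
      by (intro integrable_mult_right integrable_gauss_scaled s)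
    show "AE u in lborel. norm (?f u) \<le> norm ((LINT x|lborel. cmod (h x))\<^sup>2 * exp (- (norm (s *\<^sub>R u))\<^sup>2 / 2))"
      by (intro AE_I2) (auto simp: abs_mult intro!: mult_right_mono power_mono cmod_fourier_L1_le)
  qed measurable
  have "?L = ennreal (LINT u|lborel. ?f u)"
    by (rule nn_integral_eq_integral[OF f]) auto
  also have "\<dots> = ennreal (cmod (LINT u|lborel. complex_of_real (?f u)))"
  proof -
    have "(LINT u|lborel. ?f u) \<ge> 0"
      by (intro integral_nonneg_AE) auto
    then show ?thesis
      by (simp only: integral_complex_of_real norm_of_real abs_of_nonneg)
  qed
  also have "\<dots> = ennreal (cmod ?R)"
    by (simp only: regularised_plancherel[OF h s])
  finally show ?thesis .
qed

lemma mult_le_half_sum_squares: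
  fixes a b :: real
  shows "a * b \<le> (a\<^sup>2 + b\<^sup>2) / 2"
  using sum_squares_bound[of a b] by simp

text \<open>In the regularised identity, 2 |h(x)| |h(x - s z)| is at most |h(x)|^2 + |h(x - s z)|^2, and the
  integral of either term over x is the squared norm of h for every z.  So the damped integral is
  bounded uniformly in s, and Fatou's lemma removes the damping.\<close>

lemma L2sq_fourier_L1_le:
  fixes h :: "real^'n \<Rightarrow> complex"
  assumes h: "integrable lborel h"
  shows "L2sq (fourier_L1 h) \<le> ennreal ((2 * pi) ^ CARD('n)) * L2sq h"
proof -
  have [measurable]: "h \<in> borel_measurable borel"
    using h by auto
  have [measurable]: "fourier_L1 h \<in> borel_measurable borel"
    by (rule borel_measurable_fourier_L1) measurable
  let ?e = "\<lambda>z::real^'n. exp (- (norm z)\<^sup>2 / 2)"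
  let ?I = "\<lambda>s x z. h x * cnj (h (x - s *\<^sub>R z)) * complex_of_real (?e z)"
  let ?a = "\<lambda>x z. ennreal ((cmod (h x))\<^sup>2 / 2) * ennreal (?e z)"
  let ?b = "\<lambda>s x z. ennreal ((cmod (h (x - s *\<^sub>R z)))\<^sup>2 / 2) * ennreal (?e z)"
  let ?w = "\<lambda>k u. (cmod (fourier_L1 h u))\<^sup>2 * exp (- (norm ((1 / real (Suc k)) *\<^sub>R u))\<^sup>2 / 2)"
  let ?c = "sqrt (2 * pi) ^ CARD('n)"
  have c2: "?c * ?c = (2 * pi) ^ CARD('n)"
    by (simp only: power_mult_distrib[symmetric]) simp
  \<comment> \<open>A bound uniform in s, by the symmetric splitting of the product of h and its translate.\<close>
  have bound: "(\<integral>\<^sup>+u. ennreal ((cmod (fourier_L1 h u))\<^sup>2 * exp (- (norm (s *\<^sub>R u))\<^sup>2 / 2)) \<partial>lborel)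
      \<le> ennreal ((2 * pi) ^ CARD('n)) * L2sq h" if s: "s > 0" for s
  proof -
    have "ennreal (cmod (LINT x|lborel. LINT z|lborel. ?I s x z))
        \<le> (\<integral>\<^sup>+x. ennreal (cmod (LINT z|lborel. ?I s x z)) \<partial>lborel)"
      by (rule ennreal_cmod_lebesgue_integral_le)
    also have "\<dots> \<le> (\<integral>\<^sup>+x. \<integral>\<^sup>+z. ennreal (cmod (?I s x z)) \<partial>lborel \<partial>lborel)"
      by (intro nn_integral_mono ennreal_cmod_lebesgue_integral_le)
    also have "\<dots> \<le> (\<integral>\<^sup>+x. \<integral>\<^sup>+z. ?a x z + ?b s x z \<partial>lborel \<partial>lborel)"
    proof (intro nn_integral_mono)
      fix x z :: "real^'n"
      have "cmod (h x) * cmod (h (x - s *\<^sub>R z)) * ?e z \<le> ((cmod (h x))\<^sup>2 + (cmod (h (x - s *\<^sub>R z)))\<^sup>2) / 2 * ?e z"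
        by (intro mult_right_mono mult_le_half_sum_squares) auto
      then show "ennreal (cmod (?I s x z))
         \<le> ?a x z + ?b s x z"
        by (subst (1 2) ennreal_mult[symmetric]) (auto simp: norm_mult algebra_simps add_divide_distrib simp flip: ennreal_plus)
    qed
    also have "\<dots> = (\<integral>\<^sup>+x. \<integral>\<^sup>+z. ?a x z \<partial>lborel \<partial>lborel)
        + (\<integral>\<^sup>+x. \<integral>\<^sup>+z. ?b s x z \<partial>lborel \<partial>lborel)"
      by (simp add: nn_integral_add)
    also have "(\<integral>\<^sup>+x. \<integral>\<^sup>+z. ?b s x z \<partial>lborel \<partial>lborel)
       = (\<integral>\<^sup>+z. \<integral>\<^sup>+x. ?b s x z \<partial>lborel \<partial>lborel)"
      by (rule lborel_pair.Fubini'[symmetric]) measurable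
    also have "\<dots> = (\<integral>\<^sup>+z. (\<integral>\<^sup>+x. ennreal ((cmod (h x))\<^sup>2 / 2) \<partial>lborel) * ennreal (?e z) \<partial>lborel)"
    proof (intro nn_integral_cong)
      fix z :: "real^'n"
      show "(\<integral>\<^sup>+x. ?b s x z \<partial>lborel)
        = (\<integral>\<^sup>+x. ennreal ((cmod (h x))\<^sup>2 / 2) \<partial>lborel) * ennreal (?e z)"
        using nn_integral_lborel_affine[of "\<lambda>x. ennreal ((cmod (h x))\<^sup>2 / 2)" 1 "- (s *\<^sub>R z)"]
        by (simp add: nn_integral_multc)
    qed
    also have "(\<integral>\<^sup>+x. \<integral>\<^sup>+z. ?a x z \<partial>lborel \<partial>lborel)
       + (\<integral>\<^sup>+z. (\<integral>\<^sup>+x. ennreal ((cmod (h x))\<^sup>2 / 2) \<partial>lborel) * ennreal (?e z) \<partial>lborel)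
       = 2 * (\<integral>\<^sup>+x. ennreal ((cmod (h x))\<^sup>2 / 2) \<partial>lborel) * ennreal ?c"
    proof -
      have "(\<integral>\<^sup>+z. ennreal a * ennreal (?e z) \<partial>lborel) = ennreal a * ennreal ?c" for a
        using nn_integral_gauss[where 'a="real^'n"] by (subst nn_integral_cmult) auto
      moreover have "(\<integral>\<^sup>+z. a * ennreal (?e z) \<partial>lborel) = a * ennreal ?c" for a
        using nn_integral_gauss[where 'a="real^'n"] by (subst nn_integral_cmult) auto
      ultimately show ?thesis
        by (simp only: mult_2 distrib_right) (subst nn_integral_multc, auto)
    qed
    also have "2 * (\<integral>\<^sup>+x. ennreal ((cmod (h x))\<^sup>2 / 2) \<partial>lborel) = L2sq h"
      unfolding L2sq_def
      by (subst nn_integral_cmult[symmetric]) (auto intro!: nn_integral_cong simp: ennreal_mult'[symmetric] simp flip: ennreal_numeral)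
    finally have *: "ennreal (cmod (LINT x|lborel. LINT z|lborel. ?I s x z)) \<le> L2sq h * ennreal ?c" .
    show ?thesis
      unfolding nn_integral_cmod_fourier_L1_gauss[OF h s] norm_mult
      using mult_left_mono[OF * zero_le, of "ennreal ?c"] unfolding c2[symmetric]
      by (simp only: norm_of_real ennreal_mult[OF zero_le_power zero_le_power] ennreal_mult' norm_ge_zero abs_ge_zero
          abs_of_nonneg real_sqrt_ge_zero pi_ge_zero mult_nonneg_nonneg zero_le_numeral zero_le_power mult_ac)
  qed
  have "L2sq (fourier_L1 h) = (\<integral>\<^sup>+u. liminf (\<lambda>k. ennreal (?w k u)) \<partial>lborel)"
    unfolding L2sq_def
  proof (intro nn_integral_cong lim_imp_Liminf[symmetric] trivial_limit_sequentially)
    fix u :: "real^'n"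
    have "(\<lambda>k. ?w k u)
       \<longlonglongrightarrow> (cmod (fourier_L1 h u))\<^sup>2 * exp (- (norm (0 *\<^sub>R u))\<^sup>2 / 2)"
      by (intro tendsto_intros LIMSEQ_Suc lim_1_over_n) auto
    then show "(\<lambda>k. ennreal (?w k u)) \<longlonglongrightarrow> ennreal ((cmod (fourier_L1 h u))\<^sup>2)"
      by (intro tendsto_ennrealI) simp
  qed
  also have "\<dots> \<le> liminf (\<lambda>k. \<integral>\<^sup>+u. ennreal (?w k u) \<partial>lborel)"
    by (rule nn_integral_liminf) measurable
  also have "\<dots> \<le> liminf (\<lambda>k::nat. ennreal ((2 * pi) ^ CARD('n)) * L2sq h)"
    by (intro Liminf_mono always_eventually allI bound) auto
  finally show ?thesis
    by (simp add: Liminf_const)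
qed

text \<open>For continuous h of bounded support, h(x - s z) tends to h(x) boundedly, so the right side of the
  regularised identity tends to (2 pi)^d times the squared norm of h.  The left side is at
  most the squared norm of the Fourier transform for every s.\<close>

lemma L2sq_le_fourier_L1_continuous:
  fixes h :: "real^'n \<Rightarrow> complex"
  assumes cont: "continuous_on UNIV h" and M: "\<And>x. cmod (h x) \<le> M" and supp: "\<And>x. norm x > R \<Longrightarrow> h x = 0"
  shows "ennreal ((2 * pi) ^ CARD('n)) * L2sq h \<le> L2sq (fourier_L1 h)"
proof -
  have [measurable]: "h \<in> borel_measurable borel"
    using cont by (rule borel_measurable_continuous_onI)
  have M0: "0 \<le> M" using order_trans[OF norm_ge_zero M] .
  have hM: "cmod (h x) \<le> M * indicator (cball 0 R) x" for x
    using M supp by (auto simp: indicator_def not_le)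
  have ballint: "integrable lborel (\<lambda>x::real^'n. indicator (cball 0 R) x :: real)"
    using emeasure_lborel_cball_finite by (intro integrable_real_indicator) auto
  have h: "integrable lborel h"
    by (rule Bochner_Integration.integrable_bound[OF integrable_mult_right[of M, OF ballint]])
       (auto intro!: AE_I2 order_trans[OF hM] simp: abs_mult M0)
  let ?e = "\<lambda>z::real^'n. exp (- (norm z)\<^sup>2 / 2)"
  let ?c = "sqrt (2 * pi) ^ CARD('n)"
  let ?s = "\<lambda>k. 1 / real (Suc k)"
  let ?I = "\<lambda>k x z. h x * cnj (h (x - ?s k *\<^sub>R z)) * complex_of_real (?e z)"
  let ?J = "\<lambda>k. LINT x|lborel. LINT z|lborel. ?I k x z" and ?L = "LINT x|lborel. LINT z|lborel. h x * cnj (h x) * complex_of_real (?e z)"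
  have c2: "?c * ?c = (2 * pi) ^ CARD('n)"
    by (simp only: power_mult_distrib[symmetric]) simp
  have e_int: "(LINT z|lborel. complex_of_real (?e z)) = complex_of_real ?c"
    using integral_gauss[where 'a="real^'n"] by (simp only: integral_complex_of_real) simp
  have inner: "(\<lambda>k. LINT z|lborel. ?I k x z)
      \<longlonglongrightarrow> (LINT z|lborel. h x * cnj (h x) * complex_of_real (?e z))" for x
  proof (rule integral_dominated_convergence)
    show "integrable lborel (\<lambda>z. M * M * ?e z)"
      by (intro integrable_mult_right integrable_gauss)
    show "AE z in lborel. (\<lambda>k. ?I k x z) \<longlonglongrightarrow> h x * cnj (h x) * complex_of_real (?e z)"
    proof (rule AE_I2)
      fix z
      have "(\<lambda>k. x - ?s k *\<^sub>R z) \<longlonglongrightarrow> x - 0 *\<^sub>R z"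
        by (intro tendsto_intros LIMSEQ_Suc lim_1_over_n)
      then have "(\<lambda>k. h (x - ?s k *\<^sub>R z)) \<longlonglongrightarrow> h x"
        using continuous_on_tendsto_compose[OF cont] by simp
      then show "(\<lambda>k. ?I k x z) \<longlonglongrightarrow> h x * cnj (h x) * complex_of_real (?e z)"
        by (intro tendsto_intros)
    qed
    show "AE z in lborel. norm (?I k x z) \<le> M * M * ?e z" for k
      by (rule AE_I2) (auto simp: norm_mult intro!: mult_mono M M0)
  qed measurable
  have "(\<lambda>k. LINT x|lborel. LINT z|lborel. ?I k x z)
      \<longlonglongrightarrow> ?L"
  proof (rule integral_dominated_convergence)
    show "integrable lborel (\<lambda>x::real^'n. M * indicator (cball 0 R) x * M * ?c)"
      by (intro integrable_mult_left integrable_mult_right ballint)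
    show "AE x in lborel. norm (LINT z|lborel. ?I k x z) \<le> M * indicator (cball 0 R) x * M * ?c" for k
    proof (rule AE_I2)
      fix x :: "real^'n"
      have "norm (LINT z|lborel. ?I k x z)
          \<le> (LINT z|lborel. (M * indicator (cball 0 R) x * M) * ?e z)"
      proof (rule Bochner_Integration.integral_norm_bound_integral)
        show "integrable lborel (\<lambda>z. (M * indicator (cball 0 R) x * M) * ?e z)"
          by (intro integrable_mult_right integrable_gauss)
        have b: "norm (?I k x z) \<le> (M * indicator (cball 0 R) x * M) * ?e z" for z
          unfolding norm_mult by (intro mult_mono) (auto intro!: hM M mult_nonneg_nonneg M0)
        then show "norm (?I k x z) \<le> (M * indicator (cball 0 R) x * M) * ?e z" for z .
        show "integrable lborel (\<lambda>z. ?I k x z)"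
          by (rule Bochner_Integration.integrable_bound[OF \<open>integrable lborel (\<lambda>z. (M * indicator (cball 0 R) x * M) * ?e z)\<close>])
             (measurable, intro AE_I2 order_trans[OF b], simp only: real_norm_def abs_ge_self)
      qed
      also have "\<dots> = (M * indicator (cball 0 R) x * M) * ?c"
        using integral_gauss[where 'a="real^'n"] by (simp only: integral_mult_right_zero) simp
      finally show "norm (LINT z|lborel. ?I k x z) \<le> M * indicator (cball 0 R) x * M * ?c" .
    qed
  qed (measurable, intro AE_I2 inner)
  then have lim: "(\<lambda>k. ennreal (cmod (complex_of_real ?c * ?J k)))
      \<longlonglongrightarrow> ennreal (cmod (complex_of_real ?c * ?L))"
    by (intro tendsto_intros)
  have sq: "integrable lborel (\<lambda>x. (cmod (h x))\<^sup>2)"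
  proof (rule Bochner_Integration.integrable_bound)
    show "integrable lborel (\<lambda>x::real^'n. M * (M * indicator (cball 0 R) x))"
      by (intro integrable_mult_right ballint)
    show "AE x in lborel. norm ((cmod (h x))\<^sup>2) \<le> norm (M * (M * indicator (cball 0 R) x))"
      by (rule AE_I2) (auto simp: power2_eq_square abs_mult intro!: order_trans[OF mult_mono[OF M hM]] M0)
  qed measurable
  have "complex_of_real ?c * ?L
      = complex_of_real ((2 * pi) ^ CARD('n)) * (LINT x|lborel. complex_of_real ((cmod (h x))\<^sup>2))"
    unfolding complex_norm_square c2[symmetric]
    by (simp only: integral_mult_right_zero integral_mult_left_zero e_int of_real_mult) (simp only: mult_ac)
  also have "\<dots> = complex_of_real ((2 * pi) ^ CARD('n) * (LINT x|lborel. (cmod (h x))\<^sup>2))"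
    by (simp only: integral_complex_of_real of_real_mult)
  finally have "ennreal (cmod (complex_of_real ?c * ?L))
      = ennreal (cmod (complex_of_real ((2 * pi) ^ CARD('n) * (LINT x|lborel. (cmod (h x))\<^sup>2))))"
    by (simp only:)
  also have "\<dots> = ennreal ((2 * pi) ^ CARD('n) * (LINT x|lborel. (cmod (h x))\<^sup>2))"
  proof -
    have "(2 * pi) ^ CARD('n) * (LINT x|lborel. (cmod (h x))\<^sup>2) \<ge> 0"
      by (intro mult_nonneg_nonneg integral_nonneg_AE) auto
    then show "ennreal (cmod (complex_of_real ((2 * pi) ^ CARD('n) * (LINT x|lborel. (cmod (h x))\<^sup>2)))) = ennreal ((2 * pi) ^ CARD('n) * (LINT x|lborel. (cmod (h x))\<^sup>2))"
      by (simp only: norm_of_real abs_of_nonneg)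
  qed
  also have "\<dots> = ennreal ((2 * pi) ^ CARD('n)) * L2sq h"
    unfolding L2sq_def by (subst nn_integral_eq_integral[OF sq]) (auto simp: ennreal_mult intro!: integral_nonneg_AE)
  finally have val: "ennreal (cmod (complex_of_real ?c * ?L))
      = ennreal ((2 * pi) ^ CARD('n)) * L2sq h" .
  show ?thesis
    unfolding val[symmetric]
  proof (rule LIMSEQ_le_const2[OF lim], intro exI[of _ 0] allI impI)
    fix k
    show "ennreal (cmod (complex_of_real ?c * ?J k)) \<le> L2sq (fourier_L1 h)"
      unfolding L2sq_def by (subst nn_integral_cmod_fourier_L1_gauss[OF h, symmetric])
        (auto intro!: nn_integral_mono ennreal_leI mult_left_le)
  qed
qed

section \<open>Square-integrable functions and their limits\<close>

lemma ennreal_tendsto_0_if_le: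
  fixes f g :: "nat \<Rightarrow> ennreal"
  assumes "g \<longlonglongrightarrow> 0" and "\<And>k. f k \<le> g k"
  shows "f \<longlonglongrightarrow> 0"
  by (rule tendsto_sandwich[OF _ _ tendsto_const assms(1)]) (use assms(2) in auto)

lemma two_mult_ennreal_add: "a \<ge> 0 \<Longrightarrow> 2 * ennreal a + 2 * ennreal a = ennreal (4 * a)"
  unfolding mult_2 by (subst ennreal_plus[symmetric]; simp)+

text \<open>A quadratic substitute for the triangle inequality.  As the weight may be taken arbitrarily small, no
  constant is lost when limits in L2 are taken, and square roots of extended reals are avoided.\<close>

lemma norm_square_le_weighted:
  fixes a b :: complex
  assumes d: "\<delta> > 0"
  shows "(cmod a)\<^sup>2 \<le> (1 + \<delta>) * (cmod b)\<^sup>2 + (1 + 1 / \<delta>) * (cmod (a - b))\<^sup>2"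
proof -
  let ?x = "cmod b" and ?y = "cmod (a - b)"
  have "cmod a \<le> ?x + ?y"
    using norm_triangle_ineq[of b "a - b"] by simp
  then have "(cmod a)\<^sup>2 \<le> (?x + ?y)\<^sup>2"
    by (intro power_mono) auto
  also have "\<dots> = ?x\<^sup>2 + ?y\<^sup>2 + 2 * ?x * ?y"
    by (simp add: power2_sum)
  also have "\<dots> \<le> (1 + \<delta>) * ?x\<^sup>2 + (1 + 1 / \<delta>) * ?y\<^sup>2"
  proof -
    have "0 \<le> (\<delta> * ?x - ?y)\<^sup>2 / \<delta>"
      using d by simp
    also have "\<dots> = \<delta> * ?x\<^sup>2 + ?y\<^sup>2 / \<delta> - 2 * ?x * ?y"
      using d by (simp add: power2_diff field_simps power2_eq_square)
    finally show ?thesis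
      by (simp add: algebra_simps)
  qed
  finally show ?thesis .
qed

lemma L2sq_le_weighted:
  assumes d: "\<delta> > 0" and [measurable]: "f \<in> borel_measurable borel" "g \<in> borel_measurable borel"
  shows "L2sq f \<le> ennreal (1 + \<delta>) * L2sq g + ennreal (1 + 1 / \<delta>) * L2sq (\<lambda>x. f x - g x)"
proof -
  have "L2sq f \<le> (\<integral>\<^sup>+x. ennreal (1 + \<delta>) * ennreal ((cmod (g x))\<^sup>2) + ennreal (1 + 1 / \<delta>) * ennreal ((cmod (f x - g x))\<^sup>2) \<partial>lborel)"
    unfolding L2sq_def using d
    by (intro nn_integral_mono) (simp add: norm_square_le_weighted ennreal_leI flip: ennreal_mult ennreal_plus)
  then show ?thesis
    by (simp add: nn_integral_add nn_integral_cmult L2sq_def)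
qed

lemma L2sq_diff_commute: "L2sq (\<lambda>x. f x - g x) = L2sq (\<lambda>x. g x - f x)"
  by (simp add: L2sq_def norm_minus_commute)

lemma L2sq_diff_le:
  assumes [measurable]: "f \<in> borel_measurable borel" "g \<in> borel_measurable borel"
  shows "L2sq (\<lambda>x. f x - g x) \<le> 2 * L2sq f + 2 * L2sq g"
  using L2sq_le_weighted[of 1 "\<lambda>x. f x - g x" f] by (simp add: L2sq_def)

text \<open>Norm inequalities pass to limits in L2.  This carries the lower half of Plancherel from
  continuous to integrable functions, and later from integrable functions to all of L2.\<close>

lemma L2sq_le_of_limit:
  fixes h g :: "'a::euclidean_space \<Rightarrow> complex" and hs gs :: "nat \<Rightarrow> 'a \<Rightarrow> complex"
  assumes m [measurable]: "h \<in> borel_measurable borel" "g \<in> borel_measurable borel"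
      "\<And>k. hs k \<in> borel_measurable borel" "\<And>k. gs k \<in> borel_measurable borel"
    and h: "(\<lambda>k. L2sq (\<lambda>x. hs k x - h x)) \<longlonglongrightarrow> 0"
    and g: "(\<lambda>k. L2sq (\<lambda>x. gs k x - g x)) \<longlonglongrightarrow> 0"
    and fin: "L2sq g < \<infinity>" and c: "c \<ge> 0"
    and le: "\<And>k. L2sq (hs k) \<le> ennreal c * L2sq (gs k)"
  shows "L2sq h \<le> ennreal c * L2sq g"
proof -
  \<comment> \<open>The weighted inequality is used once for h and once for g, hence the factor (1 + \<delta>) twice.\<close>
  have weighted: "L2sq h \<le> ennreal ((1 + \<delta>) * c * (1 + \<delta>)) * L2sq g" if d: "\<delta> > 0" for \<delta>
  proof -
    have "L2sq h \<le> ennreal (1 + \<delta>) * (ennreal c * (ennreal (1 + \<delta>) * L2sq g + ennreal (1 + 1 / \<delta>) * L2sq (\<lambda>x. gs k x - g x)))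
        + ennreal (1 + 1 / \<delta>) * L2sq (\<lambda>x. hs k x - h x)" (is "_ \<le> ?r k") for k
    proof -
      have "L2sq h \<le> ennreal (1 + \<delta>) * L2sq (hs k) + ennreal (1 + 1 / \<delta>) * L2sq (\<lambda>x. h x - hs k x)"
        by (intro L2sq_le_weighted d m)
      also have "\<dots> \<le> ennreal (1 + \<delta>) * (ennreal c * L2sq (gs k)) + ennreal (1 + 1 / \<delta>) * L2sq (\<lambda>x. hs k x - h x)"
        by (intro add_mono mult_left_mono le) (auto simp: L2sq_diff_commute)
      also have "\<dots> \<le> ?r k"
        by (intro add_mono mult_left_mono L2sq_le_weighted d m order_refl) auto
      finally show ?thesis .
    qed
    moreover have "?r \<longlonglongrightarrow> ennreal (1 + \<delta>) * (ennreal c * (ennreal (1 + \<delta>) * L2sq g + ennreal (1 + 1 / \<delta>) * 0)) + ennreal (1 + 1 / \<delta>) * 0"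
      by (intro tendsto_add ennreal_tendsto_cmult tendsto_const h g) auto
    ultimately have "L2sq h \<le> ennreal (1 + \<delta>) * (ennreal c * (ennreal (1 + \<delta>) * L2sq g + ennreal (1 + 1 / \<delta>) * 0)) + ennreal (1 + 1 / \<delta>) * 0"
      by (intro LIMSEQ_le_const) auto
    then show ?thesis
      using d c by (simp add: ennreal_mult mult_ac)
  qed
  have "(\<lambda>k. (1 + 1 / real (Suc k)) * c * (1 + 1 / real (Suc k))) \<longlonglongrightarrow> (1 + 0) * c * (1 + 0)"
    by (intro tendsto_intros LIMSEQ_Suc lim_1_over_n)
  then have "(\<lambda>k. ennreal ((1 + 1 / real (Suc k)) * c * (1 + 1 / real (Suc k))) * L2sq g) \<longlonglongrightarrow> ennreal c * L2sq g"
    using fin by (subst (1 2) mult.commute, intro ennreal_tendsto_cmult tendsto_ennrealI) auto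
  then show ?thesis
    using weighted by (intro LIMSEQ_le_const) (auto intro!: exI[of _ 0])
qed

text \<open>Fast convergent sequences in L2 have a limit.  The weights 4^k bound the k-th increment at almost every
  point by a constant times 2^(-k), so the sequence converges pointwise, and the tail from m on is
  dominated by a fixed integrable function times 4^(-m).\<close>

lemma L2sq_complete:
  fixes g :: "nat \<Rightarrow> 'a::euclidean_space \<Rightarrow> complex"
  assumes [measurable]: "\<And>k. g k \<in> borel_measurable borel"
    and fin: "(\<Sum>k. ennreal (4 ^ k) * L2sq (\<lambda>x. g (Suc k) x - g k x)) < \<infinity>"
  shows "\<exists>G\<in>borel_measurable borel. (\<lambda>k. L2sq (\<lambda>x. g k x - G x)) \<longlonglongrightarrow> 0"
proof -
  define S where "S x = (\<Sum>k. ennreal (4 ^ k) * ennreal ((cmod (g (Suc k) x - g k x))\<^sup>2))" for x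
  have [measurable]: "S \<in> borel_measurable borel"
    unfolding S_def[abs_def] by measurable
  have S: "(\<integral>\<^sup>+x. S x \<partial>lborel) < \<infinity>"
    using fin unfolding S_def L2sq_def by (simp add: nn_integral_suminf nn_integral_cmult)
  then have AE: "AE x in lborel. S x \<noteq> \<infinity>"
    by (intro nn_integral_PInf_AE) auto
  define G where "G x = lim (\<lambda>k. g k x)" for x
  have [measurable]: "G \<in> borel_measurable borel"
    unfolding G_def[abs_def] by measurable
  have pt: "ennreal ((cmod (g m x - G x))\<^sup>2) \<le> ennreal (4 / 4 ^ m) * S x" if Sx: "S x \<noteq> \<infinity>" for x m
  proof -
    obtain s where s: "S x = ennreal s" "s \<ge> 0"
      using Sx by (cases "S x") auto
    \<comment> \<open>A single term of the series S x bounds the k-th increment.\<close>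
    have inc: "cmod (g (Suc k) x - g k x) \<le> sqrt s / 2 ^ k" for k
    proof -
      have "ennreal (4 ^ k) * ennreal ((cmod (g (Suc k) x - g k x))\<^sup>2) \<le> S x"
        unfolding S_def using sum_le_suminf[of "\<lambda>k. ennreal (4 ^ k) * ennreal ((cmod (g (Suc k) x - g k x))\<^sup>2)" "{k}"] by simp
      then have "4 ^ k * (cmod (g (Suc k) x - g k x))\<^sup>2 \<le> s"
        using s by (simp flip: ennreal_mult)
      then have "(2 ^ k * cmod (g (Suc k) x - g k x))\<^sup>2 \<le> s"
        by (simp add: power_mult_distrib power_even_eq power_mult[symmetric] mult.commute[of k] power_mult)
      then have "2 ^ k * cmod (g (Suc k) x - g k x) \<le> sqrt s"
        by (rule real_le_rsqrt)
      then show ?thesis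
        by (simp add: field_simps)
    qed
    have tail: "cmod (g (m + j) x - g m x) \<le> sqrt s * (2 / 2 ^ m) * (1 - 1 / 2 ^ j)" for m j
    proof (induction j)
      case (Suc j)
      have "cmod (g (m + Suc j) x - g m x) \<le> cmod (g (Suc (m + j)) x - g (m + j) x) + cmod (g (m + j) x - g m x)"
        using norm_triangle_ineq[of "g (Suc (m + j)) x - g (m + j) x" "g (m + j) x - g m x"] by simp
      also have "\<dots> \<le> sqrt s / 2 ^ (m + j) + sqrt s * (2 / 2 ^ m) * (1 - 1 / 2 ^ j)"
        by (intro add_mono inc Suc)
      also have "\<dots> = sqrt s * (2 / 2 ^ m) * (1 - 1 / 2 ^ Suc j)"
        by (simp add: field_simps power_add)
      finally show ?case .
    qed simp
    have tail': "cmod (g n x - g m x) \<le> sqrt s * (2 / 2 ^ m)" if "n \<ge> m" for n m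
    proof -
      have "cmod (g n x - g m x) \<le> sqrt s * (2 / 2 ^ m) * (1 - 1 / 2 ^ (n - m))"
        using tail[of m "n - m"] that by simp
      also have "\<dots> \<le> sqrt s * (2 / 2 ^ m) * 1"
        using s by (intro mult_left_mono) auto
      finally show ?thesis by simp
    qed
    have z: "(\<lambda>m. sqrt s * (2 * (1 / 2) ^ m)) \<longlonglongrightarrow> sqrt s * (2 * 0)"
      by (intro tendsto_intros LIMSEQ_power_zero) auto
    have "Cauchy (\<lambda>k. g k x)"
    proof (rule metric_CauchyI)
      fix e :: real assume "e > 0"
      then have "\<forall>\<^sub>F m in sequentially. sqrt s * (2 * (1 / 2) ^ m) < e / 2"
        using order_tendstoD(2)[OF z, of "e / 2"] by simp
      then obtain N where N: "sqrt s * (2 * (1 / 2) ^ N) < e / 2"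
        by (auto simp: eventually_sequentially)
      have "dist (g i x) (g N x) < e / 2" if "i \<ge> N" for i
      proof -
        have "cmod (g i x - g N x) \<le> sqrt s * (2 * (1 / 2) ^ N)"
          using tail'[OF that] by (simp add: power_divide)
        with N show ?thesis
          by (simp only: dist_norm)
      qed
      then show "\<exists>M. \<forall>m\<ge>M. \<forall>n\<ge>M. dist (g m x) (g n x) < e"
        by (metis dist_triangle_half_l dist_commute)
    qed
    then have "(\<lambda>k. g k x) \<longlonglongrightarrow> G x"
      unfolding G_def by (simp add: Cauchy_convergent_iff convergent_LIMSEQ_iff)
    then have "(\<lambda>n. cmod (g n x - g m x)) \<longlonglongrightarrow> cmod (G x - g m x)"
      by (intro tendsto_intros)
    then have "cmod (G x - g m x) \<le> sqrt s * (2 / 2 ^ m)"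
      by (rule LIMSEQ_le_const2) (use tail' in auto)
    then have "(cmod (g m x - G x))\<^sup>2 \<le> (sqrt s * (2 / 2 ^ m))\<^sup>2"
      by (intro power_mono) (auto simp: norm_minus_commute)
    also have "\<dots> = 4 / 4 ^ m * s"
      using s by (simp add: power_mult_distrib power_divide power_mult[symmetric] mult.commute[of m] power_mult)
    finally show ?thesis
      using s by (simp add: ennreal_leI flip: ennreal_mult)
  qed
  have bound: "L2sq (\<lambda>x. g m x - G x) \<le> (\<integral>\<^sup>+x. S x \<partial>lborel) * ennreal (4 / 4 ^ m)" for m
  proof -
    have bound: "L2sq (\<lambda>x. g m x - G x) \<le> (\<integral>\<^sup>+x. ennreal (4 / 4 ^ m) * S x \<partial>lborel)"
      unfolding L2sq_def by (intro nn_integral_mono_AE) (use AE pt in \<open>auto elim!: eventually_mono\<close>)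
    then show ?thesis
      by (subst (asm) nn_integral_cmult) (simp_all add: mult.commute)
  qed
  have "(\<lambda>m. (\<integral>\<^sup>+x. S x \<partial>lborel) * ennreal (4 / 4 ^ m)) \<longlonglongrightarrow> (\<integral>\<^sup>+x. S x \<partial>lborel) * ennreal 0"
  proof (intro ennreal_tendsto_cmult tendsto_ennrealI)
    have "(\<lambda>m::nat. 4 * (1 / 4) ^ m :: real) \<longlonglongrightarrow> 4 * 0"
      by (intro tendsto_intros LIMSEQ_power_zero) auto
    then show "(\<lambda>m. 4 / 4 ^ m :: real) \<longlonglongrightarrow> 0"
      by (simp add: power_divide)
  qed (use S in auto)
  then have "(\<lambda>m. (\<integral>\<^sup>+x. S x \<partial>lborel) * ennreal (4 / 4 ^ m)) \<longlonglongrightarrow> 0"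
    by simp
  from ennreal_tendsto_0_if_le[OF this bound] have "(\<lambda>k. L2sq (\<lambda>x. g k x - G x)) \<longlonglongrightarrow> 0" .
  then show ?thesis by auto
qed

section \<open>Density of continuous functions and the Fourier transform on L2\<close>

lemma L2sq_dominated_convergence:
  fixes hs :: "nat \<Rightarrow> 'a::euclidean_space \<Rightarrow> complex" and w :: "'a \<Rightarrow> real"
  assumes [measurable]: "\<And>k. hs k \<in> borel_measurable borel" "h \<in> borel_measurable borel" "w \<in> borel_measurable borel"
    and w: "(\<integral>\<^sup>+x. ennreal (w x) \<partial>lborel) < \<infinity>"
    and le: "\<And>k. AE x in lborel. (cmod (hs k x - h x))\<^sup>2 \<le> w x"
    and lim: "AE x in lborel. (\<lambda>k. hs k x) \<longlonglongrightarrow> h x"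
  shows "(\<lambda>k. L2sq (\<lambda>x. hs k x - h x)) \<longlonglongrightarrow> 0"
proof -
  have "(\<lambda>k. \<integral>\<^sup>+x. ennreal ((cmod (hs k x - h x))\<^sup>2) \<partial>lborel) \<longlonglongrightarrow> (\<integral>\<^sup>+x. 0 \<partial>(lborel :: 'a measure))"
  proof (rule nn_integral_dominated_convergence)
    show "AE x in lborel. ennreal ((cmod (hs k x - h x))\<^sup>2) \<le> ennreal (w x)" for k
      using le[of k] by eventually_elim (rule ennreal_leI)
    show "AE x in lborel. (\<lambda>k. ennreal ((cmod (hs k x - h x))\<^sup>2)) \<longlonglongrightarrow> 0"
      using lim
    proof eventually_elim
      case (elim x)
      then have "(\<lambda>k. (cmod (hs k x - h x))\<^sup>2) \<longlonglongrightarrow> (cmod (h x - h x))\<^sup>2"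
        by (intro tendsto_intros)
      then show ?case
        using tendsto_ennrealI by fastforce
    qed
  qed (use w in auto)
  then show ?thesis
    by (simp add: L2sq_def)
qed

lemma square_integrable_iff_L2sq:
  fixes h :: "real^'n \<Rightarrow> complex"
  shows "square_integrable h \<longleftrightarrow> h \<in> borel_measurable borel \<and> L2sq h < \<infinity>"
  unfolding square_integrable_def L2sq_def integrable_iff_bounded by auto

text \<open>A measurable function is an almost everywhere limit of continuous functions.  Projecting their
  values onto the disc of radius M and multiplying them by a continuous cut-off makes the
  convergence dominated, and changes neither the limit nor the continuity.\<close>

lemma continuous_dense_in_bounded_support:
  fixes h :: "real^'n \<Rightarrow> complex"
  assumes [measurable]: "h \<in> borel_measurable borel" and M: "\<And>x. cmod (h x) \<le> M" and supp: "\<And>x. norm x > R \<Longrightarrow> h x = 0"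
  shows "\<exists>\<psi>. (\<forall>k. continuous_on UNIV (\<psi> k) \<and> (\<forall>x. cmod (\<psi> k x) \<le> M) \<and> (\<forall>x. norm x > R + 1 \<longrightarrow> \<psi> k x = 0))
           \<and> (\<lambda>k. L2sq (\<lambda>x. \<psi> k x - h x)) \<longlonglongrightarrow> 0"
proof -
  have M0: "0 \<le> M" using order_trans[OF norm_ge_zero M] .
  have "h \<in> borel_measurable lebesgue"
    by (rule measurable_completion) simp
  then have "h measurable_on UNIV"
    by (subst measurable_on_iff_borel_measurable) auto
  then obtain N g where N: "negligible N" and g: "\<And>k. continuous_on UNIV (g k)"
    and lim: "\<And>x. x \<notin> N \<Longrightarrow> (\<lambda>k. g k x) \<longlonglongrightarrow> h x"
    by (auto simp: measurable_on_def)
  \<comment> \<open>The projection onto the disc is continuous and fixes the values of h.\<close>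
  let ?p = "closest_point (cball 0 M :: complex set)"
  have cp: "continuous_on UNIV ?p"
    using M0 by (intro continuous_on_closest_point) auto
  have pM: "cmod (?p z) \<le> M" for z
    using closest_point_in_set[of "cball 0 M" z] M0 by auto
  define c :: "real^'n \<Rightarrow> real" where "c x = max 0 (min 1 (R + 1 - norm x))" for x
  have c: "0 \<le> c x" "c x \<le> 1" for x
    by (auto simp: c_def)
  define \<psi> where "\<psi> k x = complex_of_real (c x) * ?p (g k x)" for k x
  have cont: "continuous_on UNIV (\<psi> k)" for k
  proof -
    have "continuous_on UNIV (\<lambda>x. ?p (g k x))"
      by (rule continuous_on_compose2[OF cp g]) auto
    then show ?thesis
      unfolding \<psi>_def[abs_def] c_def by (intro continuous_intros)
  qed
  have [measurable]: "\<psi> k \<in> borel_measurable borel" for k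
    using cont by (rule borel_measurable_continuous_onI)
  have bd: "cmod (\<psi> k x) \<le> M" for k x
    unfolding \<psi>_def norm_mult using mult_mono[OF c(2)[of x] pM[of "g k x"]] c[of x] by simp
  have zero: "\<psi> k x = 0" if "norm x > R + 1" for k x
    using that by (simp add: \<psi>_def c_def)
  have [measurable]: "cball (0::real^'n) (R + 1) \<in> sets borel"
    by (rule borel_closed) simp
  have "(\<lambda>k. L2sq (\<lambda>x. \<psi> k x - h x)) \<longlonglongrightarrow> 0"
  proof (rule L2sq_dominated_convergence[where w="\<lambda>x. (2 * M)\<^sup>2 * indicator (cball 0 (R + 1)) x"])
    show "(\<integral>\<^sup>+x. ennreal ((2 * M)\<^sup>2 * indicator (cball 0 (R + 1)) (x::real^'n)) \<partial>lborel) < \<infinity>"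
      using emeasure_lborel_cball_finite[of "0::real^'n" "R + 1"]
      by (simp only: ennreal_mult'[OF zero_le_power2] ennreal_indicator nn_integral_cmult_indicator sets_lborel borel_closed closed_cball) (simp add: ennreal_mult_less_top)
    show "AE x in lborel. (cmod (\<psi> k x - h x))\<^sup>2 \<le> (2 * M)\<^sup>2 * indicator (cball 0 (R + 1)) x" for k
    proof (rule AE_I2)
      fix x :: "real^'n"
      have "cmod (\<psi> k x - h x) \<le> 2 * M"
        using norm_triangle_ineq4[of "\<psi> k x" "h x"] bd[of k x] M[of x] by simp
      then have "(cmod (\<psi> k x - h x))\<^sup>2 \<le> (2 * M)\<^sup>2"
        by (intro power_mono) auto
      then show "(cmod (\<psi> k x - h x))\<^sup>2 \<le> (2 * M)\<^sup>2 * indicator (cball 0 (R + 1)) x"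
        using supp[of x] zero[of x k] by (auto simp: indicator_def)
    qed
    have "AE x in lborel. x \<notin> N"
      using AE_not_in[OF iffD1[OF negligible_iff_null_sets N]] by (simp only: AE_completion_iff)
    then show "AE x in lborel. (\<lambda>k. \<psi> k x) \<longlonglongrightarrow> h x"
    proof eventually_elim
      case (elim x)
      have "(\<lambda>k. ?p (g k x)) \<longlonglongrightarrow> ?p (h x)"
        by (rule continuous_on_tendsto_compose[OF cp lim[OF elim]]) auto
      moreover have "?p (h x) = h x"
        using M by (intro closest_point_self) auto
      ultimately have "(\<lambda>k. \<psi> k x) \<longlonglongrightarrow> complex_of_real (c x) * h x"
        unfolding \<psi>_def by (intro tendsto_intros) simp
      moreover have "complex_of_real (c x) * h x = h x"
        using supp[of x] by (cases "norm x > R") (auto simp: c_def)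
      ultimately show ?case by simp
    qed
  qed measurable
  with cont bd zero show ?thesis
    by (intro exI[of _ \<psi>]) auto
qed

definition continuous_bounded_support :: "('a::euclidean_space \<Rightarrow> complex) \<Rightarrow> bool" where
  "continuous_bounded_support \<psi> \<longleftrightarrow> continuous_on UNIV \<psi> \<and> (\<exists>M. \<forall>x. cmod (\<psi> x) \<le> M) \<and> (\<exists>R. \<forall>x. norm x > R \<longrightarrow> \<psi> x = 0)"

text \<open>Truncation of the values and of the support reduces the claim to the bounded case.\<close>

lemma continuous_bounded_support_dense:
  fixes h :: "real^'n \<Rightarrow> complex"
  assumes h: "square_integrable h" and e: "e > 0"
  shows "\<exists>\<psi>. continuous_bounded_support \<psi> \<and> L2sq (\<lambda>x. \<psi> x - h x) < ennreal e"
proof -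
  have [measurable]: "h \<in> borel_measurable borel" and fin: "L2sq h < \<infinity>"
    using h by (auto simp: square_integrable_iff_L2sq)
  define hk where "hk k x = (if norm x \<le> real k \<and> cmod (h x) \<le> real k then h x else 0)" for k x
  have [measurable]: "hk k \<in> borel_measurable borel" for k
    unfolding hk_def[abs_def] by measurable
  have "(\<lambda>k. L2sq (\<lambda>x. hk k x - h x)) \<longlonglongrightarrow> 0"
  proof (rule L2sq_dominated_convergence[where w="\<lambda>x. (cmod (h x))\<^sup>2"])
    show "(\<integral>\<^sup>+x. ennreal ((cmod (h x))\<^sup>2) \<partial>lborel) < \<infinity>"
      using fin by (simp add: L2sq_def)
    show "AE x in lborel. (cmod (hk k x - h x))\<^sup>2 \<le> (cmod (h x))\<^sup>2" for k
      by (auto simp: hk_def)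
    show "AE x in lborel. (\<lambda>k. hk k x) \<longlonglongrightarrow> h x"
    proof (rule AE_I2, rule tendsto_eventually)
      fix x
      obtain k0 where "max (norm x) (cmod (h x)) \<le> real k0"
        using real_arch_simple by blast
      then show "\<forall>\<^sub>F k in sequentially. hk k x = h x"
        by (intro eventually_sequentiallyI[of k0]) (auto simp: hk_def)
    qed
  qed measurable
  then have "\<forall>\<^sub>F k in sequentially. L2sq (\<lambda>x. hk k x - h x) < ennreal (e / 4)"
    using e by (intro order_tendstoD(2)) auto
  then obtain k where k: "L2sq (\<lambda>x. hk k x - h x) < ennreal (e / 4)"
    by (auto simp: eventually_sequentially)
  obtain \<psi> where \<psi>: "\<And>j. continuous_bounded_support (\<psi> j)" and lim: "(\<lambda>j. L2sq (\<lambda>x. \<psi> j x - hk k x)) \<longlonglongrightarrow> 0"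
    using continuous_dense_in_bounded_support[of "hk k" "real k" "real k"]
    unfolding continuous_bounded_support_def by (fastforce simp: hk_def)
  have "\<forall>\<^sub>F j in sequentially. L2sq (\<lambda>x. \<psi> j x - hk k x) < ennreal (e / 4)"
    using e lim by (intro order_tendstoD(2)) auto
  then obtain j where j: "L2sq (\<lambda>x. \<psi> j x - hk k x) < ennreal (e / 4)"
    by (auto simp: eventually_sequentially)
  have [measurable]: "\<psi> j \<in> borel_measurable borel"
    using \<psi>[of j] unfolding continuous_bounded_support_def by (auto intro: borel_measurable_continuous_onI)
  have "L2sq (\<lambda>x. \<psi> j x - h x) = L2sq (\<lambda>x. (\<psi> j x - hk k x) - (h x - hk k x))"
    by simp
  also have "\<dots> \<le> 2 * L2sq (\<lambda>x. \<psi> j x - hk k x) + 2 * L2sq (\<lambda>x. h x - hk k x)"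
    by (rule L2sq_diff_le) measurable
  also have "\<dots> < 2 * ennreal (e / 4) + 2 * ennreal (e / 4)"
    using j k by (intro add_strict_mono ennreal_mult_strict_left_mono) (auto simp: L2sq_diff_commute)
  also have "\<dots> = ennreal e"
    using e by (subst two_mult_ennreal_add) auto
  finally show ?thesis
    using \<psi> by blast
qed

lemma integrable_continuous_bounded_support:
  fixes \<psi> :: "real^'n \<Rightarrow> complex"
  assumes "continuous_bounded_support \<psi>"
  shows "integrable lborel \<psi>" "\<psi> \<in> borel_measurable borel"
proof -
  obtain M R where c: "continuous_on UNIV \<psi>" and M: "\<And>x. cmod (\<psi> x) \<le> M" and R: "\<And>x. norm x > R \<Longrightarrow> \<psi> x = 0"
    using assms unfolding continuous_bounded_support_def by blast
  show m: "\<psi> \<in> borel_measurable borel"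
    using c by (rule borel_measurable_continuous_onI)
  have "integrable lborel (\<lambda>x::real^'n. indicator (cball 0 R) x :: real)"
    using emeasure_lborel_cball_finite by (intro integrable_real_indicator) auto
  then have "integrable lborel (\<lambda>x::real^'n. M * indicator (cball 0 R) x)"
    by (intro integrable_mult_right)
  then show "integrable lborel \<psi>"
  proof (rule Bochner_Integration.integrable_bound)
    show "AE x in lborel. norm (\<psi> x) \<le> norm (M * indicator (cball 0 R) x)"
      using M R by (intro AE_I2) (auto simp: indicator_def not_le intro: order_trans[OF M abs_ge_self])
  qed (use m in measurable)
qed

lemma continuous_bounded_support_plancherel:
  fixes \<psi> :: "real^'n \<Rightarrow> complex"
  assumes "continuous_bounded_support \<psi>"
  shows "ennreal ((2 * pi) ^ CARD('n)) * L2sq \<psi> \<le> L2sq (fourier_L1 \<psi>)"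
  using assms L2sq_le_fourier_L1_continuous[of \<psi>] unfolding continuous_bounded_support_def by blast

lemma fourier_L1_diff:
  fixes f g :: "real^'n \<Rightarrow> complex"
  assumes "integrable lborel f" "integrable lborel g"
  shows "fourier_L1 (\<lambda>x. f x - g x) = (\<lambda>u. fourier_L1 f u - fourier_L1 g u)"
  using integrable_mult_iexp[OF assms(1)] integrable_mult_iexp[OF assms(2)]
  by (simp add: fourier_L1_def fun_eq_iff left_diff_distrib)

lemma ennreal_inverse_two_pi_mult:
  "ennreal (1 / (2 * pi) ^ n) * (ennreal ((2 * pi) ^ n) * x) = x"
  by (simp add: mult.assoc[symmetric] flip: ennreal_mult)

text \<open>The lower half of Plancherel for all integrable square-integrable functions: by the upper half,
  the transforms of approximating continuous functions converge as well.\<close>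

lemma L2sq_le_fourier_L1:
  fixes h :: "real^'n \<Rightarrow> complex"
  assumes h: "integrable lborel h" "square_integrable h"
  shows "L2sq h \<le> ennreal (1 / (2 * pi) ^ CARD('n)) * L2sq (fourier_L1 h)"
proof -
  have m: "h \<in> borel_measurable borel" and fin: "L2sq h < \<infinity>"
    using h by (auto simp: square_integrable_iff_L2sq)
  have "\<exists>\<psi>. continuous_bounded_support \<psi> \<and> L2sq (\<lambda>x. \<psi> x - h x) < ennreal (1 / real (Suc k))" for k
    by (rule continuous_bounded_support_dense[OF h(2)]) simp
  then obtain \<psi> where \<psi>: "\<And>k. continuous_bounded_support (\<psi> k)" and e: "\<And>k. L2sq (\<lambda>x. \<psi> k x - h x) < ennreal (1 / real (Suc k))"
    by metis
  note int = integrable_continuous_bounded_support[OF \<psi>]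
  have "(\<lambda>k. ennreal (1 / real (Suc k))) \<longlonglongrightarrow> ennreal 0"
    by (intro tendsto_ennrealI LIMSEQ_Suc lim_1_over_n)
  then have "(\<lambda>k. ennreal (1 / real (Suc k))) \<longlonglongrightarrow> 0"
    by simp
  from ennreal_tendsto_0_if_le[OF this less_imp_le[OF e]]
  have lim: "(\<lambda>k. L2sq (\<lambda>x. \<psi> k x - h x)) \<longlonglongrightarrow> 0" .
  show ?thesis
  proof (rule L2sq_le_of_limit[where hs=\<psi> and gs="\<lambda>k. fourier_L1 (\<psi> k)"])
    have bound: "L2sq (\<lambda>u. fourier_L1 (\<psi> k) u - fourier_L1 h u) \<le> ennreal ((2 * pi) ^ CARD('n)) * L2sq (\<lambda>x. \<psi> k x - h x)" for k
      using L2sq_fourier_L1_le[of "\<lambda>x. \<psi> k x - h x"] int h(1) by (simp add: fourier_L1_diff)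
    have "(\<lambda>k. ennreal ((2 * pi) ^ CARD('n)) * L2sq (\<lambda>x. \<psi> k x - h x)) \<longlonglongrightarrow> ennreal ((2 * pi) ^ CARD('n)) * 0"
      by (intro ennreal_tendsto_cmult lim) auto
    then have "(\<lambda>k. ennreal ((2 * pi) ^ CARD('n)) * L2sq (\<lambda>x. \<psi> k x - h x)) \<longlonglongrightarrow> 0"
      by simp
    from ennreal_tendsto_0_if_le[OF this bound]
    show "(\<lambda>k. L2sq (\<lambda>u. fourier_L1 (\<psi> k) u - fourier_L1 h u)) \<longlonglongrightarrow> 0" .
    show "L2sq (\<psi> k) \<le> ennreal (1 / (2 * pi) ^ CARD('n)) * L2sq (fourier_L1 (\<psi> k))" for k
      using mult_left_mono[OF continuous_bounded_support_plancherel[OF \<psi>[of k]] zero_le, of "ennreal (1 / (2 * pi) ^ CARD('n))"]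
      by (simp only: ennreal_inverse_two_pi_mult)
    show "L2sq (fourier_L1 h) < \<infinity>"
      using L2sq_fourier_L1_le[OF h(1)] fin by (auto simp: ennreal_mult_less_top intro: order_le_less_trans)
  qed (use m int lim in \<open>auto intro: borel_measurable_fourier_L1\<close>)
qed

text \<open>Approximate h by continuous functions of bounded support with squared error at most 8^(-k).  The
  upper half of Plancherel turns this into a bound of order 8^(-k) for the increments of the
  transforms, which is summable against the weights 4^k that completeness asks for.\<close>

lemma is_fourier_L2_exists:
  fixes h :: "real^'n \<Rightarrow> complex"
  assumes h: "square_integrable h"
  shows "\<exists>g. is_fourier_L2 h g"
proof -
  have m [measurable]: "h \<in> borel_measurable borel" and fin: "L2sq h < \<infinity>"
    using h by (auto simp: square_integrable_iff_L2sq)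
  let ?c = "(2 * pi) ^ CARD('n)"
  have "\<exists>\<psi>. continuous_bounded_support \<psi> \<and> L2sq (\<lambda>x. \<psi> x - h x) < ennreal (1 / 8 ^ k)" for k :: nat
    by (rule continuous_bounded_support_dense[OF h]) simp
  then obtain \<psi> where \<psi>: "\<And>k. continuous_bounded_support (\<psi> k)" and e: "\<And>k. L2sq (\<lambda>x. \<psi> k x - h x) < ennreal (1 / 8 ^ k)"
    by metis
  let ?inc = "\<lambda>k. L2sq (\<lambda>u. fourier_L1 (\<psi> (Suc k)) u - fourier_L1 (\<psi> k) u)"
  let ?dist = "\<lambda>G k. L2sq (\<lambda>u. fourier_L1 (\<psi> k) u - G u)"
  note int = integrable_continuous_bounded_support[OF \<psi>]
  have [measurable]: "fourier_L1 (\<psi> k) \<in> borel_measurable borel" "\<psi> k \<in> borel_measurable borel" for k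
    using int by (auto intro: borel_measurable_fourier_L1)
  have sqint: "square_integrable (\<psi> k)" for k
  proof -
    have "L2sq (\<psi> k) \<le> 2 * L2sq (\<lambda>x. \<psi> k x - h x) + 2 * L2sq (\<lambda>x. - h x)"
      using L2sq_diff_le[of "\<lambda>x. \<psi> k x - h x" "\<lambda>x. - h x"] by simp
    also have "\<dots> < \<infinity>"
      using fin e[of k] by (auto simp: L2sq_def ennreal_mult_less_top intro: less_trans)
    finally show ?thesis
      by (simp add: square_integrable_iff_L2sq)
  qed
  have inc: "?inc k \<le> ennreal (?c * 4 / 8 ^ k)" for k
  proof -
    have "?inc k \<le> ennreal ?c * L2sq (\<lambda>x. \<psi> (Suc k) x - \<psi> k x)"
      using L2sq_fourier_L1_le[of "\<lambda>x. \<psi> (Suc k) x - \<psi> k x"] int by (simp add: fourier_L1_diff)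
    also have "L2sq (\<lambda>x. \<psi> (Suc k) x - \<psi> k x) = L2sq (\<lambda>x. (\<psi> (Suc k) x - h x) - (\<psi> k x - h x))"
      by simp
    also have "\<dots> \<le> 2 * L2sq (\<lambda>x. \<psi> (Suc k) x - h x) + 2 * L2sq (\<lambda>x. \<psi> k x - h x)"
      by (rule L2sq_diff_le) measurable
    also have "\<dots> \<le> 2 * ennreal (1 / 8 ^ k) + 2 * ennreal (1 / 8 ^ k)"
    proof (intro add_mono mult_left_mono)
      have "L2sq (\<lambda>x. \<psi> (Suc k) x - h x) \<le> ennreal (1 / 8 ^ Suc k)"
        using e[of "Suc k"] by simp
      also have "\<dots> \<le> ennreal (1 / 8 ^ k)"
        by (intro ennreal_leI) (simp add: field_simps)
      finally show "L2sq (\<lambda>x. \<psi> (Suc k) x - h x) \<le> ennreal (1 / 8 ^ k)" .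
    qed (use e[of k] in auto)
    also have "\<dots> = ennreal (4 / 8 ^ k)"
      by (subst two_mult_ennreal_add) auto
    finally show ?thesis
      by (simp add: mult_left_mono flip: ennreal_mult)
  qed
  have "(\<Sum>k. ennreal (4 ^ k) * ?inc k)
      \<le> (\<Sum>k. ennreal (?c * 4 * (1 / 2) ^ k))"
  proof (intro suminf_le allI summableI)
    fix k
    have "ennreal (4 ^ k) * ?inc k \<le> ennreal (4 ^ k) * ennreal (?c * 4 / 8 ^ k)"
      by (intro mult_left_mono inc) auto
    also have "\<dots> = ennreal (?c * 4 * (4 ^ k / 8 ^ k))"
      by (simp add: mult_ac flip: ennreal_mult)
    also have "(4::real) ^ k / 8 ^ k = (1 / 2) ^ k"
      by (simp flip: power_divide)
    finally show "ennreal (4 ^ k) * ?inc k \<le> ennreal (?c * 4 * (1 / 2) ^ k)" .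
  qed
  also have "\<dots> < \<infinity>"
    by (subst suminf_ennreal2) (auto intro!: summable_mult summable_geometric)
  finally obtain G where G [measurable]: "G \<in> borel_measurable borel" and lim: "(\<lambda>k. ?dist G k) \<longlonglongrightarrow> 0"
    using L2sq_complete[of "\<lambda>k. fourier_L1 (\<psi> k)"] by auto
  have "\<forall>\<^sub>F k in sequentially. ?dist G k < 1"
    using lim by (intro order_tendstoD(2)) auto
  then obtain k where k: "?dist G k < 1"
    by (auto simp: eventually_sequentially)
  have "L2sq G \<le> 2 * L2sq (fourier_L1 (\<psi> k)) + 2 * ?dist G k"
    using L2sq_diff_le[of "fourier_L1 (\<psi> k)" "\<lambda>u. fourier_L1 (\<psi> k) u - G u"] by simp
  also have "\<dots> < \<infinity>"
  proof -
    have "L2sq (fourier_L1 (\<psi> k)) < \<infinity>"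
      using L2sq_fourier_L1_le[OF int(1), of k] sqint[of k]
      by (auto simp: square_integrable_iff_L2sq ennreal_mult_less_top intro: order_le_less_trans)
    then show ?thesis
      using less_trans[OF k ennreal_one_less_top] by (auto simp: ennreal_mult_less_top)
  qed
  finally have "square_integrable G"
    by (simp add: square_integrable_iff_L2sq)
  moreover have "L2_converges \<psi> h"
  proof -
    have "(\<lambda>k::nat. ennreal ((1 / 8) ^ k)) \<longlonglongrightarrow> ennreal 0"
      by (intro tendsto_ennrealI LIMSEQ_power_zero) auto
    then have "(\<lambda>k::nat. ennreal (1 / 8 ^ k)) \<longlonglongrightarrow> 0"
      by (simp add: power_divide)
    from ennreal_tendsto_0_if_le[OF this less_imp_le[OF e]]
    have "(\<lambda>k. L2sq (\<lambda>x. \<psi> k x - h x)) \<longlonglongrightarrow> 0" .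
    then show ?thesis
      by (simp add: L2_converges_def L2sq_def)
  qed
  moreover have "L2_converges (\<lambda>k. fourier_L1 (\<psi> k)) G"
    using lim by (simp add: L2_converges_def L2sq_def)
  ultimately show ?thesis
    unfolding is_fourier_L2_def using sqint int(1) by blast
qed

lemma fourier_L2_is_fourier_L2:
  fixes h :: "real^'n \<Rightarrow> complex"
  assumes "square_integrable h"
  shows "is_fourier_L2 h (fourier_L2 h)"
  unfolding fourier_L2_def using is_fourier_L2_exists[OF assms] by (rule someI_ex)

section \<open>Averages of translates\<close>

text \<open>The convolution of h with the reflected occupation measure of x.  The map x is kept apart from the
  parameter measure, instead of passing to the image measure, so that a path and the same path
  sampled on the grid share one parameter measure.\<close>

definition translate_avg :: "'s measure \<Rightarrow> ('s \<Rightarrow> real^'n) \<Rightarrow> (real^'n \<Rightarrow> complex) \<Rightarrow> real^'n \<Rightarrow> complex" where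
  "translate_avg \<Lambda> x h z = (LINT s|\<Lambda>. h (x s + z))"

definition average_phase :: "'s measure \<Rightarrow> ('s \<Rightarrow> real^'n) \<Rightarrow> real^'n \<Rightarrow> complex" where
  "average_phase \<Lambda> x u = (LINT s|\<Lambda>. iexp (- (u \<bullet> x s)))"

context
  fixes \<Lambda> :: "'s measure" and x :: "'s \<Rightarrow> real^'n"
  assumes fin: "finite_measure \<Lambda>" and x [measurable]: "x \<in> borel_measurable \<Lambda>"
begin

interpretation finite_measure \<Lambda> by (rule fin)
interpretation pair_sigma_finite \<Lambda> "lborel :: (real^'n) measure" ..

lemma borel_measurable_avg:
  assumes [measurable]: "h \<in> borel_measurable borel"
  shows "translate_avg \<Lambda> x h \<in> borel_measurable borel"
  unfolding translate_avg_def[abs_def] by measurable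

lemma nn_integral_translates:
  assumes [measurable]: "(F :: real^'n \<Rightarrow> ennreal) \<in> borel_measurable borel"
  shows "(\<integral>\<^sup>+z. \<integral>\<^sup>+s. F (x s + z) \<partial>\<Lambda> \<partial>lborel) = emeasure \<Lambda> (space \<Lambda>) * (\<integral>\<^sup>+z. F z \<partial>lborel)"
proof -
  have "(\<integral>\<^sup>+z. \<integral>\<^sup>+s. F (x s + z) \<partial>\<Lambda> \<partial>lborel) = (\<integral>\<^sup>+s. \<integral>\<^sup>+z. F (x s + z) \<partial>lborel \<partial>\<Lambda>)"
    by (rule Fubini') measurable
  also have "\<dots> = (\<integral>\<^sup>+s. (\<integral>\<^sup>+z. F z \<partial>lborel) \<partial>\<Lambda>)"
    using nn_integral_lborel_affine[of F 1] by simp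
  finally show ?thesis by (simp add: mult.commute)
qed

text \<open>Cauchy-Schwarz in the parameter, then translation invariance of Lebesgue measure.\<close>

lemma L2sq_avg_le:
  assumes [measurable]: "h \<in> borel_measurable borel"
  shows "L2sq (translate_avg \<Lambda> x h) \<le> (emeasure \<Lambda> (space \<Lambda>))\<^sup>2 * L2sq h"
proof -
  have "ennreal ((cmod (translate_avg \<Lambda> x h z))\<^sup>2) \<le> emeasure \<Lambda> (space \<Lambda>) * (\<integral>\<^sup>+s. ennreal ((cmod (h (x s + z)))\<^sup>2) \<partial>\<Lambda>)" for z
  proof -
    have "ennreal ((cmod (translate_avg \<Lambda> x h z))\<^sup>2) = (ennreal (cmod (translate_avg \<Lambda> x h z)))\<^sup>2"
      by (simp add: ennreal_power)
    also have "\<dots> \<le> (\<integral>\<^sup>+s. 1 * ennreal (cmod (h (x s + z))) \<partial>\<Lambda>)\<^sup>2"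
      unfolding translate_avg_def using ennreal_cmod_lebesgue_integral_le[of \<Lambda> "\<lambda>s. h (x s + z)"]
      by (intro power_mono) auto
    also have "\<dots> \<le> (\<integral>\<^sup>+s. 1\<^sup>2 \<partial>\<Lambda>) * (\<integral>\<^sup>+s. (ennreal (cmod (h (x s + z))))\<^sup>2 \<partial>\<Lambda>)"
      by (rule Cauchy_Schwarz_nn_integral) measurable
    finally show ?thesis
      by (simp add: ennreal_power)
  qed
  then have "L2sq (translate_avg \<Lambda> x h) \<le> (\<integral>\<^sup>+z. emeasure \<Lambda> (space \<Lambda>) * (\<integral>\<^sup>+s. ennreal ((cmod (h (x s + z)))\<^sup>2) \<partial>\<Lambda>) \<partial>lborel)"
    unfolding L2sq_def by (intro nn_integral_mono)
  also have "\<dots> = emeasure \<Lambda> (space \<Lambda>) * (\<integral>\<^sup>+z. \<integral>\<^sup>+s. ennreal ((cmod (h (x s + z)))\<^sup>2) \<partial>\<Lambda> \<partial>lborel)"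
    by (rule nn_integral_cmult) measurable
  also have "\<dots> = (emeasure \<Lambda> (space \<Lambda>))\<^sup>2 * L2sq h"
    by (subst nn_integral_translates) (auto simp: L2sq_def power2_eq_square mult.assoc)
  finally show ?thesis .
qed

lemma AE_integrable_translates:
  assumes h: "square_integrable (h :: real^'n \<Rightarrow> complex)"
  shows "AE z in lborel. integrable \<Lambda> (\<lambda>s. h (x s + z))"
proof -
  have [measurable]: "h \<in> borel_measurable borel" and L: "L2sq h < \<infinity>"
    using h by (auto simp: square_integrable_iff_L2sq)
  have "(\<integral>\<^sup>+z. \<integral>\<^sup>+s. ennreal ((cmod (h (x s + z)))\<^sup>2) \<partial>\<Lambda> \<partial>lborel) = emeasure \<Lambda> (space \<Lambda>) * L2sq h"
    unfolding L2sq_def by (rule nn_integral_translates) measurable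
  also have "\<dots> < \<infinity>"
    using L emeasure_finite[of "space \<Lambda>"] by (auto simp: less_top[symmetric] ennreal_mult_eq_top_iff)
  finally have "AE z in lborel. (\<integral>\<^sup>+s. ennreal ((cmod (h (x s + z)))\<^sup>2) \<partial>\<Lambda>) \<noteq> \<infinity>"
    by (intro nn_integral_PInf_AE) auto
  then show ?thesis
  proof eventually_elim
    case (elim z)
    have "integrable \<Lambda> (\<lambda>s. 1 + (cmod (h (x s + z)))\<^sup>2)"
      using elim by (intro Bochner_Integration.integrable_add integrable_const integrableI_bounded) (auto simp: less_top)
    then show ?case
    proof (rule Bochner_Integration.integrable_bound)
      have "r \<le> 1 + r\<^sup>2" if "r \<ge> 0" for r :: real
        using mult_le_half_sum_squares[of 1 r] that by (simp add: field_simps) 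
      then show "AE s in \<Lambda>. norm (h (x s + z)) \<le> norm (1 + (cmod (h (x s + z)))\<^sup>2)"
        by (auto intro!: AE_I2)
    qed measurable
  qed
qed

lemma
  assumes h: "integrable lborel (h :: real^'n \<Rightarrow> complex)"
  shows integrable_avg: "integrable lborel (translate_avg \<Lambda> x h)"
    and fourier_L1_avg: "fourier_L1 (translate_avg \<Lambda> x h) u = average_phase \<Lambda> x u * fourier_L1 h u"
proof -
  have [measurable]: "h \<in> borel_measurable borel"
    using h by auto
  have trans: "integrable lborel (\<lambda>z. h (x s + z) * iexp (v \<bullet> z))" for s v
  proof -
    have "(\<integral>\<^sup>+z. ennreal (cmod (h (x s + z))) \<partial>lborel) < \<infinity>"
      using h nn_integral_lborel_affine[of "\<lambda>z. ennreal (cmod (h z))" 1 "x s"]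
      by (simp add: integrable_iff_bounded)
    then show ?thesis
      by (simp add: integrable_iff_bounded norm_mult)
  qed
  have prod: "integrable (\<Lambda> \<Otimes>\<^sub>M lborel) (\<lambda>(s, z). h (x s + z) * iexp (v \<bullet> z))" for v
  proof (rule Fubini_integrable)
    have "(LINT z|lborel. norm (h (x s + z) * iexp (v \<bullet> z))) = (LINT z|lborel. cmod (h z))" for s
      using integral_lborel_affine[of "\<lambda>z. complex_of_real (cmod (h z))" 1 "x s"]
      by (simp add: norm_mult)
    then show "integrable \<Lambda> (\<lambda>s. LINT z|lborel. norm (case (s, z) of (s, z) \<Rightarrow> h (x s + z) * iexp (v \<bullet> z)))"
      by simp
    show "AE s in \<Lambda>. integrable lborel (\<lambda>z. case (s, z) of (s, z) \<Rightarrow> h (x s + z) * iexp (v \<bullet> z))"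
      using trans by simp
  qed measurable
  have "integrable lborel (\<lambda>z. LINT s|\<Lambda>. h (x s + z) * iexp (0 \<bullet> z))"
    using integrable_snd[OF prod[of 0]] by simp
  then show "integrable lborel (translate_avg \<Lambda> x h)"
    unfolding translate_avg_def[abs_def] by simp
  have "fourier_L1 (translate_avg \<Lambda> x h) u = (LINT z|lborel. LINT s|\<Lambda>. h (x s + z) * iexp (u \<bullet> z))"
    unfolding fourier_L1_def translate_avg_def by simp
  also have "\<dots> = (LINT s|\<Lambda>. LINT z|lborel. h (x s + z) * iexp (u \<bullet> z))"
    by (rule Fubini_integral[OF prod])
  also have "\<dots> = (LINT s|\<Lambda>. iexp (- (u \<bullet> x s)) * fourier_L1 h u)"
  proof (rule Bochner_Integration.integral_cong)
    fix s
    have "fourier_L1 h u = (LINT z|lborel. h (x s + z) * iexp (u \<bullet> (x s + z)))"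
      using integral_lborel_affine[of "\<lambda>z. h z * iexp (u \<bullet> z)" 1 "x s"] by (simp add: fourier_L1_def)
    also have "\<dots> = (LINT z|lborel. iexp (u \<bullet> x s) * (h (x s + z) * iexp (u \<bullet> z)))"
      by (intro Bochner_Integration.integral_cong) (auto simp: inner_add_right exp_add distrib_left)
    also have "\<dots> = iexp (u \<bullet> x s) * (LINT z|lborel. h (x s + z) * iexp (u \<bullet> z))"
      by (rule integral_mult_right_zero)
    finally show "(LINT z|lborel. h (x s + z) * iexp (u \<bullet> z)) = iexp (- (u \<bullet> x s)) * fourier_L1 h u"
      by (simp add: mult.assoc[symmetric] exp_add[symmetric])
  qed simp
  also have "\<dots> = average_phase \<Lambda> x u * fourier_L1 h u"
    unfolding average_phase_def by simp
  finally show "fourier_L1 (translate_avg \<Lambda> x h) u = average_phase \<Lambda> x u * fourier_L1 h u" .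
qed

lemma borel_measurable_avg_char: "average_phase \<Lambda> x \<in> borel_measurable borel"
  unfolding average_phase_def[abs_def] by measurable

lemma cmod_avg_char_le: "cmod (average_phase \<Lambda> x u) \<le> measure \<Lambda> (space \<Lambda>)"
  unfolding average_phase_def by (rule order_trans[OF integral_norm_bound]) simp

lemma L2sq_avg_converges:
  assumes hs: "\<And>k. square_integrable (hs k)" and h: "square_integrable h"
    and lim: "(\<lambda>k. L2sq (\<lambda>z. hs k z - h z)) \<longlonglongrightarrow> 0"
  shows "(\<lambda>k. L2sq (\<lambda>z. translate_avg \<Lambda> x (hs k) z - translate_avg \<Lambda> x h z)) \<longlonglongrightarrow> 0"
proof -
  have [measurable]: "h \<in> borel_measurable borel" "hs k \<in> borel_measurable borel" for k
    using hs h by (auto simp: square_integrable_iff_L2sq)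
  have bound: "L2sq (\<lambda>z. translate_avg \<Lambda> x (hs k) z - translate_avg \<Lambda> x h z) \<le> (emeasure \<Lambda> (space \<Lambda>))\<^sup>2 * L2sq (\<lambda>z. hs k z - h z)" for k
  proof -
    have "AE z in lborel. translate_avg \<Lambda> x (hs k) z - translate_avg \<Lambda> x h z = translate_avg \<Lambda> x (\<lambda>z. hs k z - h z) z"
      using AE_integrable_translates[OF hs[of k]] AE_integrable_translates[OF h]
      by eventually_elim (simp add: translate_avg_def)
    then have "L2sq (\<lambda>z. translate_avg \<Lambda> x (hs k) z - translate_avg \<Lambda> x h z) = L2sq (translate_avg \<Lambda> x (\<lambda>z. hs k z - h z))"
      unfolding L2sq_def by (intro nn_integral_cong_AE) (auto elim: eventually_mono)
    also have "\<dots> \<le> (emeasure \<Lambda> (space \<Lambda>))\<^sup>2 * L2sq (\<lambda>z. hs k z - h z)"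
      by (rule L2sq_avg_le) measurable
    finally show ?thesis .
  qed
  have "(\<lambda>k. (emeasure \<Lambda> (space \<Lambda>))\<^sup>2 * L2sq (\<lambda>z. hs k z - h z)) \<longlonglongrightarrow> (emeasure \<Lambda> (space \<Lambda>))\<^sup>2 * 0"
    using emeasure_finite[of "space \<Lambda>"] by (intro ennreal_tendsto_cmult lim) (auto simp: power2_eq_square less_top[symmetric] ennreal_mult_eq_top_iff)
  then have "(\<lambda>k. (emeasure \<Lambda> (space \<Lambda>))\<^sup>2 * L2sq (\<lambda>z. hs k z - h z)) \<longlonglongrightarrow> 0"
    by simp
  from ennreal_tendsto_0_if_le[OF this bound] show ?thesis .
qed

end

lemma square_integrable_avg:
  assumes "finite_measure \<Lambda>" "x \<in> borel_measurable \<Lambda>" and h: "square_integrable h"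
  shows "square_integrable (translate_avg \<Lambda> x h)"
proof -
  interpret finite_measure \<Lambda> by fact
  have "L2sq (translate_avg \<Lambda> x h) \<le> (emeasure \<Lambda> (space \<Lambda>))\<^sup>2 * L2sq h"
    using assms by (intro L2sq_avg_le) (auto simp: square_integrable_iff_L2sq)
  also have "\<dots> < \<infinity>"
    using h emeasure_finite[of "space \<Lambda>"] by (auto simp: square_integrable_iff_L2sq power2_eq_square less_top[symmetric] ennreal_mult_eq_top_iff)
  finally show ?thesis
    using assms by (auto simp: square_integrable_iff_L2sq intro: borel_measurable_avg)
qed

text \<open>Averaging translates acts on the Fourier side as multiplication by a bounded function.  For
  integrable f the claim is therefore the lower half of Plancherel.  In general f is approximated by the
  integrable functions which define its transform g; both sides depend continuously on f and g
  in L2, because averaging and multiplication are bounded operators.\<close>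

lemma L2sq_avg_diff_le:
  fixes x y :: "'s \<Rightarrow> real^'n"
  assumes fin: "finite_measure \<Lambda>" and x: "x \<in> borel_measurable \<Lambda>" and y: "y \<in> borel_measurable \<Lambda>"
    and f: "square_integrable f" and g: "is_fourier_L2 f g"
  shows "L2sq (\<lambda>z. translate_avg \<Lambda> x f z - translate_avg \<Lambda> y f z)
    \<le> ennreal (1 / (2 * pi) ^ CARD('n)) * L2sq (\<lambda>u. (average_phase \<Lambda> x u - average_phase \<Lambda> y u) * g u)"
proof -
  interpret finite_measure \<Lambda> by (rule fin)
  obtain hs where hs: "\<And>k. square_integrable (hs k)" "\<And>k. integrable lborel (hs k)"
    and conv: "(\<lambda>k. L2sq (\<lambda>z. hs k z - f z)) \<longlonglongrightarrow> 0" "(\<lambda>k. L2sq (\<lambda>u. fourier_L1 (hs k) u - g u)) \<longlonglongrightarrow> 0"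
    and gsq: "square_integrable g"
    using g by (auto simp: is_fourier_L2_def L2_converges_def L2sq_def)
  let ?K = "\<lambda>u. average_phase \<Lambda> x u - average_phase \<Lambda> y u"
  let ?A = "\<lambda>h z. translate_avg \<Lambda> x h z - translate_avg \<Lambda> y h z"
  have [measurable]: "f \<in> borel_measurable borel" "g \<in> borel_measurable borel" "hs k \<in> borel_measurable borel" for k
    using f gsq hs by (auto simp: square_integrable_iff_L2sq)
  note [measurable] = borel_measurable_avg_char[OF fin x] borel_measurable_avg_char[OF fin y]
    borel_measurable_avg[OF fin x] borel_measurable_avg[OF fin y] borel_measurable_fourier_L1
  let ?C = "(2 * measure \<Lambda> (space \<Lambda>))\<^sup>2"
  have KC: "L2sq (\<lambda>u. ?K u * h u) \<le> ennreal ?C * L2sq h" if [measurable]: "h \<in> borel_measurable borel" for h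
  proof -
    have "cmod (?K u) \<le> 2 * measure \<Lambda> (space \<Lambda>)" for u
      using norm_triangle_ineq4[of "average_phase \<Lambda> x u" "average_phase \<Lambda> y u"]
        cmod_avg_char_le[OF fin x, of u] cmod_avg_char_le[OF fin y, of u] by simp
    then have "(cmod (?K u * h u))\<^sup>2 \<le> ?C * (cmod (h u))\<^sup>2" for u
      unfolding norm_mult power_mult_distrib[of "cmod (?K u)"] by (intro mult_right_mono power_mono) auto
    then have "L2sq (\<lambda>u. ?K u * h u) \<le> (\<integral>\<^sup>+u. ennreal ?C * ennreal ((cmod (h u))\<^sup>2) \<partial>lborel)"
      unfolding L2sq_def by (intro nn_integral_mono) (simp add: ennreal_leI flip: ennreal_mult)
    then show ?thesis
      by (simp add: nn_integral_cmult L2sq_def)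
  qed
  show ?thesis
  proof (rule L2sq_le_of_limit[where hs="\<lambda>k. ?A (hs k)" and gs="\<lambda>k u. ?K u * fourier_L1 (hs k) u"])
    let ?dx = "\<lambda>k z. translate_avg \<Lambda> x (hs k) z - translate_avg \<Lambda> x f z" and ?dy = "\<lambda>k z. translate_avg \<Lambda> y (hs k) z - translate_avg \<Lambda> y f z"
    have "(\<lambda>k. 2 * L2sq (?dx k) + 2 * L2sq (?dy k)) \<longlonglongrightarrow> 2 * 0 + 2 * 0"
      by (intro tendsto_add ennreal_tendsto_cmult L2sq_avg_converges fin x y hs f conv) auto
    then have "(\<lambda>k. 2 * L2sq (?dx k) + 2 * L2sq (?dy k)) \<longlonglongrightarrow> 0"
      by simp
    moreover have "L2sq (\<lambda>z. ?A (hs k) z - ?A f z) \<le> 2 * L2sq (?dx k) + 2 * L2sq (?dy k)" for k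
    proof -
      have "L2sq (\<lambda>z. ?A (hs k) z - ?A f z) = L2sq (\<lambda>z. ?dx k z - ?dy k z)"
        by (simp add: algebra_simps)
      then show ?thesis
        by (simp only:) (rule L2sq_diff_le; measurable)
    qed
    ultimately show "(\<lambda>k. L2sq (\<lambda>z. ?A (hs k) z - ?A f z)) \<longlonglongrightarrow> 0"
      by (rule ennreal_tendsto_0_if_le)
    have "(\<lambda>k. ennreal ?C * L2sq (\<lambda>u. fourier_L1 (hs k) u - g u)) \<longlonglongrightarrow> ennreal ?C * 0"
      by (intro ennreal_tendsto_cmult conv) auto
    then have "(\<lambda>k. ennreal ?C * L2sq (\<lambda>u. fourier_L1 (hs k) u - g u)) \<longlonglongrightarrow> 0"
      by simp
    moreover have "L2sq (\<lambda>u. ?K u * fourier_L1 (hs k) u - ?K u * g u) \<le> ennreal ?C * L2sq (\<lambda>u. fourier_L1 (hs k) u - g u)" for k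
      unfolding right_diff_distrib[symmetric] by (rule KC) measurable
    ultimately show "(\<lambda>k. L2sq (\<lambda>u. ?K u * fourier_L1 (hs k) u - ?K u * g u)) \<longlonglongrightarrow> 0"
      by (rule ennreal_tendsto_0_if_le)
    show "L2sq (\<lambda>u. ?K u * g u) < \<infinity>"
      using KC[of g] gsq by (auto simp: square_integrable_iff_L2sq ennreal_mult_less_top intro: order_le_less_trans)
    show "L2sq (?A (hs k)) \<le> ennreal (1 / (2 * pi) ^ CARD('n)) * L2sq (\<lambda>u. ?K u * fourier_L1 (hs k) u)" for k
    proof -
      note ix = integrable_avg[OF fin x hs(2)[of k]] and iy = integrable_avg[OF fin y hs(2)[of k]]
      have sx: "square_integrable (translate_avg \<Lambda> x (hs k))" and sy: "square_integrable (translate_avg \<Lambda> y (hs k))"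
        by (intro square_integrable_avg fin x y hs)+
      have "fourier_L1 (?A (hs k)) = (\<lambda>u. ?K u * fourier_L1 (hs k) u)"
        unfolding fourier_L1_diff[OF ix iy]
        by (simp add: fun_eq_iff fourier_L1_avg[OF fin x hs(2)] fourier_L1_avg[OF fin y hs(2)] left_diff_distrib)
      moreover have "L2sq (?A (hs k)) < \<infinity>"
        using L2sq_diff_le[of "translate_avg \<Lambda> x (hs k)" "translate_avg \<Lambda> y (hs k)"] sx sy
        by (auto simp: square_integrable_iff_L2sq ennreal_mult_less_top intro: order_le_less_trans)
      ultimately show ?thesis
        using L2sq_le_fourier_L1[of "?A (hs k)"] ix iy by (simp add: square_integrable_iff_L2sq)
    qed
    show "(\<lambda>u. ?K u * g u) \<in> borel_measurable borel" "?A f \<in> borel_measurable borel"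
        "(\<lambda>u. ?K u * fourier_L1 (hs k) u) \<in> borel_measurable borel" "?A (hs k) \<in> borel_measurable borel" for k
      by measurable
    show "0 \<le> 1 / (2 * pi) ^ CARD('n)"
      by simp
  qed
qed

section \<open>Derivatives, increments and the time grid\<close>

text \<open>Every derivative is integrable in the sense of Henstock and Kurzweil, with the increment of F as its
  integral.  If the right side is finite, D is also Lebesgue integrable and the two integrals agree.
  The case of an infinite right side does occur: the increment of the t'-derivative between t and
  the grid point below t may fail to be integrable.\<close>

lemma ennreal_cmod_increment_le:
  fixes F :: "real \<Rightarrow> complex"
  assumes ab: "a \<le> b" and [measurable]: "D \<in> borel_measurable borel"
    and F: "\<And>s. s \<in> {a..b} \<Longrightarrow> (F has_vector_derivative D s) (at s)"
  shows "ennreal (cmod (F b - F a)) \<le> (\<integral>\<^sup>+s. ennreal (cmod (D s)) * indicator {a..b} s \<partial>lborel)"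
proof (cases "(\<integral>\<^sup>+s. ennreal (cmod (D s)) * indicator {a..b} s \<partial>lborel) = \<infinity>")
  case False
  have eq: "(\<integral>\<^sup>+s. ennreal (cmod (indicator {a..b} s *\<^sub>R D s)) \<partial>lborel) = (\<integral>\<^sup>+s. ennreal (cmod (D s)) * indicator {a..b} s \<partial>lborel)"
    by (intro nn_integral_cong) (auto simp: indicator_def)
  have int: "set_integrable lborel {a..b} D"
    unfolding set_integrable_def using False eq by (intro integrableI_bounded) (auto simp: less_top)
  have "(D has_integral (F b - F a)) {a..b}"
    by (rule fundamental_theorem_of_calculus[OF ab]) (rule has_vector_derivative_at_within, rule F, simp)
  then have "F b - F a = (LINT s:{a..b}|lborel. D s)"
    by (simp add: set_borel_integral_eq_integral(2)[OF int] integral_unique)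
  then show ?thesis
    unfolding set_lebesgue_integral_def eq[symmetric] using ennreal_cmod_lebesgue_integral_le by metis
qed simp

lemma difference_quotient_seq_tendsto:
  fixes F :: "real \<Rightarrow> complex"
  assumes "F differentiable (at s)"
  shows "(\<lambda>k. of_nat (Suc k) * (F (s + 1 / real (Suc k)) - F s)) \<longlonglongrightarrow> vector_derivative F (at s)"
proof -
  have "(F has_vector_derivative vector_derivative F (at s)) (at s)"
    using assms by (simp add: vector_derivative_works)
  then have "((\<lambda>h. norm (F (s + h) - F s - h *\<^sub>R vector_derivative F (at s)) / norm h) \<longlongrightarrow> 0) (at 0)"
    by (simp add: has_vector_derivative_def has_derivative_at)
  moreover have "(\<lambda>k. 1 / real (Suc k)) \<longlonglongrightarrow> 0"
    by (intro LIMSEQ_Suc lim_1_over_n)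
  then have "filterlim (\<lambda>k. 1 / real (Suc k)) (at 0) sequentially"
    by (simp add: filterlim_at)
  ultimately have "(\<lambda>k. norm (F (s + 1 / real (Suc k)) - F s - (1 / real (Suc k)) *\<^sub>R vector_derivative F (at s)) / norm (1 / real (Suc k))) \<longlonglongrightarrow> 0"
    by (rule filterlim_compose)
  moreover have "norm (F (s + 1 / real (Suc k)) - F s - (1 / real (Suc k)) *\<^sub>R vector_derivative F (at s)) / norm (1 / real (Suc k))
      = norm (of_nat (Suc k) * (F (s + 1 / real (Suc k)) - F s) - vector_derivative F (at s))" for k
  proof -
    have "of_nat (Suc k) * (F (s + 1 / real (Suc k)) - F s) - vector_derivative F (at s)
       = of_nat (Suc k) * (F (s + 1 / real (Suc k)) - F s - (1 / real (Suc k)) *\<^sub>R vector_derivative F (at s))"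
      by (simp add: scaleR_conv_of_real right_diff_distrib del: of_nat_Suc)
    then show ?thesis
      by (simp add: norm_mult mult.commute del: of_nat_Suc)
  qed
  ultimately show ?thesis
    by (simp add: tendsto_norm_zero_iff LIM_zero_iff del: of_nat_Suc)
qed

text \<open>A partial derivative is the limit of difference quotients along 1/(k+1).  Openness of R keeps the
  shifted points in R eventually, where the measurability of the function is known.\<close>

lemma borel_measurable_vector_derivative_snd:
  fixes \<Phi> :: "real \<Rightarrow> real \<Rightarrow> complex"
  assumes R: "open R"
    and m: "(\<lambda>p. if p \<in> R then \<Phi> (fst p) (snd p) else 0) \<in> borel_measurable borel"
    and d: "\<And>t s. (t, s) \<in> R \<Longrightarrow> \<Phi> t differentiable (at s)"
  shows "(\<lambda>p. if p \<in> R then vector_derivative (\<Phi> (fst p)) (at (snd p)) else 0) \<in> borel_measurable borel"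
proof -
  let ?\<Psi> = "\<lambda>p. if p \<in> R then \<Phi> (fst p) (snd p) else 0"
  let ?s = "\<lambda>k p :: real \<times> real. (fst p, snd p + 1 / real (Suc k))"
  have R' [measurable]: "R \<in> sets borel"
    using R by (rule borel_open)
  have sm: "?s k \<in> borel \<rightarrow>\<^sub>M borel" for k
    by (intro borel_measurable_continuous_onI continuous_intros)
  have "(\<lambda>p. ?\<Psi> (?s k p)) \<in> borel_measurable borel" for k
    using measurable_compose[OF sm m] .
  note [measurable] = this m
  let ?q = "\<lambda>k p. if p \<in> R then of_nat (Suc k) * (?\<Psi> (?s k p) - ?\<Psi> p) else 0"
  show ?thesis
  proof (rule borel_measurable_LIMSEQ_metric)
    show "?q k \<in> borel_measurable borel" for k
      by measurable
    show "(\<lambda>k. ?q k p) \<longlonglongrightarrow> (if p \<in> R then vector_derivative (\<Phi> (fst p)) (at (snd p)) else 0)" for p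
    proof (cases "p \<in> R")
      case True
      have "(\<lambda>k. ?s k p) \<longlonglongrightarrow> (fst p, snd p + 0)"
        by (intro tendsto_intros LIMSEQ_Suc lim_1_over_n)
      then have "\<forall>\<^sub>F k in sequentially. ?s k p \<in> R"
        using R True by (intro topological_tendstoD[where S=R]) auto
      then have "\<forall>\<^sub>F k in sequentially. of_nat (Suc k) * (\<Phi> (fst p) (snd p + 1 / real (Suc k)) - \<Phi> (fst p) (snd p)) = ?q k p"
        by eventually_elim (use True in simp)
      moreover have "(\<lambda>k. of_nat (Suc k) * (\<Phi> (fst p) (snd p + 1 / real (Suc k)) - \<Phi> (fst p) (snd p))) \<longlonglongrightarrow> vector_derivative (\<Phi> (fst p)) (at (snd p))"
        using True d[of "fst p" "snd p"] by (intro difference_quotient_seq_tendsto) simp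
      ultimately show ?thesis
        using True by (simp add: Lim_transform_eventually)
    qed simp
  qed
qed

lemma borel_measurable_vector_derivative_fst:
  fixes \<Phi> :: "real \<Rightarrow> real \<Rightarrow> complex"
  assumes R: "open R"
    and m: "(\<lambda>p. if p \<in> R then \<Phi> (fst p) (snd p) else 0) \<in> borel_measurable borel"
    and d: "\<And>t s. (t, s) \<in> R \<Longrightarrow> (\<lambda>r. \<Phi> r s) differentiable (at t)"
  shows "(\<lambda>p. if p \<in> R then vector_derivative (\<lambda>r. \<Phi> r (snd p)) (at (fst p)) else 0) \<in> borel_measurable borel"
proof -
  have sw: "prod.swap \<in> (borel :: (real \<times> real) measure) \<rightarrow>\<^sub>M borel"
    unfolding prod.swap_def by (intro borel_measurable_continuous_onI continuous_intros)
  have "open (prod.swap -` R)"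
    by (rule open_vimage[OF R]) (auto simp: prod.swap_def intro!: continuous_intros)
  moreover have "(\<lambda>p. if p \<in> prod.swap -` R then \<Phi> (snd p) (fst p) else 0) \<in> borel_measurable borel"
    using measurable_compose[OF sw m] by (simp only: vimage_eq fst_swap snd_swap)
  ultimately have "(\<lambda>p. if p \<in> prod.swap -` R then vector_derivative (\<lambda>r. \<Phi> r (fst p)) (at (snd p)) else 0) \<in> borel_measurable borel"
    using borel_measurable_vector_derivative_snd[of "prod.swap -` R" "\<lambda>s r. \<Phi> r s"] d by auto
  from measurable_compose[OF sw this] show ?thesis
    by (simp only: vimage_eq fst_swap snd_swap swap_swap)
qed

lemma mesh_pos: "T > 0 \<Longrightarrow> n \<ge> 1 \<Longrightarrow> mesh T n > 0"
  by (simp add: mesh_def)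

lemma mesh_le: "T > 0 \<Longrightarrow> n \<ge> 1 \<Longrightarrow> mesh T n \<le> T"
  by (simp add: mesh_def field_simps)

lemma
  assumes "mesh T n > 0"
  shows grid_floor_le: "grid_floor T n t \<le> t"
    and grid_floor_gt: "t - mesh T n < grid_floor T n t"
    and grid_floor_nonneg: "t \<ge> 0 \<Longrightarrow> grid_floor T n t \<ge> 0"
    and grid_floor_ge_mesh: "t \<ge> mesh T n \<Longrightarrow> grid_floor T n t \<ge> mesh T n"
proof -
  have "of_int \<lfloor>t / mesh T n\<rfloor> * mesh T n \<le> (t / mesh T n) * mesh T n"
    using assms by (intro mult_right_mono) auto
  then show "grid_floor T n t \<le> t"
    using assms by (simp add: grid_floor_def)
  have "(t / mesh T n - 1) * mesh T n < of_int \<lfloor>t / mesh T n\<rfloor> * mesh T n"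
    using assms by (intro mult_strict_right_mono) linarith+
  then show "t - mesh T n < grid_floor T n t"
    using assms by (simp add: grid_floor_def left_diff_distrib)
  show "grid_floor T n t \<ge> 0" if "t \<ge> 0"
    using assms that by (simp add: grid_floor_def)
  show "grid_floor T n t \<ge> mesh T n" if "t \<ge> mesh T n"
  proof -
    have "1 \<le> \<lfloor>t / mesh T n\<rfloor>"
      using assms that by (simp add: le_floor_iff)
    then have "1 * mesh T n \<le> of_int \<lfloor>t / mesh T n\<rfloor> * mesh T n"
      using assms by (intro mult_right_mono) auto
    then show ?thesis
      by (simp add: grid_floor_def)
  qed
qed

lemma borel_measurable_grid_floor [measurable]: "grid_floor T n \<in> borel_measurable borel"
  unfolding grid_floor_def[abs_def] by measurable

section \<open>Integrating the covariance kernel over the time square\<close>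

lemma borel_measurable_off_diagonal: "off_diagonal T n \<in> sets (borel \<Otimes>\<^sub>M borel)"
proof -
  have "off_diagonal T n = {p \<in> space (borel \<Otimes>\<^sub>M borel). 0 \<le> fst p \<and> fst p \<le> T \<and> 0 \<le> snd p \<and> snd p \<le> T
      \<and> mesh T n \<le> fst p \<and> fst p + 2 * mesh T n < snd p}"
    by (auto simp: off_diagonal_def space_pair_measure)
  also have "\<dots> \<in> sets (borel \<Otimes>\<^sub>M borel)"
    by measurable
  finally show ?thesis .
qed

lemma borel_measurable_indicator_Icc [measurable (raw)]:
  fixes f g h :: "'a \<Rightarrow> real"
  assumes [measurable]: "f \<in> borel_measurable N" "g \<in> borel_measurable N" "h \<in> borel_measurable N"
  shows "(\<lambda>x. indicator {f x..g x} (h x) :: ennreal) \<in> borel_measurable N"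
proof -
  have "(\<lambda>x. indicator {f x..g x} (h x) :: ennreal) = (\<lambda>x. if f x \<le> h x \<and> h x \<le> g x then 1 else 0)"
    by (auto simp: indicator_def)
  then show ?thesis by simp
qed

text \<open>The decomposition of the time square.  H stands for the covariance of the phase increments, g for
  their variance, and D for the increment in t of the derivative in t'.  For t \<open>\<le>\<close> t' the kernel is dominated by
  the sum of n1 (the band of width 3 Delta along the diagonal), n2 (the strip t \<open>\<le>\<close> Delta) and n3 (the
  remainder), and by symmetry the whole square costs twice the integral of this sum.\<close>

lemma nn_integral_kernel_le:
  fixes H D :: "real \<Rightarrow> real \<Rightarrow> complex" and g :: "real \<Rightarrow> real" and T :: real and n :: nat
  assumes T: "T > 0" and n: "n \<ge> 1"
    and mH [measurable]: "(\<lambda>p. H (fst p) (snd p)) \<in> borel_measurable (borel \<Otimes>\<^sub>M borel)"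
    and mD [measurable]: "(\<lambda>p. D (fst p) (snd p)) \<in> borel_measurable (borel \<Otimes>\<^sub>M borel)"
    and mg [measurable]: "g \<in> borel_measurable borel"
    and sym: "\<And>t t'. cmod (H t t') = cmod (H t' t)"
    and near: "\<And>t t'. cmod (H t t') \<le> \<bar>g t\<bar> + \<bar>g t'\<bar>"
    and far: "\<And>t t'. mesh T n \<le> t \<Longrightarrow> t + 3 * mesh T n < t' \<Longrightarrow> t' < T \<Longrightarrow>
      ennreal (cmod (H t t')) \<le> (\<integral>\<^sup>+s. ennreal (cmod (D t s)) * indicator {grid_floor T n t'..t'} s \<partial>lborel)"
  shows "(\<integral>\<^sup>+t. \<integral>\<^sup>+t'. ennreal (cmod (H t t')) * (indicator {0..<T} t * indicator {0..<T} t') \<partial>lborel \<partial>lborel)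
    \<le> 16 * (ennreal (mesh T n) * (\<integral>\<^sup>+t. ennreal \<bar>g t\<bar> * indicator {mesh T n..T} t \<partial>lborel)
          + ennreal T * (\<integral>\<^sup>+t. ennreal \<bar>g t\<bar> * indicator {0..mesh T n} t \<partial>lborel)
          + ennreal (mesh T n) * (\<integral>\<^sup>+p. ennreal (cmod (D (fst p) (snd p))) * indicator (off_diagonal T n) p \<partial>lborel))"
proof -
  let ?\<Delta> = "mesh T n"
  have \<Delta>: "?\<Delta> > 0" "?\<Delta> \<le> T"
    using mesh_pos[OF T n] mesh_le[OF T n] by auto
  have e14: "14 * x = 2 * (6 * x) + 2 * x" and e16: "16 * x = 14 * x + 2 * x" for x :: ennreal
    by (simp_all only: mult.assoc[symmetric] distrib_right[symmetric]) simp_all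
  let ?II = "\<lambda>F. \<integral>\<^sup>+t. \<integral>\<^sup>+t'. F t t' \<partial>lborel \<partial>lborel"
  have mH' [measurable (raw)]: "(\<lambda>x. H (f x) (h x)) \<in> borel_measurable N" if "f \<in> borel_measurable N" "h \<in> borel_measurable N" for f h and N :: "'z measure"
    using measurable_compose[OF measurable_Pair[OF that] mH] by simp
  have mD' [measurable (raw)]: "(\<lambda>x. D (f x) (h x)) \<in> borel_measurable N" if "f \<in> borel_measurable N" "h \<in> borel_measurable N" for f h and N :: "'z measure"
    using measurable_compose[OF measurable_Pair[OF that] mD] by simp
  note [measurable] = borel_measurable_off_diagonal[of T n]
  let ?h = "\<lambda>t t'. ennreal (cmod (H t t')) * (indicator {0..<T} t * indicator {0..<T} t')"
  define a where "a t = ennreal \<bar>g t\<bar> * indicator {0..T} t" for t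
  have [measurable]: "a \<in> borel_measurable borel"
    unfolding a_def[abs_def] by measurable
  define A where "A = (\<integral>\<^sup>+t. a t \<partial>lborel)"
  define A0 where "A0 = (\<integral>\<^sup>+t. ennreal \<bar>g t\<bar> * indicator {0..?\<Delta>} t \<partial>lborel)"
  define A1 where "A1 = (\<integral>\<^sup>+t. ennreal \<bar>g t\<bar> * indicator {?\<Delta>..T} t \<partial>lborel)"
  define V where "V = (\<integral>\<^sup>+p. ennreal (cmod (D (fst p) (snd p))) * indicator (off_diagonal T n) p \<partial>lborel)"
  define n1 where "n1 t t' = a t * indicator {t..t + 3 * ?\<Delta>} t' + a t' * indicator {t' - 3 * ?\<Delta>..t'} t" for t t'
  define n2 where "n2 t t' = a t * indicator {0..?\<Delta>} t * indicator {0..T} t' + a t' * indicator {0..?\<Delta>} t" for t t'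
  define n3 where "n3 t t' = (\<integral>\<^sup>+s. ennreal (cmod (D t s)) * indicator (off_diagonal T n) (t, s) * indicator {grid_floor T n t'..t'} s \<partial>lborel)" for t t'
  let ?U = "\<lambda>t t'. n1 t t' + n2 t t' + n3 t t'"
  have mn [measurable]: "(\<lambda>(t, t'). n1 t t') \<in> borel_measurable (borel \<Otimes>\<^sub>M borel)"
      "(\<lambda>(t, t'). n2 t t') \<in> borel_measurable (borel \<Otimes>\<^sub>M borel)"
      "(\<lambda>(t, t'). n3 t t') \<in> borel_measurable (borel \<Otimes>\<^sub>M borel)"
    unfolding n1_def n2_def n3_def by measurable
  \<comment> \<open>The domination above the diagonal, by the three regions.\<close>
  have pt: "?h t t' \<le> ?U t t'" if le: "t \<le> t'" for t t'
  proof (cases "t \<in> {0..<T} \<and> t' \<in> {0..<T}")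
    case in_T: True
    have hg: "?h t t' \<le> a t + a t'"
      using in_T near[of t t'] by (simp add: a_def flip: ennreal_plus)
    consider "t' \<le> t + 3 * ?\<Delta>" | "t \<le> ?\<Delta>" | "?\<Delta> \<le> t" "t + 3 * ?\<Delta> < t'"
      by linarith
    then show ?thesis
    proof cases
      case 1
      then have "a t + a t' \<le> n1 t t'"
        using le by (simp add: n1_def)
      also have "n1 t t' \<le> ?U t t'"
        by (intro add_increasing2 zero_le order_refl)
      finally show ?thesis
        using hg by (rule order_trans[rotated])
    next
      case 2
      then have "a t + a t' \<le> n2 t t'"
        using in_T by (simp add: n2_def)
      also have "n2 t t' \<le> ?U t t'"
        by (intro add_increasing2[OF zero_le] add_increasing[OF zero_le] order_refl)
      finally show ?thesis
        using hg by (rule order_trans[rotated])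
    next
      case 3
      have "?h t t' \<le> (\<integral>\<^sup>+s. ennreal (cmod (D t s)) * indicator {grid_floor T n t'..t'} s \<partial>lborel)"
        using far[OF 3] in_T by simp
      also have "\<dots> = n3 t t'"
        unfolding n3_def
      proof (intro nn_integral_cong)
        fix s
        \<comment> \<open>Here the width 3 of the band is needed: s > t' - \<Delta> > t + 2 * \<Delta>.\<close>
        have "(t, s) \<in> off_diagonal T n" if "s \<in> {grid_floor T n t'..t'}"
          using that in_T 3 \<Delta> grid_floor_gt[OF \<Delta>(1), of t'] by (auto simp: off_diagonal_def)
        then show "ennreal (cmod (D t s)) * indicator {grid_floor T n t'..t'} s = ennreal (cmod (D t s)) * indicator (off_diagonal T n) (t, s) * indicator {grid_floor T n t'..t'} s"
          by (auto simp: indicator_def)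
      qed
      finally show ?thesis
        by (simp add: add_increasing)
    qed
  qed auto
  have "?h t t' \<le> ?U t t' + ?U t' t" for t t'
  proof (cases "t \<le> t'")
    case True
    then show ?thesis
      using pt[OF True] by (simp add: add_increasing2)
  next
    case False
    have "?h t t' = ?h t' t"
      by (simp add: sym[of t] mult.commute)
    also have "\<dots> \<le> ?U t' t"
      using False by (intro pt) simp
    finally show ?thesis
      by (simp add: add_increasing)
  qed
  then have "?II ?h \<le> (\<integral>\<^sup>+t. \<integral>\<^sup>+t'. ?U t t' + ?U t' t \<partial>lborel \<partial>lborel)"
    by (intro nn_integral_mono)
  also have "\<dots> = ?II ?U + (\<integral>\<^sup>+t. \<integral>\<^sup>+t'. ?U t' t \<partial>lborel \<partial>lborel)"
    by (simp add: nn_integral_add)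
  also have "(\<integral>\<^sup>+t. \<integral>\<^sup>+t'. ?U t' t \<partial>lborel \<partial>lborel) = ?II ?U"
    by (rule lborel_pair.Fubini') measurable
  also have "?II ?U
      = ?II n1 + ?II n2 + ?II n3"
    by (simp add: nn_integral_add)
  also have "?II n1 = 6 * ennreal ?\<Delta> * A"
  proof -
    have "?II n1
        = (\<integral>\<^sup>+t. \<integral>\<^sup>+t'. a t * indicator {t..t + 3 * ?\<Delta>} t' \<partial>lborel \<partial>lborel)
          + (\<integral>\<^sup>+t. \<integral>\<^sup>+t'. a t' * indicator {t' - 3 * ?\<Delta>..t'} t \<partial>lborel \<partial>lborel)"
      unfolding n1_def by (subst nn_integral_add[symmetric]) (auto simp: nn_integral_add)
    also have "(\<integral>\<^sup>+t. \<integral>\<^sup>+t'. a t' * indicator {t' - 3 * ?\<Delta>..t'} t \<partial>lborel \<partial>lborel)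
        = (\<integral>\<^sup>+t'. \<integral>\<^sup>+t. a t' * indicator {t' - 3 * ?\<Delta>..t'} t \<partial>lborel \<partial>lborel)"
      by (rule lborel_pair.Fubini') measurable
    also have "(\<integral>\<^sup>+t. \<integral>\<^sup>+t'. a t * indicator {t..t + 3 * ?\<Delta>} t' \<partial>lborel \<partial>lborel)
        + (\<integral>\<^sup>+t'. \<integral>\<^sup>+t. a t' * indicator {t' - 3 * ?\<Delta>..t'} t \<partial>lborel \<partial>lborel)
        = A * (3 * ennreal ?\<Delta>) + A * (3 * ennreal ?\<Delta>)"
      using \<Delta> by (simp add: nn_integral_cmult_indicator nn_integral_multc A_def ennreal_mult')
    also have "\<dots> = (2 * 3) * ennreal ?\<Delta> * A"
      by (simp only: mult_2[symmetric] mult_ac)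
    finally show ?thesis
      by simp
  qed
  also have "?II n2 = ennreal T * A0 + ennreal ?\<Delta> * A"
  proof -
    have "(\<integral>\<^sup>+t'. n2 t t' \<partial>lborel) = a t * indicator {0..?\<Delta>} t * ennreal T + A * indicator {0..?\<Delta>} t" for t
      unfolding n2_def using T by (simp add: nn_integral_add nn_integral_cmult_indicator nn_integral_multc A_def)
    moreover have "(\<integral>\<^sup>+t. a t * indicator {0..?\<Delta>} t \<partial>lborel) = A0"
      unfolding A0_def a_def using \<Delta> by (intro nn_integral_cong) (auto simp: indicator_def)
    moreover have "(\<integral>\<^sup>+t. a t * indicator {0..?\<Delta>} t * ennreal T \<partial>lborel) = (\<integral>\<^sup>+t. a t * indicator {0..?\<Delta>} t \<partial>lborel) * ennreal T"
      by (rule nn_integral_multc) measurable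
    moreover have "(\<integral>\<^sup>+t. A * indicator {0..?\<Delta>} t \<partial>lborel) = A * ennreal ?\<Delta>"
      using \<Delta> by (subst nn_integral_cmult_indicator) auto
    ultimately show ?thesis
      by (simp only:) (subst nn_integral_add; simp add: mult.commute)
  qed
  also have "?II n3 \<le> ennreal ?\<Delta> * V"
  proof -
    let ?d = "\<lambda>t s. ennreal (cmod (D t s)) * indicator (off_diagonal T n) (t, s)"
    have "(\<integral>\<^sup>+t'. n3 t t' \<partial>lborel) \<le> (\<integral>\<^sup>+s. ?d t s * ennreal ?\<Delta> \<partial>lborel)" for t
    proof -
      have "(\<integral>\<^sup>+t'. n3 t t' \<partial>lborel) = (\<integral>\<^sup>+s. \<integral>\<^sup>+t'. ?d t s * indicator {grid_floor T n t'..t'} s \<partial>lborel \<partial>lborel)"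
        unfolding n3_def by (rule lborel_pair.Fubini') measurable
      also have "\<dots> \<le> (\<integral>\<^sup>+s. \<integral>\<^sup>+t'. ?d t s * indicator {s..s + ?\<Delta>} t' \<partial>lborel \<partial>lborel)"
      proof (intro nn_integral_mono mult_left_mono)
        fix s t' :: real
        \<comment> \<open>A given s lies in the cell interval of t' only for t' within one mesh width of s.\<close>
        show "indicator {grid_floor T n t'..t'} s \<le> (indicator {s..s + ?\<Delta>} t' :: ennreal)"
          using grid_floor_gt[OF \<Delta>(1), of t'] by (auto simp: indicator_def)
      qed auto
      also have "\<dots> = (\<integral>\<^sup>+s. ?d t s * ennreal ?\<Delta> \<partial>lborel)"
        using \<Delta> by (intro nn_integral_cong) (simp add: nn_integral_cmult_indicator)
      finally show ?thesis .
    qed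
    then have "?II n3 \<le> (\<integral>\<^sup>+t. \<integral>\<^sup>+s. ?d t s * ennreal ?\<Delta> \<partial>lborel \<partial>lborel)"
      by (rule nn_integral_mono)
    also have "\<dots> = (\<integral>\<^sup>+t. \<integral>\<^sup>+s. ?d t s \<partial>lborel \<partial>lborel) * ennreal ?\<Delta>"
      by (simp add: nn_integral_multc)
    also have "(\<integral>\<^sup>+t. \<integral>\<^sup>+s. ?d t s \<partial>lborel \<partial>lborel) = V"
      unfolding V_def lborel_prod[symmetric] by (subst lborel.nn_integral_fst[symmetric]) simp_all
    finally show ?thesis
      by (simp add: mult.commute)
  qed
  finally have "?II ?h
     \<le> 2 * (6 * ennreal ?\<Delta> * A + (ennreal T * A0 + ennreal ?\<Delta> * A) + ennreal ?\<Delta> * V)"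
    unfolding mult_2 by (simp add: add_mono)
  also have "\<dots> = 14 * (ennreal ?\<Delta> * A) + 2 * (ennreal T * A0) + 2 * (ennreal ?\<Delta> * V)"
    by (simp only: e14 distrib_left mult.assoc add_ac)
  also have "A \<le> A1 + A0"
  proof -
    have "A \<le> (\<integral>\<^sup>+t. ennreal \<bar>g t\<bar> * indicator {?\<Delta>..T} t + ennreal \<bar>g t\<bar> * indicator {0..?\<Delta>} t \<partial>lborel)"
      unfolding A_def a_def by (intro nn_integral_mono) (auto simp: indicator_def)
    then show ?thesis
      by (simp add: nn_integral_add A0_def A1_def)
  qed
  also have "14 * (ennreal ?\<Delta> * (A1 + A0)) + 2 * (ennreal T * A0) + 2 * (ennreal ?\<Delta> * V)
      = 14 * (ennreal ?\<Delta> * A1) + (14 * (ennreal ?\<Delta> * A0) + 2 * (ennreal T * A0)) + 2 * (ennreal ?\<Delta> * V)"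
    by (simp only: distrib_left add_ac)
  also have "\<dots> \<le> 16 * (ennreal ?\<Delta> * A1) + (14 * (ennreal T * A0) + 2 * (ennreal T * A0)) + 16 * (ennreal ?\<Delta> * V)"
    using \<Delta> by (intro add_mono mult_right_mono mult_left_mono ennreal_leI) auto
  also have "\<dots> = 16 * (ennreal ?\<Delta> * A1 + ennreal T * A0 + ennreal ?\<Delta> * V)"
    by (simp only: e16[symmetric] distrib_left)
  finally show ?thesis
    by (simp only: A0_def A1_def V_def) (simp add: mult_left_mono)
qed

text \<open>A point r is in [floor t, t] only for t in an interval of length Delta, so exchanging the
  integrals over r and t gains a factor Delta.  The region is stable under replacing t by a smaller
  r which is at least floor t, because floor t is still at least Delta.\<close>

lemma nn_integral_off_diagonal_increment_le:
  fixes D E :: "real \<Rightarrow> real \<Rightarrow> complex"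
  assumes T: "T > 0" and n: "n \<ge> 1"
    and mE [measurable]: "(\<lambda>p. E (fst p) (snd p)) \<in> borel_measurable (borel \<Otimes>\<^sub>M borel)"
    and le: "\<And>t s. (t, s) \<in> off_diagonal T n \<Longrightarrow> s < T \<Longrightarrow>
      ennreal (cmod (D t s)) \<le> (\<integral>\<^sup>+r. ennreal (cmod (E r s)) * indicator {grid_floor T n t..t} r \<partial>lborel)"
    and D0: "\<And>t s. s \<ge> T \<Longrightarrow> D t s = 0"
  shows "(\<integral>\<^sup>+p. ennreal (cmod (D (fst p) (snd p))) * indicator (off_diagonal T n) p \<partial>lborel)
    \<le> ennreal (mesh T n) * (\<integral>\<^sup>+p. ennreal (cmod (E (fst p) (snd p))) * indicator (off_diagonal T n) p \<partial>lborel)"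
proof -
  let ?\<Delta> = "mesh T n"
  have \<Delta>: "?\<Delta> > 0"
    using mesh_pos[OF T n] .
  have mE' [measurable (raw)]: "(\<lambda>x. E (f x) (h x)) \<in> borel_measurable N" if "f \<in> borel_measurable N" "h \<in> borel_measurable N" for f h and N :: "'z measure"
    using measurable_compose[OF measurable_Pair[OF that] mE] by simp
  note [measurable] = borel_measurable_off_diagonal[of T n]
  let ?e = "\<lambda>r s. ennreal (cmod (E r s)) * indicator (off_diagonal T n) (r, s)"
  let ?G = "\<lambda>t s. \<integral>\<^sup>+r. ?e r s * indicator {grid_floor T n t..t} r \<partial>lborel"
  have pt: "ennreal (cmod (D t s)) * indicator (off_diagonal T n) (t, s) \<le> ?G t s" for t s
  proof (cases "(t, s) \<in> off_diagonal T n \<and> s < T")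
    case True
    have "ennreal (cmod (D t s)) \<le> (\<integral>\<^sup>+r. ennreal (cmod (E r s)) * indicator {grid_floor T n t..t} r \<partial>lborel)"
      using True by (intro le) auto
    also have "\<dots> = ?G t s"
    proof (intro nn_integral_cong)
      fix r
      have "(r, s) \<in> off_diagonal T n" if "r \<in> {grid_floor T n t..t}"
        using that True \<Delta> grid_floor_ge_mesh[OF \<Delta>, of t] by (auto simp: off_diagonal_def)
      then show "ennreal (cmod (E r s)) * indicator {grid_floor T n t..t} r = ?e r s * indicator {grid_floor T n t..t} r"
        by (auto simp: indicator_def)
    qed
    finally show ?thesis
      using True by simp
  next
    case False
    then show ?thesis
      using D0[of s t] by (auto simp: off_diagonal_def)
  qed
  have "(\<integral>\<^sup>+p. ennreal (cmod (D (fst p) (snd p))) * indicator (off_diagonal T n) p \<partial>lborel) \<le> (\<integral>\<^sup>+p. ?G (fst p) (snd p) \<partial>lborel)"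
    by (intro nn_integral_mono order_trans[OF _ pt]) simp
  also have "\<dots> = (\<integral>\<^sup>+s. \<integral>\<^sup>+t. ?G t s \<partial>lborel \<partial>lborel)"
    unfolding lborel_prod[symmetric] by (subst lborel_pair.nn_integral_snd[symmetric]) simp_all
  also have "\<dots> \<le> (\<integral>\<^sup>+s. \<integral>\<^sup>+r. ?e r s * ennreal ?\<Delta> \<partial>lborel \<partial>lborel)"
  proof (rule nn_integral_mono)
    fix s
    have "(\<integral>\<^sup>+t. ?G t s \<partial>lborel) = (\<integral>\<^sup>+r. \<integral>\<^sup>+t. ?e r s * indicator {grid_floor T n t..t} r \<partial>lborel \<partial>lborel)"
      by (rule lborel_pair.Fubini') measurable
    also have "\<dots> \<le> (\<integral>\<^sup>+r. \<integral>\<^sup>+t. ?e r s * indicator {r..r + ?\<Delta>} t \<partial>lborel \<partial>lborel)"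
    proof (intro nn_integral_mono mult_left_mono)
      fix r t :: real
      show "indicator {grid_floor T n t..t} r \<le> (indicator {r..r + ?\<Delta>} t :: ennreal)"
        using grid_floor_gt[OF \<Delta>, of t] by (auto simp: indicator_def)
    qed auto
    also have "\<dots> = (\<integral>\<^sup>+r. ?e r s * ennreal ?\<Delta> \<partial>lborel)"
      using \<Delta> by (intro nn_integral_cong) (simp add: nn_integral_cmult_indicator)
    finally show "(\<integral>\<^sup>+t. ?G t s \<partial>lborel) \<le> (\<integral>\<^sup>+r. ?e r s * ennreal ?\<Delta> \<partial>lborel)" .
  qed
  also have "\<dots> = (\<integral>\<^sup>+s. \<integral>\<^sup>+r. ?e r s \<partial>lborel \<partial>lborel) * ennreal ?\<Delta>"
    by (simp add: nn_integral_multc)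
  also have "(\<integral>\<^sup>+s. \<integral>\<^sup>+r. ?e r s \<partial>lborel \<partial>lborel) = (\<integral>\<^sup>+p. ennreal (cmod (E (fst p) (snd p))) * indicator (off_diagonal T n) p \<partial>lborel)"
    unfolding lborel_prod[symmetric] by (subst lborel_pair.nn_integral_snd[symmetric]) simp_all
  finally show ?thesis
    by (simp add: mult.commute)
qed

section \<open>The second moment of the phase integral\<close>

lemma fubini_bounded_finite:
  fixes f :: "'a \<Rightarrow> 'b \<Rightarrow> complex"
  assumes M: "finite_measure M" and N: "finite_measure N"
    and [measurable]: "(\<lambda>(x, y). f x y) \<in> borel_measurable (M \<Otimes>\<^sub>M N)" and C: "\<And>x y. cmod (f x y) \<le> C"
  shows "(LINT x|M. LINT y|N. f x y) = (LINT y|N. LINT x|M. f x y)"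
proof -
  interpret M: finite_measure M by fact
  interpret N: finite_measure N by fact
  interpret pair_sigma_finite M N ..
  interpret P: finite_measure "M \<Otimes>\<^sub>M N"
    by (rule finite_measureI)
       (simp add: space_pair_measure N.emeasure_pair_measure_Times ennreal_mult_eq_top_iff)
  have "integrable (M \<Otimes>\<^sub>M N) (\<lambda>(x, y). f x y)"
    by (rule P.integrable_const_bound[where B=C]) (auto simp: C)
  then show ?thesis
    by (rule Fubini_integral[symmetric])
qed

text \<open>The square of an integral is a double integral, and the expectation is taken inside.\<close>

lemma second_moment_integral_le:
  fixes Z :: "'s \<Rightarrow> 'w \<Rightarrow> complex"
  assumes M: "finite_measure M" and L: "finite_measure \<Lambda>"
    and mZ: "(\<lambda>(t, \<omega>). Z t \<omega>) \<in> borel_measurable (\<Lambda> \<Otimes>\<^sub>M M)" and C: "\<And>t \<omega>. cmod (Z t \<omega>) \<le> C"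
  shows "(\<integral>\<^sup>+\<omega>. ennreal ((cmod (LINT t|\<Lambda>. Z t \<omega>))\<^sup>2) \<partial>M)
    \<le> (\<integral>\<^sup>+t. \<integral>\<^sup>+t'. ennreal (cmod (LINT \<omega>|M. Z t \<omega> * cnj (Z t' \<omega>))) \<partial>\<Lambda> \<partial>\<Lambda>)"
proof -
  interpret M: finite_measure M by fact
  interpret L: finite_measure \<Lambda> by fact
  have [measurable (raw)]: "(\<lambda>x. Z (f x) (h x)) \<in> borel_measurable N" if "f \<in> N \<rightarrow>\<^sub>M \<Lambda>" "h \<in> N \<rightarrow>\<^sub>M M" for f h and N :: "'z measure"
    using measurable_compose[OF measurable_Pair[OF that] mZ] by simp
  let ?H = "\<lambda>t t'. LINT \<omega>|M. Z t \<omega> * cnj (Z t' \<omega>)"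
  have C0: "0 \<le> C" using order_trans[OF norm_ge_zero C] .
  define W where "W \<omega> = (LINT t|\<Lambda>. Z t \<omega>)" for \<omega>
  have [measurable]: "W \<in> borel_measurable M"
    unfolding W_def[abs_def] by measurable
  have WC: "cmod (W \<omega>) \<le> C * measure \<Lambda> (space \<Lambda>)" for \<omega>
  proof (cases "integrable \<Lambda> (\<lambda>t. Z t \<omega>)")
    case True
    have "cmod (W \<omega>) \<le> (LINT t|\<Lambda>. cmod (Z t \<omega>))"
      unfolding W_def by (rule integral_norm_bound)
    also have "\<dots> \<le> (LINT t|\<Lambda>. C)"
      using True by (intro integral_mono) (auto simp: C)
    finally have "cmod (W \<omega>) \<le> (LINT t|\<Lambda>. C)" .
    then show ?thesis by (simp add: mult.commute)
  qed (use C0 in \<open>simp add: W_def not_integrable_integral_eq\<close>)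
  have int: "integrable M (\<lambda>\<omega>. (cmod (W \<omega>))\<^sup>2)"
    by (rule M.integrable_const_bound[where B="(C * measure \<Lambda> (space \<Lambda>))\<^sup>2"]) (auto intro!: power_mono WC)
  have "complex_of_real (LINT \<omega>|M. (cmod (W \<omega>))\<^sup>2) = (LINT \<omega>|M. W \<omega> * cnj (W \<omega>))"
    unfolding complex_norm_square[symmetric] by (rule integral_complex_of_real[symmetric])
  also have "\<dots> = (LINT \<omega>|M. LINT t|\<Lambda>. Z t \<omega> * cnj (W \<omega>))"
    by (simp add: W_def)
  also have "\<dots> = (LINT t|\<Lambda>. LINT \<omega>|M. Z t \<omega> * cnj (W \<omega>))"
    by (rule fubini_bounded_finite[OF M L, where C="C * (C * measure \<Lambda> (space \<Lambda>))"])
       (measurable, auto simp: norm_mult intro!: mult_mono C WC C0)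
  also have "\<dots> = (LINT t|\<Lambda>. LINT \<omega>|M. LINT t'|\<Lambda>. Z t \<omega> * cnj (Z t' \<omega>))"
    by (simp add: W_def flip: Bochner_Integration.integral_cnj)
  also have "\<dots> = (LINT t|\<Lambda>. LINT t'|\<Lambda>. ?H t t')"
  proof (rule Bochner_Integration.integral_cong)
    fix t assume [measurable]: "t \<in> space \<Lambda>"
    show "(LINT \<omega>|M. LINT t'|\<Lambda>. Z t \<omega> * cnj (Z t' \<omega>)) = (LINT t'|\<Lambda>. ?H t t')"
      by (rule fubini_bounded_finite[OF M L, where C="C * C"])
         (measurable, auto simp: norm_mult intro!: mult_mono C C0)
  qed simp
  finally have eq: "complex_of_real (LINT \<omega>|M. (cmod (W \<omega>))\<^sup>2) = (LINT t|\<Lambda>. LINT t'|\<Lambda>. ?H t t')" .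
  have "(\<integral>\<^sup>+\<omega>. ennreal ((cmod (W \<omega>))\<^sup>2) \<partial>M) = ennreal (LINT \<omega>|M. (cmod (W \<omega>))\<^sup>2)"
    by (rule nn_integral_eq_integral[OF int]) auto
  also have "(LINT \<omega>|M. (cmod (W \<omega>))\<^sup>2) = cmod (complex_of_real (LINT \<omega>|M. (cmod (W \<omega>))\<^sup>2))"
    unfolding norm_of_real by (rule abs_of_nonneg[symmetric]) (auto intro!: integral_nonneg_AE)
  also have "\<dots> = cmod (LINT t|\<Lambda>. LINT t'|\<Lambda>. ?H t t')"
    unfolding eq ..
  also have "ennreal \<dots> \<le> (\<integral>\<^sup>+t. ennreal (cmod (LINT t'|\<Lambda>. ?H t t')) \<partial>\<Lambda>)"
    by (rule ennreal_cmod_lebesgue_integral_le)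
  also have "\<dots> \<le> (\<integral>\<^sup>+t. \<integral>\<^sup>+t'. ennreal (cmod (?H t t')) \<partial>\<Lambda> \<partial>\<Lambda>)"
    by (intro nn_integral_mono ennreal_cmod_lebesgue_integral_le)
  finally show ?thesis
    by (simp add: W_def)
qed

definition phase_increment :: "(real \<Rightarrow> 'w \<Rightarrow> real^'n) \<Rightarrow> real \<Rightarrow> nat \<Rightarrow> real^'n \<Rightarrow> real \<Rightarrow> 'w \<Rightarrow> complex" where
  "phase_increment Y T n u t \<omega> = iexp (u \<bullet> Y t \<omega>) - iexp (u \<bullet> Y (grid_floor T n t) \<omega>)"

lemma cmod_phase_increment_le: "cmod (phase_increment Y T n u t \<omega>) \<le> 2"
  unfolding phase_increment_def by (rule order_trans[OF norm_triangle_ineq4]) simp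

context
  fixes M :: "'w measure" and Y :: "real \<Rightarrow> 'w \<Rightarrow> real^'n"
  assumes prob: "prob_space M"
    and mY: "(\<lambda>(t, \<omega>). Y t \<omega>) \<in> borel_measurable (borel \<Otimes>\<^sub>M M)"
begin

interpretation prob_space M by (rule prob)

lemma borel_measurable_process_compose:
  assumes "f \<in> borel_measurable N" "h \<in> N \<rightarrow>\<^sub>M M"
  shows "(\<lambda>x. Y (f x) (h x)) \<in> borel_measurable N"
  using measurable_compose[OF measurable_Pair[OF assms] mY] by simp

lemmas [measurable (raw)] = borel_measurable_process_compose

lemma integrable_iexp_process:
  "integrable M (\<lambda>\<omega>. iexp (u \<bullet> Y t \<omega> + v \<bullet> Y t' \<omega>))"
  by (rule integrable_const_bound[where B=1]) auto

text \<open>The covariance is a second difference of the joint characteristic function.  It is grouped as an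
  increment in t' of an increment in t, ready for the fundamental theorem of calculus in t'.\<close>

lemma covariance_phase_increment:
  "(LINT \<omega>|M. phase_increment Y T n u t \<omega> * cnj (phase_increment Y T n u t' \<omega>))
    = (joint_char M Y u t (- u) t' - joint_char M Y u (grid_floor T n t) (- u) t')
      - (joint_char M Y u t (- u) (grid_floor T n t') - joint_char M Y u (grid_floor T n t) (- u) (grid_floor T n t'))"
proof -
  have prod: "iexp (u \<bullet> Y a \<omega>) * cnj (iexp (u \<bullet> Y b \<omega>)) = iexp (u \<bullet> Y a \<omega> + (- u) \<bullet> Y b \<omega>)" for a b \<omega>
    by (simp add: iexp_mult_cnj_iexp)
  have "phase_increment Y T n u t \<omega> * cnj (phase_increment Y T n u t' \<omega>)
      = (iexp (u \<bullet> Y t \<omega> + (- u) \<bullet> Y t' \<omega>) - iexp (u \<bullet> Y (grid_floor T n t) \<omega> + (- u) \<bullet> Y t' \<omega>))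
        - (iexp (u \<bullet> Y t \<omega> + (- u) \<bullet> Y (grid_floor T n t') \<omega>) - iexp (u \<bullet> Y (grid_floor T n t) \<omega> + (- u) \<bullet> Y (grid_floor T n t') \<omega>))" for \<omega>
    unfolding phase_increment_def prod[symmetric] by (simp add: algebra_simps)
  then show ?thesis
    unfolding joint_char_def
    by (simp only: Bochner_Integration.integral_diff Bochner_Integration.integrable_diff integrable_iexp_process)
qed

lemma second_moment_phase_increment:
  "(LINT \<omega>|M. (cmod (phase_increment Y T n u t \<omega>))\<^sup>2) = 2 - 2 * Re (joint_char M Y u (grid_floor T n t) (- u) t)"
proof -
  have unit: "(cmod (a - b))\<^sup>2 = 2 - 2 * Re (b * cnj a)" if "cmod a = 1" "cmod b = 1" for a b
  proof -
    have "(cmod (a - b))\<^sup>2 = (cmod a)\<^sup>2 + (cmod b)\<^sup>2 - 2 * Re (b * cnj a)"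
      by (simp add: cmod_power2) (simp add: power2_eq_square algebra_simps)
    then show ?thesis using that by simp
  qed
  have "(cmod (phase_increment Y T n u t \<omega>))\<^sup>2 = 2 - 2 * Re (iexp (u \<bullet> Y (grid_floor T n t) \<omega> + (- u) \<bullet> Y t \<omega>))" for \<omega>
  proof -
    have "iexp (u \<bullet> Y (grid_floor T n t) \<omega>) * cnj (iexp (u \<bullet> Y t \<omega>)) = iexp (u \<bullet> Y (grid_floor T n t) \<omega> + (- u) \<bullet> Y t \<omega>)"
      by (simp add: iexp_mult_cnj_iexp)
    then show ?thesis
      unfolding phase_increment_def by (subst unit) (simp_all only: norm_exp_i_times)
  qed
  moreover have "(LINT \<omega>|M. 2 - 2 * Re (iexp (u \<bullet> Y (grid_floor T n t) \<omega> + (- u) \<bullet> Y t \<omega>)))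
      = 2 - 2 * Re (joint_char M Y u (grid_floor T n t) (- u) t)"
    unfolding joint_char_def
    using integrable_Re[OF integrable_iexp_process] integrable_iexp_process
    by (simp only: Bochner_Integration.integral_diff integrable_mult_right integrable_const integral_mult_right_zero integral_Re lebesgue_integral_const prob_space) simp
  ultimately show ?thesis
    by (simp only:)
qed

lemma cmod_covariance_phase_increment_le:
  "cmod (LINT \<omega>|M. phase_increment Y T n u t \<omega> * cnj (phase_increment Y T n u t' \<omega>))
    \<le> (LINT \<omega>|M. (cmod (phase_increment Y T n u t \<omega>))\<^sup>2) + (LINT \<omega>|M. (cmod (phase_increment Y T n u t' \<omega>))\<^sup>2)"
proof -
  let ?Z = "phase_increment Y T n u"
  have [measurable]: "?Z t \<in> borel_measurable M" for t
    unfolding phase_increment_def[abs_def] by measurable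
  have int: "integrable M (\<lambda>\<omega>. (cmod (?Z t \<omega>))\<^sup>2)" for t
    using power_mono[OF cmod_phase_increment_le norm_ge_zero, where n=2]
    by (intro integrable_const_bound[where B=4] AE_I2) auto
  have "cmod (LINT \<omega>|M. ?Z t \<omega> * cnj (?Z t' \<omega>))
      \<le> (LINT \<omega>|M. (cmod (?Z t \<omega>))\<^sup>2 + (cmod (?Z t' \<omega>))\<^sup>2)"
  proof (rule order_trans[OF integral_norm_bound integral_mono])
    show "integrable M (\<lambda>\<omega>. norm (?Z t \<omega> * cnj (?Z t' \<omega>)))"
      using mult_mono[OF cmod_phase_increment_le[of Y T n u t] cmod_phase_increment_le[of Y T n u t']]
      by (intro integrable_const_bound[where B=4] AE_I2) (auto simp: norm_mult)
    fix \<omega>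
    have "x * y \<le> x\<^sup>2 + y\<^sup>2" for x y :: real
    proof -
      have "0 \<le> x\<^sup>2 + y\<^sup>2"
        by simp
      then have "(x\<^sup>2 + y\<^sup>2) / 2 \<le> x\<^sup>2 + y\<^sup>2"
        by (auto simp: divide_le_eq intro: order_trans)
      then show ?thesis
        by (rule order_trans[OF mult_le_half_sum_squares])
    qed
    then show "norm (?Z t \<omega> * cnj (?Z t' \<omega>)) \<le> (cmod (?Z t \<omega>))\<^sup>2 + (cmod (?Z t' \<omega>))\<^sup>2"
      by (simp add: norm_mult)
  qed (intro Bochner_Integration.integrable_add int)
  then show ?thesis
    by (simp add: int)
qed

end

definition time_region :: "real \<Rightarrow> (real \<times> real) set" where
  "time_region T = {p. 0 < fst p \<and> fst p < snd p \<and> snd p < T}"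

lemma open_time_region: "open (time_region T)"
  unfolding time_region_def by (intro open_Collect_conj open_Collect_less continuous_intros)

lemma AE_snd_neq: "AE p in (lborel :: (real \<times> real) measure). snd p \<noteq> c"
proof -
  have "{p :: real \<times> real. snd p = c} = UNIV \<times> {c}"
    by auto
  also have "emeasure (lborel \<Otimes>\<^sub>M lborel) (UNIV \<times> {c :: real}) = emeasure lborel (UNIV :: real set) * emeasure lborel {c}"
    by (subst lborel.emeasure_pair_measure_Times) auto
  finally have "emeasure lborel {p :: real \<times> real. snd p = c} = 0"
    by (simp add: lborel_prod)
  moreover have "{p :: real \<times> real. snd p = c} \<in> sets lborel"
    unfolding sets_lborel by (intro borel_closed closed_Collect_eq continuous_intros)
  ultimately show ?thesis
    by (intro AE_I[where N="{p. snd p = c}"]) auto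
qed

text \<open>The derivative is controlled only for 0 < t < t' < T.  Setting it to 0 elsewhere makes it
  a Borel function on the whole plane.\<close>

definition interior_d2 :: "'w measure \<Rightarrow> (real \<Rightarrow> 'w \<Rightarrow> real^'n) \<Rightarrow> real \<Rightarrow> real^'n \<Rightarrow> real \<times> real \<Rightarrow> complex" where
  "interior_d2 M X T u p = (if p \<in> time_region T then d2_char M X u (fst p) (- u) (snd p) else 0)"

definition interior_d12 :: "'w measure \<Rightarrow> (real \<Rightarrow> 'w \<Rightarrow> real^'n) \<Rightarrow> real \<Rightarrow> real^'n \<Rightarrow> real \<times> real \<Rightarrow> complex" where
  "interior_d12 M X T u p = (if p \<in> time_region T then d12_char M X u (fst p) (- u) (snd p) else 0)"

definition d2_increment :: "'w measure \<Rightarrow> (real \<Rightarrow> 'w \<Rightarrow> real^'n) \<Rightarrow> real \<Rightarrow> nat \<Rightarrow> real^'n \<Rightarrow> real \<Rightarrow> real \<Rightarrow> complex" where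
  "d2_increment M X T n u t s = interior_d2 M X T u (t, s) - interior_d2 M X T u (grid_floor T n t, s)"

lemma d2_increment_eq:
  assumes T: "T > 0" and n: "n \<ge> 1" and p: "(t, s) \<in> off_diagonal T n" "s < T"
  shows "d2_increment M X T n u t s = d2_char M X u t (- u) s - d2_char M X u (grid_floor T n t) (- u) s"
  using p mesh_pos[OF T n] grid_floor_le[OF mesh_pos[OF T n], of t] grid_floor_ge_mesh[OF mesh_pos[OF T n], of t]
  by (auto simp: d2_increment_def interior_d2_def time_region_def off_diagonal_def)

text \<open>The region of integration leaves the interior only in the null set t' = T.\<close>

lemma v_term_eq:
  assumes T: "T > 0" and n: "n \<ge> 1"
  shows "v_term M X T n u = ennreal (mesh T n) *
    (\<integral>\<^sup>+p. ennreal (cmod (d2_increment M X T n u (fst p) (snd p))) * indicator (off_diagonal T n) p \<partial>lborel)"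
proof -
  let ?v = "\<lambda>p. (case p of (t, t') \<Rightarrow> ennreal (cmod (d2_char M X u t (- u) t' - d2_char M X u (grid_floor T n t) (- u) t'))) * indicator (off_diagonal T n) p"
  let ?D = "\<lambda>p. ennreal (cmod (d2_increment M X T n u (fst p) (snd p))) * indicator (off_diagonal T n) p"
  have "(\<integral>\<^sup>+p\<in>off_diagonal T n.
        (case p of (t, t') \<Rightarrow>
          ennreal (cmod (d2_char M X u t (- u) t'
                         - d2_char M X u (grid_floor T n t) (- u) t'))) \<partial>lborel)
      = (\<integral>\<^sup>+p. ?D p \<partial>lborel)"
  proof (rule nn_integral_cong_AE)
    have "?v p
       = ?D p" if "snd p \<noteq> T" for p
    proof (cases "p \<in> off_diagonal T n")
      case True
      then have "snd p < T"
        using that by (auto simp: off_diagonal_def)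
      then show ?thesis
        using True d2_increment_eq[OF T n, of "fst p" "snd p" M X u] by (auto split: prod.splits)
    qed simp
    then show "AE p in lborel. ?v p
       = ?D p"
      using AE_snd_neq[of T] by (auto elim: eventually_mono)
  qed
  then show ?thesis
    by (simp add: v_term_def)
qed

lemma v_tilde_term_eq:
  assumes T: "T > 0" and n: "n \<ge> 1"
  shows "v_tilde_term M X T n u = ennreal ((mesh T n)\<^sup>2) *
    (\<integral>\<^sup>+p. ennreal (cmod (interior_d12 M X T u p)) * indicator (off_diagonal T n) p \<partial>lborel)"
proof -
  let ?v = "\<lambda>p. (case p of (t, t') \<Rightarrow> ennreal (cmod (d12_char M X u t (- u) t'))) * indicator (off_diagonal T n) p"
  let ?D = "\<lambda>p. ennreal (cmod (interior_d12 M X T u p)) * indicator (off_diagonal T n) p"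
  have "(\<integral>\<^sup>+p\<in>off_diagonal T n. (case p of (t, t') \<Rightarrow> ennreal (cmod (d12_char M X u t (- u) t'))) \<partial>lborel)
      = (\<integral>\<^sup>+p. ?D p \<partial>lborel)"
  proof (rule nn_integral_cong_AE)
    have "?v p
       = ?D p" if "snd p \<noteq> T" for p
      using that mesh_pos[OF T n]
      by (cases "p \<in> off_diagonal T n") (auto simp: off_diagonal_def interior_d12_def time_region_def)
    then show "AE p in lborel. ?v p
       = ?D p"
      using AE_snd_neq[of T] by (auto elim: eventually_mono)
  qed
  then show ?thesis
    by (simp add: v_tilde_term_def)
qed

context
  fixes M :: "'w measure" and X Y :: "real \<Rightarrow> 'w \<Rightarrow> real^'n" and T :: real and n :: nat and u :: "real^'n"
  assumes prob: "prob_space M"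
    and mY: "(\<lambda>(t, \<omega>). Y t \<omega>) \<in> borel_measurable (borel \<Otimes>\<^sub>M M)"
    and YX: "\<And>t. t \<in> {0..T} \<Longrightarrow> Y t = X t"
    and T: "T > 0" and n: "n \<ge> 1"
    and diff: "\<And>t t'. 0 < t \<Longrightarrow> t < t' \<Longrightarrow> t' < T \<Longrightarrow> (\<lambda>s. joint_char M X u t (- u) s) differentiable (at t')"
begin

interpretation prob_space M by (rule prob)

lemmas [measurable (raw)] = borel_measurable_process_compose[OF prob mY]

lemma borel_measurable_joint_char_process:
  assumes "f \<in> borel_measurable N" "h \<in> borel_measurable N"
  shows "(\<lambda>x. joint_char M Y u (f x) (- u) (h x)) \<in> borel_measurable N"
  unfolding joint_char_def using assms by measurable

lemma joint_char_process_eq: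
  "t \<in> {0..T} \<Longrightarrow> s \<in> {0..T} \<Longrightarrow> joint_char M Y u t (- u) s = joint_char M X u t (- u) s"
  by (simp add: joint_char_def YX)

lemma borel_measurable_interior_d2: "interior_d2 M X T u \<in> borel_measurable borel"
proof -
  have R [measurable]: "time_region T \<in> sets borel"
    using open_time_region by (rule borel_open)
  have f: "fst \<in> borel_measurable (borel :: (real \<times> real) measure)" and s: "snd \<in> borel_measurable (borel :: (real \<times> real) measure)"
    by (intro borel_measurable_continuous_onI continuous_intros)+
  have "(\<lambda>p. if p \<in> time_region T then joint_char M X u (fst p) (- u) (snd p) else 0)
      = (\<lambda>p. if p \<in> time_region T then joint_char M Y u (fst p) (- u) (snd p) else 0)"
    by (auto simp: fun_eq_iff time_region_def joint_char_process_eq)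
  also have "\<dots> \<in> borel_measurable borel"
    using borel_measurable_joint_char_process[OF f s] by measurable
  finally have "(\<lambda>p. if p \<in> time_region T then vector_derivative (\<lambda>s. joint_char M X u (fst p) (- u) s) (at (snd p)) else 0) \<in> borel_measurable borel"
    by (rule borel_measurable_vector_derivative_snd[OF open_time_region]) (auto simp: time_region_def diff)
  then show ?thesis
    unfolding interior_d2_def[abs_def] d2_char_def .
qed

lemma borel_measurable_d2_increment: "(\<lambda>p. d2_increment M X T n u (fst p) (snd p)) \<in> borel_measurable (borel \<Otimes>\<^sub>M borel)"
proof -
  note [measurable] = borel_measurable_interior_d2[unfolded borel_prod[symmetric]]
  show ?thesis
    unfolding d2_increment_def by measurable
qed

lemma d2_increment_has_vector_derivative:
  assumes "mesh T n \<le> t" "t < s" "s < T"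
  shows "((\<lambda>s. joint_char M X u t (- u) s - joint_char M X u (grid_floor T n t) (- u) s)
    has_vector_derivative d2_increment M X T n u t s) (at s)"
proof -
  have gf: "0 < grid_floor T n t" "grid_floor T n t \<le> t"
    using mesh_pos[OF T n] grid_floor_le[OF mesh_pos[OF T n], of t] grid_floor_ge_mesh[OF mesh_pos[OF T n], of t] assms by auto
  have "((\<lambda>s. joint_char M X u r (- u) s) has_vector_derivative interior_d2 M X T u (r, s)) (at s)" if "0 < r" "r \<le> t" for r
    using diff[of r s] assms that by (simp add: interior_d2_def time_region_def d2_char_def vector_derivative_works)
  then show ?thesis
    unfolding d2_increment_def using gf assms by (intro has_vector_derivative_diff) auto
qed

text \<open>The kernel estimate applied to the covariance of the phase increments.  Y extends X from
  [0,T] to a jointly measurable process on the line.\<close>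

lemma second_moment_phase_integral_le:
  "(\<integral>\<^sup>+\<omega>. ennreal ((cmod (LINT t|restrict_space lborel {0..<T}. phase_increment Y T n u t \<omega>))\<^sup>2) \<partial>M)
    \<le> 16 * (w_term M X T n u + v_term M X T n u)"
proof -
  let ?\<Lambda> = "restrict_space lborel {0..<T} :: real measure"
  let ?Z = "phase_increment Y T n u"
  let ?B = "\<lambda>t t'. \<integral>\<^sup>+s. ennreal (cmod (d2_increment M X T n u t s)) * indicator {grid_floor T n t'..t'} s \<partial>lborel"
  define H where "H t t' = (LINT \<omega>|M. ?Z t \<omega> * cnj (?Z t' \<omega>))" for t t'
  define g where "g t = (LINT \<omega>|M. (cmod (?Z t \<omega>))\<^sup>2)" for t
  have \<Delta>: "mesh T n > 0" "mesh T n \<le> T"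
    using mesh_pos[OF T n] mesh_le[OF T n] by auto
  have [measurable (raw)]: "(\<lambda>x. ?Z (f x) (h x)) \<in> borel_measurable N" if "f \<in> borel_measurable N" "h \<in> N \<rightarrow>\<^sub>M M" for f h and N :: "'z measure"
    unfolding phase_increment_def using that by measurable
  have fin: "finite_measure ?\<Lambda>"
    by (rule finite_measureI) (use T in \<open>simp add: emeasure_restrict_space\<close>)
  have "(\<integral>\<^sup>+\<omega>. ennreal ((cmod (LINT t|?\<Lambda>. ?Z t \<omega>))\<^sup>2) \<partial>M) \<le> (\<integral>\<^sup>+t. \<integral>\<^sup>+t'. ennreal (cmod (H t t')) \<partial>?\<Lambda> \<partial>?\<Lambda>)"
    unfolding H_def
  proof (rule second_moment_integral_le)
    have "(\<lambda>p. fst p) \<in> borel_measurable (?\<Lambda> \<Otimes>\<^sub>M M)"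
      by (rule measurable_compose[OF measurable_fst]) (simp add: measurable_restrict_space1)
    then show "(\<lambda>(t, \<omega>). ?Z t \<omega>) \<in> borel_measurable (?\<Lambda> \<Otimes>\<^sub>M M)"
      unfolding split_beta by measurable
  qed (use fin cmod_phase_increment_le in \<open>auto intro: finite_measure_axioms\<close>)
  also have "\<dots> = (\<integral>\<^sup>+t. \<integral>\<^sup>+t'. ennreal (cmod (H t t')) * (indicator {0..<T} t * indicator {0..<T} t') \<partial>lborel \<partial>lborel)"
    by (subst (1 2) nn_integral_restrict_space) (auto intro!: nn_integral_cong simp: indicator_def)
  also have "\<dots> \<le> 16 * (ennreal (mesh T n) * (\<integral>\<^sup>+t. ennreal \<bar>g t\<bar> * indicator {mesh T n..T} t \<partial>lborel)
          + ennreal T * (\<integral>\<^sup>+t. ennreal \<bar>g t\<bar> * indicator {0..mesh T n} t \<partial>lborel)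
          + ennreal (mesh T n) * (\<integral>\<^sup>+p. ennreal (cmod (d2_increment M X T n u (fst p) (snd p))) * indicator (off_diagonal T n) p \<partial>lborel))"
  proof (rule nn_integral_kernel_le[OF T n])
    show "(\<lambda>p. H (fst p) (snd p)) \<in> borel_measurable (borel \<Otimes>\<^sub>M borel)"
      unfolding H_def by measurable
    show "g \<in> borel_measurable borel"
      unfolding g_def[abs_def] by measurable
    show "(\<lambda>p. d2_increment M X T n u (fst p) (snd p)) \<in> borel_measurable (borel \<Otimes>\<^sub>M borel)"
      by (rule borel_measurable_d2_increment)
    show "cmod (H t t') = cmod (H t' t)" for t t'
    proof -
      have "H t t' = cnj (H t' t)"
        unfolding H_def by (simp add: mult.commute flip: Bochner_Integration.integral_cnj)
      then show ?thesis by simp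
    qed
    have g0: "\<bar>g t\<bar> = g t" for t
      unfolding g_def by (rule abs_of_nonneg) (auto intro!: integral_nonneg_AE)
    show "cmod (H t t') \<le> \<bar>g t\<bar> + \<bar>g t'\<bar>" for t t'
      unfolding g0 unfolding H_def g_def by (rule cmod_covariance_phase_increment_le[OF prob mY])
    fix t t' assume t: "mesh T n \<le> t" "t + 3 * mesh T n < t'" "t' < T"
    let ?F = "\<lambda>s. joint_char M X u t (- u) s - joint_char M X u (grid_floor T n t) (- u) s"
    have gf: "0 \<le> grid_floor T n t" "grid_floor T n t \<le> t" "grid_floor T n t' \<le> t'" "t' - mesh T n < grid_floor T n t'"
      using t \<Delta> grid_floor_nonneg grid_floor_le grid_floor_gt by auto
    have "H t t' = ?F t' - ?F (grid_floor T n t')"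
      unfolding H_def covariance_phase_increment[OF prob mY]
      using t gf \<Delta> by (simp add: joint_char_process_eq)
    moreover have "ennreal (cmod (?F t' - ?F (grid_floor T n t'))) \<le> ?B t t'"
    proof (rule ennreal_cmod_increment_le)
      show "d2_increment M X T n u t \<in> borel_measurable borel"
        using measurable_compose[OF _ borel_measurable_d2_increment, of "\<lambda>s. (t, s)" borel] by simp
      show "(?F has_vector_derivative d2_increment M X T n u t s) (at s)" if "s \<in> {grid_floor T n t'..t'}" for s
        using that t gf \<Delta> by (intro d2_increment_has_vector_derivative) auto
    qed (rule gf)
    ultimately show "ennreal (cmod (H t t')) \<le> ?B t t'"
      by simp
  qed
  also have "\<dots> = 16 * (w_term M X T n u + v_term M X T n u)"
  proof -
    have g: "g t = g_err M X T n u t" if "t \<in> {0..T}" for t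
      unfolding g_def g_err_def second_moment_phase_increment[OF prob mY]
      using that grid_floor_le[OF \<Delta>(1), of t] grid_floor_nonneg[OF \<Delta>(1), of t] by (simp add: joint_char_process_eq)
    have "(\<integral>\<^sup>+t. ennreal \<bar>g t\<bar> * indicator {mesh T n..T} t \<partial>lborel) = (\<integral>\<^sup>+t\<in>{mesh T n..T}. ennreal \<bar>g_err M X T n u t\<bar> \<partial>lborel)"
      using \<Delta> g by (intro nn_integral_cong) (auto simp: indicator_def)
    moreover have "(\<integral>\<^sup>+t. ennreal \<bar>g t\<bar> * indicator {0..mesh T n} t \<partial>lborel) = (\<integral>\<^sup>+t\<in>{0..mesh T n}. ennreal \<bar>g_err M X T n u t\<bar> \<partial>lborel)"
      using \<Delta> g by (intro nn_integral_cong) (auto simp: indicator_def)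
    ultimately show ?thesis
      unfolding w_term_def v_term_eq[OF T n] by simp
  qed
  finally show ?thesis .
qed

text \<open>The increment of the t'-derivative between floor t and t is an integral of the mixed derivative.\<close>

lemma v_term_le_v_tilde_term:
  assumes diff2: "\<And>t t'. 0 < t \<Longrightarrow> t < t' \<Longrightarrow> t' < T \<Longrightarrow> (\<lambda>s. d2_char M X u s (- u) t') differentiable (at t)"
  shows "v_term M X T n u \<le> v_tilde_term M X T n u"
proof -
  let ?B = "\<lambda>t s. \<integral>\<^sup>+r. ennreal (cmod (interior_d12 M X T u (r, s))) * indicator {grid_floor T n t..t} r \<partial>lborel"
  have \<Delta>: "mesh T n > 0"
    by (rule mesh_pos[OF T n])
  have m12: "interior_d12 M X T u \<in> borel_measurable borel"
  proof -
    have "(\<lambda>p. if p \<in> time_region T then d2_char M X u (fst p) (- u) (snd p) else 0) \<in> borel_measurable borel"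
      using borel_measurable_interior_d2 unfolding interior_d2_def[abs_def] .
    then have "(\<lambda>p. if p \<in> time_region T then vector_derivative (\<lambda>r. d2_char M X u r (- u) (snd p)) (at (fst p)) else 0) \<in> borel_measurable borel"
      by (rule borel_measurable_vector_derivative_fst[OF open_time_region]) (auto simp: time_region_def diff2)
    then show ?thesis
      unfolding interior_d12_def[abs_def] d12_char_def .
  qed
  have "(\<integral>\<^sup>+p. ennreal (cmod (d2_increment M X T n u (fst p) (snd p))) * indicator (off_diagonal T n) p \<partial>lborel)
      \<le> ennreal (mesh T n) * (\<integral>\<^sup>+p. ennreal (cmod (interior_d12 M X T u (fst p, snd p))) * indicator (off_diagonal T n) p \<partial>lborel)"
  proof (rule nn_integral_off_diagonal_increment_le[OF T n])
    show "(\<lambda>p. interior_d12 M X T u (fst p, snd p)) \<in> borel_measurable (borel \<Otimes>\<^sub>M borel)"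
      using m12 by (simp add: borel_prod)
    show "d2_increment M X T n u t s = 0" if "s \<ge> T" for t s
      using that by (auto simp: d2_increment_def interior_d2_def time_region_def)
    fix t s assume p: "(t, s) \<in> off_diagonal T n" "s < T"
    then have t: "mesh T n \<le> t" "t < s"
      using \<Delta> by (auto simp: off_diagonal_def)
    have "ennreal (cmod (d2_char M X u t (- u) s - d2_char M X u (grid_floor T n t) (- u) s))
        \<le> ?B t s"
    proof (rule ennreal_cmod_increment_le)
      show "grid_floor T n t \<le> t"
        by (rule grid_floor_le[OF \<Delta>])
      show "(\<lambda>r. interior_d12 M X T u (r, s)) \<in> borel_measurable borel"
        using measurable_compose[OF _ m12, of "\<lambda>r. (r, s)" borel] by (simp add: borel_prod[symmetric])
      show "((\<lambda>r. d2_char M X u r (- u) s) has_vector_derivative interior_d12 M X T u (r, s)) (at r)" if "r \<in> {grid_floor T n t..t}" for r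
        using that t p(2) \<Delta> grid_floor_ge_mesh[OF \<Delta> t(1)] diff2[of r s]
        by (simp add: interior_d12_def time_region_def d12_char_def vector_derivative_works)
    qed
    then show "ennreal (cmod (d2_increment M X T n u t s))
        \<le> ?B t s"
      by (simp add: d2_increment_eq[OF T n p])
  qed
  then have "v_term M X T n u \<le> ennreal (mesh T n) * (ennreal (mesh T n) * (\<integral>\<^sup>+p. ennreal (cmod (interior_d12 M X T u p)) * indicator (off_diagonal T n) p \<partial>lborel))"
    unfolding v_term_eq[OF T n] by (intro mult_left_mono) auto
  also have "\<dots> = v_tilde_term M X T n u"
    unfolding v_tilde_term_eq[OF T n] using \<Delta> by (simp add: power2_eq_square ennreal_mult mult.assoc)
  finally show ?thesis .
qed

end

section \<open>Measurability, independence and the Riemann sum\<close>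

text \<open>Sampling the path at the next point of a grid of width 1/(k+1) gives a process which is constant in
  time between grid points, hence jointly measurable.  By right-continuity it converges to X as k tends to
  infinity.  The process is extended constantly outside [0,T].\<close>

lemma right_continuous_process_measurable:
  fixes X :: "real \<Rightarrow> 'w \<Rightarrow> real^'n"
  assumes T: "T > 0" and m: "\<And>t. t \<in> {0..T} \<Longrightarrow> X t \<in> borel_measurable N"
    and rc: "\<And>\<omega> t. \<omega> \<in> space N \<Longrightarrow> t \<in> {0..<T} \<Longrightarrow> ((\<lambda>t. X t \<omega>) \<longlongrightarrow> X t \<omega>) (at_right t)"
  shows "(\<lambda>(t, \<omega>). X (max 0 (min T t)) \<omega>) \<in> borel_measurable (borel \<Otimes>\<^sub>M N)"
proof (rule borel_measurable_LIMSEQ_metric)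
  let ?c = "\<lambda>t. max 0 (min T t) :: real"
  let ?g = "\<lambda>k i. ?c ((real_of_int i + 1) / real (Suc k))"
  let ?i = "\<lambda>k t. \<lfloor>?c t * real (Suc k)\<rfloor>"
  show "(\<lambda>p. X (?g k (?i k (fst p))) (snd p)) \<in> borel_measurable (borel \<Otimes>\<^sub>M N)" for k
  proof (rule measurable_compose_countable[where f="\<lambda>i p. X (?g k i) (snd p)"])
    show "(\<lambda>p. X (?g k i) (snd p)) \<in> borel_measurable (borel \<Otimes>\<^sub>M N)" for i
      using T by (intro measurable_compose[OF measurable_snd] m) auto
    show "(\<lambda>p. ?i k (fst p)) \<in> borel \<Otimes>\<^sub>M N \<rightarrow>\<^sub>M count_space UNIV"
      by measurable
  qed
  fix p :: "real \<times> 'w" assume "p \<in> space (borel \<Otimes>\<^sub>M N)"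
  then have w: "snd p \<in> space N"
    by (auto simp: space_pair_measure)
  let ?t = "?c (fst p)"
  let ?r = "\<lambda>k. ?g k (?i k (fst p))"
  have "(\<lambda>k. X (?r k) (snd p)) \<longlonglongrightarrow> X ?t (snd p)"
  proof (cases "?t < T")
    case True
    have bounds: "?t < (real_of_int (?i k (fst p)) + 1) / real (Suc k)" "(real_of_int (?i k (fst p)) + 1) / real (Suc k) \<le> ?t + 1 / real (Suc k)" for k
    proof -
      have gen: "x < (real_of_int \<lfloor>x * N\<rfloor> + 1) / N" "(real_of_int \<lfloor>x * N\<rfloor> + 1) / N \<le> x + 1 / N" if "N > 0" for x N :: real
        using that floor_correct[of "x * N"] by (simp_all add: field_simps)
      show "?t < (real_of_int (?i k (fst p)) + 1) / real (Suc k)" "(real_of_int (?i k (fst p)) + 1) / real (Suc k) \<le> ?t + 1 / real (Suc k)"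
        by (rule gen; simp)+
    qed
    have r: "?t < ?r k" "?r k \<le> ?t + 1 / real (Suc k)" for k
      using bounds[of k] True by (auto simp del: of_nat_Suc)
    have "(\<lambda>k. ?t + 1 / real (Suc k)) \<longlonglongrightarrow> ?t + 0"
      by (intro tendsto_intros LIMSEQ_Suc lim_1_over_n)
    then have lim: "(\<lambda>k. ?t + 1 / real (Suc k)) \<longlonglongrightarrow> ?t"
      by simp
    have "?r \<longlonglongrightarrow> ?t"
      by (rule tendsto_sandwich[OF _ _ tendsto_const lim]) (intro always_eventually allI less_imp_le r(1), intro always_eventually allI r(2))
    then have "filterlim ?r (at_right ?t) sequentially"
      unfolding filterlim_at using r(1) less_imp_neq[OF r(1), symmetric]
      by (intro conjI always_eventually allI) (simp_all only: greaterThan_iff not_False_eq_True)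
    moreover have "((\<lambda>t. X t (snd p)) \<longlongrightarrow> X ?t (snd p)) (at_right ?t)"
      using True by (intro rc w) auto
    ultimately show ?thesis
      by (rule filterlim_compose[rotated])
  next
    case False
    then have t: "?t = T"
      using T by auto
    have "?r k = T" for k
    proof -
      have "T * real (Suc k) < real_of_int (?i k (fst p)) + 1"
        unfolding t by linarith
      then have "T < (real_of_int (?i k (fst p)) + 1) / real (Suc k)"
        by (simp add: field_simps del: of_nat_Suc)
      then show ?thesis
        using T by simp
    qed
    then show ?thesis
      by (simp only: t tendsto_const)
  qed
  then show "(\<lambda>k. X (?g k (?i k (fst p))) (snd p)) \<longlonglongrightarrow> (case p of (t, \<omega>) \<Rightarrow> X (?c t) \<omega>)"
    by (simp only: split_beta)
qed

text \<open>The sigma-algebra G carries the information of the process.  Under independence the joint law of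
  the sample point, seen through G, and of the shift is a product measure, so the shift can be
  integrated out; its density is then replaced by its essential supremum.\<close>

lemma nn_integral_indep_le:
  fixes \<xi> :: "'w \<Rightarrow> real^'n"
  assumes M: "prob_space M"
    and G: "space G = space M" "sets G \<subseteq> sets M"
    and \<xi> [measurable]: "\<xi> \<in> borel_measurable M"
    and ind: "prob_space.indep_set M (sets G) (sets (vimage_algebra (space M) \<xi> borel))"
    and \<mu>: "distributed M lborel \<xi> \<mu>"
    and \<Phi> [measurable]: "(\<lambda>(\<omega>, z). \<Phi> \<omega> z) \<in> borel_measurable (G \<Otimes>\<^sub>M borel)"
  shows "(\<integral>\<^sup>+\<omega>. \<Phi> \<omega> (\<xi> \<omega>) \<partial>M) \<le> esssup lborel \<mu> * (\<integral>\<^sup>+\<omega>. \<integral>\<^sup>+z. \<Phi> \<omega> z \<partial>lborel \<partial>M)"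
proof -
  interpret prob_space M by fact
  have id [measurable]: "(\<lambda>\<omega>. \<omega>) \<in> M \<rightarrow>\<^sub>M G"
    using G by (auto simp: measurable_def)
  let ?M1 = "distr M G (\<lambda>\<omega>. \<omega>)" and ?M2 = "distr M borel \<xi>"
  interpret M1: prob_space ?M1 by (rule prob_space_distr) measurable
  interpret M2: prob_space ?M2 by (rule prob_space_distr) measurable
  have law: "?M2 = density lborel \<mu>" and [measurable]: "\<mu> \<in> borel_measurable borel"
    using \<mu> by (auto simp: distributed_def cong: distr_cong)
  have "?M1 \<Otimes>\<^sub>M ?M2 = distr M (G \<Otimes>\<^sub>M borel) (\<lambda>\<omega>. (\<omega>, \<xi> \<omega>))"
  proof (rule pair_measure_eqI)
    show "sigma_finite_measure ?M1" "sigma_finite_measure ?M2"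
      by unfold_locales
    show "sets (?M1 \<Otimes>\<^sub>M ?M2) = sets (distr M (G \<Otimes>\<^sub>M borel) (\<lambda>\<omega>. (\<omega>, \<xi> \<omega>)))"
      by (simp cong: sets_pair_measure_cong)
    fix A B assume A: "A \<in> sets ?M1" and B: "B \<in> sets ?M2"
    then have [measurable]: "A \<in> sets G" "B \<in> sets borel"
      by auto
    have AM: "A \<in> sets M"
      using \<open>A \<in> sets G\<close> G(2) by (rule rev_subsetD)
    then have AS: "A \<subseteq> space M"
      by (rule sets.sets_into_space)
    let ?B = "\<xi> -` B \<inter> space M"
    have "?B \<in> sets (vimage_algebra (space M) \<xi> borel)"
      by (intro in_vimage_algebra) measurable
    then have "prob (A \<inter> ?B) = prob A * prob ?B"
      using indep_setD[OF ind, of A ?B] by simp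
    then have "emeasure M (A \<inter> ?B) = emeasure M A * emeasure M ?B"
      by (simp add: emeasure_eq_measure ennreal_mult)
    moreover have "(\<lambda>\<omega>. (\<omega>, \<xi> \<omega>)) -` (A \<times> B) \<inter> space M = A \<inter> ?B"
      using AS by auto
    moreover have "(\<lambda>\<omega>. \<omega>) -` A \<inter> space M = A"
      using AS by auto
    ultimately show "emeasure ?M1 A * emeasure ?M2 B = emeasure (distr M (G \<Otimes>\<^sub>M borel) (\<lambda>\<omega>. (\<omega>, \<xi> \<omega>))) (A \<times> B)"
      by (simp add: emeasure_distr)
  qed
  note joint = this
  have "(\<integral>\<^sup>+\<omega>. \<Phi> \<omega> (\<xi> \<omega>) \<partial>M) = (\<integral>\<^sup>+p. (case p of (\<omega>, z) \<Rightarrow> \<Phi> \<omega> z) \<partial>distr M (G \<Otimes>\<^sub>M borel) (\<lambda>\<omega>. (\<omega>, \<xi> \<omega>)))"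
    by (simp add: nn_integral_distr)
  also have "\<dots> = (\<integral>\<^sup>+\<omega>. \<integral>\<^sup>+z. \<Phi> \<omega> z \<partial>?M2 \<partial>?M1)"
    unfolding joint[symmetric] by (subst M2.nn_integral_fst[symmetric]) (auto cong: measurable_cong_sets sets_pair_measure_cong)
  also have "\<dots> = (\<integral>\<^sup>+\<omega>. \<integral>\<^sup>+z. \<mu> z * \<Phi> \<omega> z \<partial>lborel \<partial>M)"
  proof -
    have "(\<integral>\<^sup>+\<omega>. \<integral>\<^sup>+z. \<Phi> \<omega> z \<partial>?M2 \<partial>?M1) = (\<integral>\<^sup>+\<omega>. \<integral>\<^sup>+z. \<mu> z * \<Phi> \<omega> z \<partial>lborel \<partial>?M1)"
      unfolding law by (intro nn_integral_cong nn_integral_density) auto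
    then show ?thesis
      by (simp add: nn_integral_distr)
  qed
  also have "\<dots> \<le> (\<integral>\<^sup>+\<omega>. esssup lborel \<mu> * (\<integral>\<^sup>+z. \<Phi> \<omega> z \<partial>lborel) \<partial>M)"
  proof (rule nn_integral_mono)
    fix \<omega> assume "\<omega> \<in> space M"
    then have [measurable]: "\<Phi> \<omega> \<in> borel_measurable borel"
      using measurable_compose[OF measurable_Pair1' \<Phi>, of \<omega>] G by simp
    have "(\<integral>\<^sup>+z. \<mu> z * \<Phi> \<omega> z \<partial>lborel) \<le> (\<integral>\<^sup>+z. esssup lborel \<mu> * \<Phi> \<omega> z \<partial>lborel)"
      using esssup_AE[of \<mu> lborel] by (intro nn_integral_mono_AE) (auto elim!: eventually_mono intro: mult_right_mono)
    then show "(\<integral>\<^sup>+z. \<mu> z * \<Phi> \<omega> z \<partial>lborel) \<le> esssup lborel \<mu> * (\<integral>\<^sup>+z. \<Phi> \<omega> z \<partial>lborel)"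
      by (simp add: nn_integral_cmult)
  qed
  also have "\<dots> = esssup lborel \<mu> * (\<integral>\<^sup>+\<omega>. \<integral>\<^sup>+z. \<Phi> \<omega> z \<partial>lborel \<partial>M)"
  proof (rule nn_integral_cmult)
    have "(\<lambda>\<omega>. \<integral>\<^sup>+z. \<Phi> \<omega> z \<partial>lborel) \<in> borel_measurable G"
      by measurable
    from measurable_compose[OF id this] show "(\<lambda>\<omega>. \<integral>\<^sup>+z. \<Phi> \<omega> z \<partial>lborel) \<in> borel_measurable M" .
  qed
  finally show ?thesis .
qed

text \<open>The non-negative integral of an arbitrary function is a supremum over the simple functions below it,
  and these scale.  The w- and v-terms enter as arbitrary functions of u.\<close>

lemma nn_integral_cmult_le:
  assumes c: "c > 0"
  shows "(\<integral>\<^sup>+x. ennreal c * F x \<partial>M) \<le> ennreal c * (\<integral>\<^sup>+x. F x \<partial>M)"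
  unfolding nn_integral_def[of M "\<lambda>x. ennreal c * F x"]
proof (rule SUP_least, clarify)
  fix g assume g: "simple_function M g" "g \<le> (\<lambda>x. ennreal c * F x)"
  have one: "ennreal c * (ennreal (1 / c) * y) = y" "ennreal (1 / c) * (ennreal c * y) = y" for y
    using c by (simp_all add: mult.assoc[symmetric] flip: ennreal_mult)
  have [measurable]: "g \<in> borel_measurable M"
    using g(1) by (rule borel_measurable_simple_function)
  have "integral\<^sup>S M g = (\<integral>\<^sup>+x. ennreal c * (ennreal (1 / c) * g x) \<partial>M)"
    unfolding one by (rule nn_integral_eq_simple_integral[OF g(1), symmetric])
  also have "\<dots> = ennreal c * (\<integral>\<^sup>+x. ennreal (1 / c) * g x \<partial>M)"
    by (rule nn_integral_cmult) measurable
  also have "\<dots> \<le> ennreal c * (\<integral>\<^sup>+x. F x \<partial>M)"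
  proof (intro mult_left_mono nn_integral_mono)
    fix x
    have "ennreal (1 / c) * g x \<le> ennreal (1 / c) * (ennreal c * F x)"
      using g(2) by (intro mult_left_mono) (auto simp: le_fun_def)
    then show "ennreal (1 / c) * g x \<le> F x"
      unfolding one .
  qed auto
  finally show "integral\<^sup>S M g \<le> ennreal c * (\<integral>\<^sup>+x. F x \<partial>M)" .
qed

text \<open>The Riemann estimator is the occupation time of the path frozen at the grid points.\<close>

lemma riemann_estimator_eq_integral:
  fixes h :: "'a \<Rightarrow> real"
  assumes T: "T > 0" and n: "n \<ge> 1"
  shows "riemann_estimator T n x h = (LINT t|restrict_space lborel {0..<T}. h (x (grid_floor T n t)))"
proof -
  let ?\<Delta> = "mesh T n"
  have \<Delta>: "?\<Delta> > 0" and nT: "real n * ?\<Delta> = T"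
    using mesh_pos[OF T n] n by (auto simp: mesh_def)
  let ?I = "\<lambda>k. {real k * ?\<Delta>..<real (Suc k) * ?\<Delta>}"
  have pt: "indicator {0..<T} t *\<^sub>R h (x (grid_floor T n t)) = (\<Sum>k<n. indicator (?I k) t *\<^sub>R h (x (real k * ?\<Delta>)))" for t
  proof (cases "t \<in> {0..<T}")
    case True
    define j where "j = nat \<lfloor>t / ?\<Delta>\<rfloor>"
    have j: "real_of_int \<lfloor>t / ?\<Delta>\<rfloor> = real j"
      using True \<Delta> by (simp add: j_def)
    have mem: "t \<in> ?I k \<longleftrightarrow> k = j" for k
    proof -
      have "t \<in> ?I k \<longleftrightarrow> real k \<le> t / ?\<Delta> \<and> t / ?\<Delta> < real k + 1"
        using \<Delta> by (simp add: field_simps)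
      also have "\<dots> \<longleftrightarrow> \<lfloor>t / ?\<Delta>\<rfloor> = int k"
        by (simp add: floor_eq_iff)
      also have "\<dots> \<longleftrightarrow> k = j"
        using j by linarith
      finally show ?thesis .
    qed
    have "j < n"
    proof -
      have "real j * ?\<Delta> < real n * ?\<Delta>"
        using mem[of j] True nT by auto
      then show ?thesis
        using \<Delta> by simp
    qed
    moreover have "grid_floor T n t = real j * ?\<Delta>"
      by (simp add: grid_floor_def j)
    moreover have "(\<Sum>k<n. indicator (?I k) t *\<^sub>R h (x (real k * ?\<Delta>))) = (\<Sum>k<n. if k = j then h (x (real k * ?\<Delta>)) else 0)"
      by (intro sum.cong refl) (simp only: indicator_def mem, simp)
    ultimately show ?thesis
      using True by simp
  next
    case False
    have "indicator (?I k) t = (0 :: real)" if "k < n" for k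
    proof -
      have "real (Suc k) * ?\<Delta> \<le> real n * ?\<Delta>"
        using that \<Delta> by (intro mult_right_mono) auto
      then show ?thesis
        using False nT \<Delta> by (auto simp: indicator_def simp del: of_nat_Suc) (meson \<Delta> less_imp_le mult_nonneg_nonneg of_nat_0_le_iff order_trans)
    qed
    then show ?thesis
      using False by simp
  qed
  have ivl: "measure lborel (?I k) = ?\<Delta>" "emeasure lborel (?I k) < \<infinity>" for k
    using \<Delta> by (simp_all add: measure_def distrib_right mult_right_mono)
  have "(LINT t|restrict_space lborel {0..<T}. h (x (grid_floor T n t))) = (LINT t|lborel. (\<Sum>k<n. indicator (?I k) t *\<^sub>R h (x (real k * ?\<Delta>))))"
    by (subst integral_restrict_space) (simp_all only: pt, auto)
  also have "\<dots> = (\<Sum>k<n. LINT t|lborel. indicator (?I k) t *\<^sub>R h (x (real k * ?\<Delta>)))"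
    using ivl by (intro Bochner_Integration.integral_sum integrable_scaleR_left integrable_real_indicator) auto
  also have "\<dots> = (\<Sum>k<n. ?\<Delta> * h (x (real k * ?\<Delta>)))"
    using ivl by (intro sum.cong) (auto simp del: of_nat_Suc)
  also have "\<dots> = ?\<Delta> * (\<Sum>k=1..n. h (x (real (k - 1) * ?\<Delta>)))"
    unfolding sum_distrib_left[symmetric]
    by (intro arg_cong[where f="(*) ?\<Delta>"] sum.reindex_bij_witness[of _ "\<lambda>k. k - 1" Suc]) auto
  finally show ?thesis
    by (simp add: riemann_estimator_def)
qed

section \<open>The sampling error\<close>

text \<open>The half-open interval matches the cells of the grid.\<close>

lemma occupation_time_eq_integral:
  fixes h :: "'a::euclidean_space \<Rightarrow> real"
  assumes [measurable]: "h \<in> borel_measurable borel" "y \<in> borel_measurable borel"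
    and eq: "\<And>t. t \<in> {0..T} \<Longrightarrow> y t = x t"
  shows "occupation_time T x h = (LINT t|restrict_space lborel {0..<T}. h (y t))"
proof -
  have "occupation_time T x h = (LINT t|lborel. indicator {0..T} t *\<^sub>R h (y t))"
    unfolding occupation_time_def set_lebesgue_integral_def
    by (intro Bochner_Integration.integral_cong) (auto simp: indicator_def eq)
  also have "\<dots> = (LINT t|lborel. indicator {0..<T} t *\<^sub>R h (y t))"
  proof (rule integral_cong_AE)
    show "AE t in lborel. indicator {0..T} t *\<^sub>R h (y t) = indicator {0..<T} t *\<^sub>R h (y t)"
      using AE_lborel_singleton[of T] by eventually_elim (auto simp: indicator_def)
  qed measurable
  also have "\<dots> = (LINT t|restrict_space lborel {0..<T}. h (y t))"
    by (subst integral_restrict_space) auto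
  finally show ?thesis .
qed

lemma square_integrable_complex_of_real:
  "square_integrable f \<Longrightarrow> square_integrable (\<lambda>x. complex_of_real (f x))"
  by (auto simp: square_integrable_def)

lemma sampling_error_le_phase_integral:
  fixes x :: "real \<Rightarrow> real^'n" and f :: "real^'n \<Rightarrow> real"
  assumes T: "T > 0" and n: "n \<ge> 1" and y: "y \<in> borel_measurable borel" and eq: "\<And>t. t \<in> {0..T} \<Longrightarrow> y t = x t"
    and f: "square_integrable f"
  shows "(\<integral>\<^sup>+z. ennreal ((occupation_time T x (\<lambda>a. f (a + z)) - riemann_estimator T n x (\<lambda>a. f (a + z)))\<^sup>2) \<partial>lborel)
    \<le> ennreal (1 / (2 * pi) ^ CARD('n)) *
      (\<integral>\<^sup>+u. ennreal ((cmod (fourier_L2 (\<lambda>x. complex_of_real (f x)) u))\<^sup>2)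
        * ennreal ((cmod (LINT t|restrict_space lborel {0..<T}. iexp (u \<bullet> y t) - iexp (u \<bullet> y (grid_floor T n t))))\<^sup>2) \<partial>lborel)"
proof -
  let ?\<Lambda> = "restrict_space lborel {0..<T} :: real measure"
  let ?y' = "\<lambda>t. y (grid_floor T n t)"
  let ?f = "\<lambda>x. complex_of_real (f x)" and ?g = "fourier_L2 (\<lambda>x. complex_of_real (f x))"
  let ?K = "\<lambda>u. LINT t|?\<Lambda>. iexp (u \<bullet> y t) - iexp (u \<bullet> ?y' t)"
  note [measurable] = y
  have [measurable]: "f \<in> borel_measurable borel"
    using f by (simp add: square_integrable_def)
  have fin: "finite_measure ?\<Lambda>"
    by (rule finite_measureI) (use T in \<open>simp add: emeasure_restrict_space\<close>)
  interpret finite_measure ?\<Lambda> by (rule fin)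
  have m: "y \<in> borel_measurable ?\<Lambda>" "?y' \<in> borel_measurable ?\<Lambda>"
    by (intro measurable_restrict_space1; measurable)+
  have fsq: "square_integrable ?f"
    by (rule square_integrable_complex_of_real[OF f])
  have err: "complex_of_real (occupation_time T x (\<lambda>a. f (a + z)) - riemann_estimator T n x (\<lambda>a. f (a + z)))
      = translate_avg ?\<Lambda> y ?f z - translate_avg ?\<Lambda> ?y' ?f z" for z
  proof -
    have "riemann_estimator T n x (\<lambda>a. f (a + z)) = (LINT t|?\<Lambda>. f (?y' t + z))"
      unfolding riemann_estimator_eq_integral[OF T n]
    proof (rule Bochner_Integration.integral_cong)
      fix t assume "t \<in> space ?\<Lambda>"
      then have "grid_floor T n t \<in> {0..T}"
        using grid_floor_le[OF mesh_pos[OF T n], of t] grid_floor_nonneg[OF mesh_pos[OF T n], of t] by (auto simp: space_restrict_space)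
      then show "f (x (grid_floor T n t) + z) = f (?y' t + z)"
        by (simp add: eq)
    qed simp
    moreover have "occupation_time T x (\<lambda>a. f (a + z)) = (LINT t|?\<Lambda>. f (y t + z))"
      by (rule occupation_time_eq_integral) (use eq in \<open>auto\<close>)
    ultimately show ?thesis
      by (simp only: translate_avg_def integral_complex_of_real of_real_diff)
  qed
  have "(\<integral>\<^sup>+z. ennreal ((occupation_time T x (\<lambda>a. f (a + z)) - riemann_estimator T n x (\<lambda>a. f (a + z)))\<^sup>2) \<partial>lborel)
      = L2sq (\<lambda>z. translate_avg ?\<Lambda> y ?f z - translate_avg ?\<Lambda> ?y' ?f z)"
    unfolding L2sq_def err[symmetric] norm_of_real power2_abs ..
  also have "\<dots> \<le> ennreal (1 / (2 * pi) ^ CARD('n)) * L2sq (\<lambda>u. (average_phase ?\<Lambda> y u - average_phase ?\<Lambda> ?y' u) * ?g u)"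
    by (rule L2sq_avg_diff_le[OF fin m fsq fourier_L2_is_fourier_L2[OF fsq]])
  also have "L2sq (\<lambda>u. (average_phase ?\<Lambda> y u - average_phase ?\<Lambda> ?y' u) * ?g u)
      = (\<integral>\<^sup>+u. ennreal ((cmod (?g u))\<^sup>2) * ennreal ((cmod (?K u))\<^sup>2) \<partial>lborel)"
    unfolding L2sq_def
  proof (rule nn_integral_cong)
    fix u
    have int: "integrable ?\<Lambda> (\<lambda>t. iexp (u \<bullet> v t))" if "v \<in> borel_measurable ?\<Lambda>" for v :: "real \<Rightarrow> real^'n"
      using that by (intro integrable_const_bound[where B=1]) auto
    have ac: "average_phase ?\<Lambda> v u = cnj (LINT t|?\<Lambda>. iexp (u \<bullet> v t))" for v :: "real \<Rightarrow> real^'n"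
      unfolding average_phase_def Bochner_Integration.integral_cnj[symmetric] by (simp add: exp_cnj)
    have "average_phase ?\<Lambda> y u - average_phase ?\<Lambda> ?y' u = cnj (?K u)"
      unfolding ac Bochner_Integration.integral_diff[OF int[OF m(1)] int[OF m(2)]] by (rule complex_cnj_diff[symmetric])
    then have "cmod ((average_phase ?\<Lambda> y u - average_phase ?\<Lambda> ?y' u) * ?g u) = cmod (?g u) * cmod (?K u)"
      by (simp only: norm_mult complex_mod_cnj mult.commute)
    then show "ennreal ((cmod ((average_phase ?\<Lambda> y u - average_phase ?\<Lambda> ?y' u) * ?g u))\<^sup>2)
        = ennreal ((cmod (?g u))\<^sup>2) * ennreal ((cmod (?K u))\<^sup>2)"
      by (simp only: power_mult_distrib ennreal_mult[OF zero_le_power2 zero_le_power2])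
  qed
  finally show ?thesis .
qed

text \<open>The reduction of the mean square error to a bound, for each frequency, on the second moment of the
  phase integral.  The factor 16 is absorbed in the constant 10 because (2 pi)^d is at least 2.\<close>

lemma mean_square_error_le:
  fixes M :: "'w measure" and X :: "real \<Rightarrow> 'w \<Rightarrow> real^'n" and \<xi> :: "'w \<Rightarrow> real^'n"
    and f :: "real^'n \<Rightarrow> real" and \<mu> :: "real^'n \<Rightarrow> ennreal" and W :: "real^'n \<Rightarrow> ennreal"
  assumes M: "prob_space M" and T: "T > 0" and n: "n \<ge> 1"
    and X: "cadlag_process M T X" and f: "square_integrable f"
    and \<xi>: "\<xi> \<in> borel_measurable M" and ind: "indep_of_process M T X \<xi>" and \<mu>: "distributed M lborel \<xi> \<mu>"
    and W: "\<And>u. (\<integral>\<^sup>+\<omega>. ennreal ((cmod (LINT t|restrict_space lborel {0..<T}.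
        phase_increment (\<lambda>t. X (max 0 (min T t))) T n u t \<omega>))\<^sup>2) \<partial>M) \<le> 16 * W u"
  shows "(\<integral>\<^sup>+\<omega>. ennreal ((occupation_time T (\<lambda>t. X t \<omega>) (\<lambda>x. f (x + \<xi> \<omega>))
                   - riemann_estimator T n (\<lambda>t. X t \<omega>) (\<lambda>x. f (x + \<xi> \<omega>)))\<^sup>2) \<partial>M)
         \<le> ennreal abs_const * esssup lborel \<mu> *
           (\<integral>\<^sup>+u. ennreal ((cmod (fourier_L2 (\<lambda>x. complex_of_real (f x)) u))\<^sup>2) * W u \<partial>lborel)"
proof -
  interpret prob_space M by fact
  let ?Y = "\<lambda>t. X (max 0 (min T t))"
  let ?g = "fourier_L2 (\<lambda>x. complex_of_real (f x))"
  let ?\<Lambda> = "restrict_space lborel {0..<T} :: real measure"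
  let ?K = "\<lambda>\<omega> u. ennreal ((cmod (LINT t|?\<Lambda>. phase_increment ?Y T n u t \<omega>))\<^sup>2)"
  let ?G = "\<lambda>u. ennreal ((cmod (?g u))\<^sup>2)"
  let ?c = "1 / (2 * pi) ^ CARD('n)"
  \<comment> \<open>The sigma-algebra G generated by the path on [0,T]; the process is jointly measurable for it.\<close>
  define P where "P = PiM {0..T} (\<lambda>_. borel :: (real^'n) measure)"
  define path where "path \<omega> = (\<lambda>t\<in>{0..T}. X t \<omega>)" for \<omega>
  define G where "G = vimage_algebra (space M) path P"
  have Xm: "X t \<in> borel_measurable M" if "t \<in> {0..T}" for t
    using X that by (auto simp: cadlag_process_def)
  have rc: "((\<lambda>t. X t \<omega>) \<longlongrightarrow> X t \<omega>) (at_right t)" if "\<omega> \<in> space M" "t \<in> {0..<T}" for \<omega> t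
    using X that by (auto simp: cadlag_process_def cadlag_on_def)
  have pathM: "path \<in> M \<rightarrow>\<^sub>M P"
    unfolding path_def[abs_def] P_def by (intro measurable_restrict Xm)
  have G: "space G = space M" "sets G \<subseteq> sets M"
    unfolding G_def using pathM by (auto intro: sets_image_in_sets[THEN subsetD])
  have pathG: "path \<in> G \<rightarrow>\<^sub>M P"
    unfolding G_def using measurable_space[OF pathM] by (intro measurable_vimage_algebra1) auto
  have XG: "X t \<in> borel_measurable G" if "t \<in> {0..T}" for t
  proof -
    have "(\<lambda>\<omega>. path \<omega> t) \<in> borel_measurable G"
      using measurable_compose[OF pathG[unfolded P_def] measurable_component_singleton[OF that]] .
    then show ?thesis
      using that by (simp add: path_def)
  qed
  have YG: "(\<lambda>(t, \<omega>). ?Y t \<omega>) \<in> borel_measurable (borel \<Otimes>\<^sub>M G)"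
    by (rule right_continuous_process_measurable[OF T XG]) (use rc G in auto)
  have YM: "(\<lambda>(t, \<omega>). ?Y t \<omega>) \<in> borel_measurable (borel \<Otimes>\<^sub>M M)"
    by (rule right_continuous_process_measurable[OF T Xm]) (use rc in auto)
  have Yraw: "(\<lambda>x. ?Y (a x) (b x)) \<in> borel_measurable N" if "a \<in> borel_measurable N" "b \<in> N \<rightarrow>\<^sub>M M" for a b and N :: "'z measure"
    using measurable_compose[OF measurable_Pair[OF that] YM] by simp
  have YrawG: "(\<lambda>x. ?Y (a x) (b x)) \<in> borel_measurable N" if "a \<in> borel_measurable N" "b \<in> N \<rightarrow>\<^sub>M G" for a b and N :: "'z measure"
    using measurable_compose[OF measurable_Pair[OF that] YG] by simp
  have YX: "?Y t = X t" if "t \<in> {0..T}" for t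
    using that by simp
  have [measurable]: "f \<in> borel_measurable borel"
    using f by (simp add: square_integrable_def)
  have gm [measurable]: "?g \<in> borel_measurable borel"
    using fourier_L2_is_fourier_L2[OF square_integrable_complex_of_real[OF f]]
    by (simp add: is_fourier_L2_def square_integrable_def)
  define Err where "Err \<omega> z = occupation_time T (\<lambda>t. X t \<omega>) (\<lambda>x. f (x + z)) - riemann_estimator T n (\<lambda>t. X t \<omega>) (\<lambda>x. f (x + z))" for \<omega> z
  have mErr: "(\<lambda>(\<omega>, z). Err \<omega> z) \<in> borel_measurable (G \<Otimes>\<^sub>M borel)"
  proof -
    have "(\<lambda>(\<omega>, z). occupation_time T (\<lambda>t. X t \<omega>) (\<lambda>x. f (x + z))) = (\<lambda>(\<omega>, z). LINT t|lborel. indicator {0..T} t *\<^sub>R f (?Y t \<omega> + z))"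
      unfolding occupation_time_def set_lebesgue_integral_def
      by (auto simp: fun_eq_iff indicator_def intro!: Bochner_Integration.integral_cong)
    also have "\<dots> \<in> borel_measurable (G \<Otimes>\<^sub>M borel)"
      using YrawG[measurable (raw)] by measurable
    finally have [measurable]: "(\<lambda>(\<omega>, z). occupation_time T (\<lambda>t. X t \<omega>) (\<lambda>x. f (x + z))) \<in> borel_measurable (G \<Otimes>\<^sub>M borel)" .
    have "(\<lambda>(\<omega>, z). f (X (real (k - 1) * mesh T n) \<omega> + z)) \<in> borel_measurable (G \<Otimes>\<^sub>M borel)" if "k \<in> {1..n}" for k
    proof -
      have "real (k - 1) * mesh T n \<le> real n * mesh T n" "0 \<le> real (k - 1) * mesh T n"
        using that mesh_pos[OF T n] by (auto intro!: mult_right_mono)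
      moreover have "real n * mesh T n = T"
        using n by (simp add: mesh_def)
      ultimately have "real (k - 1) * mesh T n \<in> {0..T}"
        by simp
      note [measurable] = XG[OF this]
      show ?thesis by measurable
    qed
    then have [measurable]: "(\<lambda>(\<omega>, z). riemann_estimator T n (\<lambda>t. X t \<omega>) (\<lambda>x. f (x + z))) \<in> borel_measurable (G \<Otimes>\<^sub>M borel)"
      unfolding riemann_estimator_def split_beta by (intro borel_measurable_times borel_measurable_const borel_measurable_sum)
    show ?thesis
      unfolding Err_def split_beta by measurable
  qed
  have "(\<integral>\<^sup>+\<omega>. ennreal ((Err \<omega> (\<xi> \<omega>))\<^sup>2) \<partial>M) \<le> esssup lborel \<mu> * (\<integral>\<^sup>+\<omega>. \<integral>\<^sup>+z. ennreal ((Err \<omega> z)\<^sup>2) \<partial>lborel \<partial>M)"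
  proof (rule nn_integral_indep_le[OF M G \<xi> _ \<mu>])
    show "indep_set (sets G) (sets (vimage_algebra (space M) \<xi> borel))"
      using ind unfolding indep_of_process_def G_def path_def[abs_def] P_def .
    show "(\<lambda>(\<omega>, z). ennreal ((Err \<omega> z)\<^sup>2)) \<in> borel_measurable (G \<Otimes>\<^sub>M borel)"
      using mErr unfolding split_beta by measurable
  qed
  also have "(\<integral>\<^sup>+\<omega>. \<integral>\<^sup>+z. ennreal ((Err \<omega> z)\<^sup>2) \<partial>lborel \<partial>M)
      \<le> (\<integral>\<^sup>+\<omega>. ennreal ?c * (\<integral>\<^sup>+u. ?G u * ?K \<omega> u \<partial>lborel) \<partial>M)"
  proof (rule nn_integral_mono)
    fix \<omega> assume w: "\<omega> \<in> space M"
    have "(\<lambda>t. ?Y t \<omega>) \<in> borel_measurable borel"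
      by (rule Yraw) (use w in auto)
    then show "(\<integral>\<^sup>+z. ennreal ((Err \<omega> z)\<^sup>2) \<partial>lborel)
        \<le> ennreal ?c * (\<integral>\<^sup>+u. ?G u * ?K \<omega> u \<partial>lborel)"
      unfolding Err_def phase_increment_def
      by (rule sampling_error_le_phase_integral[OF T n _ _ f]) (simp add: YX)
  qed
  also have "\<dots> = ennreal ?c * (\<integral>\<^sup>+u. ?G u * (\<integral>\<^sup>+\<omega>. ?K \<omega> u \<partial>M) \<partial>lborel)"
  proof -
    have "(\<lambda>(\<omega>, u). LINT t|?\<Lambda>. phase_increment ?Y T n u t \<omega>) = (\<lambda>(\<omega>, u). LINT t|lborel. indicator {0..<T} t *\<^sub>R phase_increment ?Y T n u t \<omega>)"
      by (simp add: integral_restrict_space)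
    also have "\<dots> \<in> borel_measurable (M \<Otimes>\<^sub>M borel)"
      unfolding phase_increment_def using Yraw[measurable (raw)] by measurable
    finally have K [measurable]: "(\<lambda>(\<omega>, u). LINT t|?\<Lambda>. phase_increment ?Y T n u t \<omega>) \<in> borel_measurable (M \<Otimes>\<^sub>M borel)" .
    have [measurable (raw)]: "(\<lambda>x. LINT t|?\<Lambda>. phase_increment ?Y T n (b x) t (a x)) \<in> borel_measurable N" if "a \<in> N \<rightarrow>\<^sub>M M" "b \<in> borel_measurable N" for a b and N :: "'z measure"
      using measurable_compose[OF measurable_Pair[OF that] K] by simp
    interpret pair_sigma_finite M "lborel :: (real^'n) measure" ..
    have "(\<integral>\<^sup>+\<omega>. ennreal ?c * (\<integral>\<^sup>+u. ?G u * ?K \<omega> u \<partial>lborel) \<partial>M)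
        = ennreal ?c * (\<integral>\<^sup>+\<omega>. \<integral>\<^sup>+u. ?G u * ?K \<omega> u \<partial>lborel \<partial>M)"
      by (rule nn_integral_cmult) measurable
    also have "(\<integral>\<^sup>+\<omega>. \<integral>\<^sup>+u. ?G u * ?K \<omega> u \<partial>lborel \<partial>M)
        = (\<integral>\<^sup>+u. \<integral>\<^sup>+\<omega>. ?G u * ?K \<omega> u \<partial>M \<partial>lborel)"
      by (rule Fubini'[symmetric]) measurable
    also have "\<dots> = (\<integral>\<^sup>+u. ?G u * (\<integral>\<^sup>+\<omega>. ?K \<omega> u \<partial>M) \<partial>lborel)"
      by (intro nn_integral_cong nn_integral_cmult) measurable
    finally show ?thesis .
  qed
  also have "(\<integral>\<^sup>+u. ?G u * (\<integral>\<^sup>+\<omega>. ?K \<omega> u \<partial>M) \<partial>lborel)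
      \<le> (\<integral>\<^sup>+u. ennreal 16 * (?G u * W u) \<partial>lborel)"
  proof (rule nn_integral_mono)
    fix u
    show "?G u * (\<integral>\<^sup>+\<omega>. ?K \<omega> u \<partial>M)
        \<le> ennreal 16 * (?G u * W u)"
      using mult_left_mono[OF W[of u] zero_le, of "?G u"] by (simp add: mult.left_commute)
  qed
  also have "\<dots> \<le> ennreal 16 * (\<integral>\<^sup>+u. ?G u * W u \<partial>lborel)"
    by (rule nn_integral_cmult_le) simp
  finally have "(\<integral>\<^sup>+\<omega>. ennreal ((Err \<omega> (\<xi> \<omega>))\<^sup>2) \<partial>M)
      \<le> esssup lborel \<mu> * (ennreal ?c * (ennreal 16 * (\<integral>\<^sup>+u. ?G u * W u \<partial>lborel)))"
    by (simp add: mult_left_mono)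
  also have "\<dots> = ennreal (?c * 16) * (esssup lborel \<mu> * (\<integral>\<^sup>+u. ?G u * W u \<partial>lborel))"
    by (subst ennreal_mult) (auto simp only: mult_ac zero_le_divide_1_iff zero_le_power pi_ge_zero mult_nonneg_nonneg zero_le_numeral)
  also have "\<dots> \<le> ennreal abs_const * (esssup lborel \<mu> * (\<integral>\<^sup>+u. ?G u * W u \<partial>lborel))"
  proof (intro mult_right_mono ennreal_leI)
    have "2 \<le> 2 * pi"
      using pi_gt3 by simp
    also have "2 * pi \<le> (2 * pi) ^ CARD('n)"
      using pi_gt3 by (intro self_le_power) auto
    finally show "?c * 16 \<le> abs_const"
      by (simp add: abs_const_def field_simps)
  qed auto
  finally show ?thesis
    unfolding Err_def by (simp add: mult.assoc)
qed

theorem proposition2: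
  fixes M :: "'w measure"
    and X :: "real \<Rightarrow> 'w \<Rightarrow> real^'n"
    and \<xi> :: "'w \<Rightarrow> real^'n"
    and f :: "real^'n \<Rightarrow> real"
    and \<mu> :: "real^'n \<Rightarrow> ennreal"
    and T :: real and n :: nat
  assumes "prob_space M"
    and "T > 0" and "n \<ge> 1"
    and "cadlag_process M T X"
    and "square_integrable f"
    and "\<xi> \<in> borel_measurable M"
    and "indep_of_process M T X \<xi>"
    and "distributed M lborel \<xi> \<mu>"
    and "esssup lborel \<mu> < \<infinity>"
    and "(\<lambda>(u, t, v, t'). joint_char M X u t v t')
           \<in> borel_measurable (restrict_space borel (UNIV \<times> {0..T} \<times> UNIV \<times> {0..T}))"
    and "\<And>u v t t'. 0 < t \<Longrightarrow> t < t' \<Longrightarrow> t' < T \<Longrightarrow>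
           (\<lambda>s. joint_char M X u t v s) differentiable (at t')"
    and "\<And>u v. (\<lambda>(t, t'). d2_char M X u t v t') absolutely_integrable_on off_diagonal T n"
  shows "0 < abs_const
    \<and> (\<integral>\<^sup>+\<omega>. ennreal ((occupation_time T (\<lambda>t. X t \<omega>) (\<lambda>x. f (x + \<xi> \<omega>))
                   - riemann_estimator T n (\<lambda>t. X t \<omega>) (\<lambda>x. f (x + \<xi> \<omega>)))\<^sup>2) \<partial>M)
         \<le> ennreal abs_const * esssup lborel \<mu> *
           (\<integral>\<^sup>+u. ennreal ((cmod (fourier_L2 (\<lambda>x. complex_of_real (f x)) u))\<^sup>2)
                  * (w_term M X T n u + v_term M X T n u) \<partial>lborel)
    \<and> ((\<forall>u v t t'. 0 < t \<and> t < t' \<and> t' < T \<longrightarrow>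
              (\<lambda>s. d2_char M X u s v t') differentiable (at t)) \<and>
       (\<forall>u v. (\<lambda>(t, t'). d12_char M X u t v t') absolutely_integrable_on off_diagonal T n)
       \<longrightarrow> (\<integral>\<^sup>+\<omega>. ennreal ((occupation_time T (\<lambda>t. X t \<omega>) (\<lambda>x. f (x + \<xi> \<omega>))
                   - riemann_estimator T n (\<lambda>t. X t \<omega>) (\<lambda>x. f (x + \<xi> \<omega>)))\<^sup>2) \<partial>M)
         \<le> ennreal abs_const * esssup lborel \<mu> *
           (\<integral>\<^sup>+u. ennreal ((cmod (fourier_L2 (\<lambda>x. complex_of_real (f x)) u))\<^sup>2)
                  * (w_term M X T n u + v_tilde_term M X T n u) \<partial>lborel))"
proof -
  let ?Y = "\<lambda>t. X (max 0 (min T t))"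
  have YM: "(\<lambda>(t, \<omega>). ?Y t \<omega>) \<in> borel_measurable (borel \<Otimes>\<^sub>M M)"
    using assms(4) by (intro right_continuous_process_measurable[OF assms(2)]) (auto simp: cadlag_process_def cadlag_on_def)
  have YX: "?Y t = X t" if "t \<in> {0..T}" for t
    using that by simp
  note second_moment = second_moment_phase_integral_le[OF assms(1) YM YX assms(2,3,11)]
  note error = mean_square_error_le[OF assms(1-8)]
  show ?thesis
  proof (intro conjI impI, goal_cases)
    case 1
    show ?case
      by (simp add: abs_const_def)
  next
    case 2
    show ?case
      by (rule error, rule second_moment)
  next
    case 3
    then have "v_term M X T n u \<le> v_tilde_term M X T n u" for u
      by (intro v_term_le_v_tilde_term[OF assms(1) YM YX assms(2,3,11)]) auto
    then have le: "16 * (w_term M X T n u + v_term M X T n u) \<le> 16 * (w_term M X T n u + v_tilde_term M X T n u)" for u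
      by (intro mult_left_mono add_left_mono) auto
    show ?case
      by (rule error, rule order_trans[OF second_moment le])
  qed
qed

end
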